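(* Let $n\ge2$ be an integer, let $\Omega=\{(x,y)\in(0,+\infty)^2\colon y<(\tan(\pi/2^n))\,x\}$ be the sector of angle $\pi/2^n$, let $\bullet\in\{D,N\}$, let $V\in L^\infty(\Omega)$ be real-valued, let $G>0$, $\delta\in(0,G/2)$, let $S\subset\mathbb{R}^2$ be $(G,\delta)$-equidistributed, and let $\omega=\Omega\cap S$. Then the system $$\partial_tu(t)+(-\Delta^\bullet_\Omega+V)u(t)=\chi_\omega v(t)\quad(0<t<T),\qquad u(0)=u_0\in L^2(\Omega),$$ is null-controllable in any time $T>0$ with control cost $$C_T\le\left(\frac{\delta}{\tilde G}\right)^{-D\cdot(1+\tilde G^{4/3}\|V\|_\infty^{2/3})}\frac{D}{\sqrt T}\exp\left(\frac{D\tilde G^2\ln^2(\delta/\tilde G)}{2T}+\|V_-\|_\infty T\right),$$ where $\tilde G=4^{n-1}G$, $V_-=\max\{-V,0\}$, and $D=D(2)$ is the constant described in the context for dimension $d=2$.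
   Context: Equidistributed sets: let $G>0$, $\delta\in(0,G/2)$. A measurable set $S\subset\mathbb{R}^d$ is $(G,\delta)$-equidistributed if $S\supset\bigcup_{j\in\mathbb{Z}^d}B(z_j,\delta)$ for some $(z_j)_{j\in\mathbb{Z}^d}\subset\mathbb{R}^d$ with $B(z_j,\delta)\subset Gj+(0,G)^d$ for all $j\in\mathbb{Z}^d$, where $B(z,\delta)$ is the open Euclidean ball of radius $\delta$ around $z$. The superscript $\bullet\in\{D,N\}$ stands for Dirichlet or Neumann boundary conditions: $-\Delta_\Omega^\bullet+V$ is the lower semibounded self-adjoint operator on $L^2(\Omega)$ associated with the form $\int_\Omega\langle\nabla f,\nabla g\rangle_{\mathbb{C}^d}\,dx+\langle Vf,g\rangle_{L^2(\Omega)}$ with form domain $H_0^1(\Omega)$ (Dirichlet) or $H^1(\Omega)$ (Neumann). With $H=-\Delta_\Omega^\bullet+V$, the system $\partial_tu+Hu=\chi_\omega v$, $u(0)=u_0$, is null-controllable in time $T>0$ if for every $u_0\in L^2(\Omega)$ there is $v\in L^2((0,T),L^2(\Omega))$ with $(\ast)$ $e^{-TH}u_0+\int_0^Te^{-(T-s)H}\chi_\omega v(s)\,ds=0$. Its control cost is $C_T=\sup_{\|u_0\|_{L^2(\Omega)}=1}\inf\{\|v\|_{L^2((0,T),L^2(\omega))}\colon v\text{ satisfies }(\ast)\}$. The constants $D(d)$: for each $d\in\mathbb{N}$, $D(d)>0$ is a constant depending only on $d$ with the following property (such constants are known to exist from earlier work). For all $G>0$, $\delta\in(0,G/2)$, every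 domain $\tilde\Omega=\prod_{j=1}^d(\alpha_j,\beta_j)$ with $\alpha_j,\beta_j\in\mathbb{R}\cup\{\pm\infty\}$, $\alpha_j<\beta_j$, and $(0,G)^d\subset\tilde\Omega$, every real-valued $V\in L^\infty(\tilde\Omega)$, either boundary condition, and every $(G,\delta)$-equidistributed set $S\subset\mathbb{R}^d$, the system $\partial_tu+(-\Delta^\bullet_{\tilde\Omega}+V)u=\chi_{\tilde\Omega\cap S}v$ is null-controllable in any time $T>0$ with control cost (with $D=D(d)$) $$C_T\le\left(\frac{\delta}{G}\right)^{-D\cdot(1+G^{4/3}\|V\|_\infty^{2/3})}\frac{D}{\sqrt T}\exp\left(\frac{DG^2\ln^2(\delta/G)}{2T}+\|V_-\|_\infty T\right).$$ *)

theory Defs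
  imports "HOL-Probability.Essential_Supremum"
begin

text \<open>
  The Hilbert space \<open>'a L2\<close> of complex-valued Lebesgue square-integrable functions on the whole
  space, modulo equality almost everywhere. The space \<open>L\<^sup>2(\<Omega>)\<close> is the subspace \<open>L2_on \<Omega>\<close> below.
  The instances \<open>banach\<close> and \<open>second_countable_topology\<close> make the library's Bochner integral
  available for functions with values in \<open>'a L2\<close>.
\<close>

definition sq_integrable :: "('a::euclidean_space \<Rightarrow> complex) \<Rightarrow> bool" where
  "sq_integrable f \<longleftrightarrow>
     f \<in> borel_measurable lebesgue \<and> integrable lebesgue (\<lambda>x. (cmod (f x))\<^sup>2)"

lemma sq_integrableD:
  assumes "sq_integrable f"
  shows "f \<in> borel_measurable lebesgue" "integrable lebesgue (\<lambda>x. (cmod (f x))\<^sup>2)"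
  using assms by (auto simp: sq_integrable_def)

lemma sq_integrable_dominated:
  assumes "sq_integrable f" "g \<in> borel_measurable lebesgue" "\<And>x. cmod (g x) \<le> c * cmod (f x)"
  shows "sq_integrable g"
  unfolding sq_integrable_def
proof
  note [measurable] = assms(2)
  show "integrable lebesgue (\<lambda>x. (cmod (g x))\<^sup>2)"
  proof (rule Bochner_Integration.integrable_bound)
    show "integrable lebesgue (\<lambda>x. c\<^sup>2 * (cmod (f x))\<^sup>2)"
      using sq_integrableD(2)[OF assms(1)] by simp
    show "AE x in lebesgue. norm ((cmod (g x))\<^sup>2) \<le> norm (c\<^sup>2 * (cmod (f x))\<^sup>2)"
      using power_mono[OF assms(3), of _ 2] by (auto simp: power_mult_distrib)
  qed measurable
qed fact

lemma sq_integrable_zero: "sq_integrable (\<lambda>x. 0)"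
  by (simp add: sq_integrable_def)

lemma sq_integrable_add:
  assumes "sq_integrable f" "sq_integrable g"
  shows "sq_integrable (\<lambda>x. f x + g x)"
  unfolding sq_integrable_def
proof
  note [measurable] = sq_integrableD(1)[OF assms(1)] sq_integrableD(1)[OF assms(2)]
  show "(\<lambda>x. f x + g x) \<in> borel_measurable lebesgue" by measurable
  show "integrable lebesgue (\<lambda>x. (cmod (f x + g x))\<^sup>2)"
  proof (rule Bochner_Integration.integrable_bound)
    show "integrable lebesgue (\<lambda>x. 2 * (cmod (f x))\<^sup>2 + 2 * (cmod (g x))\<^sup>2)"
      using sq_integrableD(2)[OF assms(1)] sq_integrableD(2)[OF assms(2)] by simp
    have "(cmod (f x + g x))\<^sup>2 \<le> 2 * (cmod (f x))\<^sup>2 + 2 * (cmod (g x))\<^sup>2" for x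
    proof -
      have "(cmod (f x + g x))\<^sup>2 \<le> (cmod (f x) + cmod (g x))\<^sup>2"
        by (intro power_mono norm_triangle_ineq) auto
      also have "\<dots> \<le> 2 * (cmod (f x))\<^sup>2 + 2 * (cmod (g x))\<^sup>2"
        using sum_squares_bound[of "cmod (f x)" "cmod (g x)"] by (simp add: power2_sum)
      finally show ?thesis .
    qed
    then show "AE x in lebesgue. norm ((cmod (f x + g x))\<^sup>2)
        \<le> norm (2 * (cmod (f x))\<^sup>2 + 2 * (cmod (g x))\<^sup>2)"
      by simp
  qed measurable
qed

lemma sq_integrable_cmult:
  assumes "sq_integrable f"
  shows "sq_integrable (\<lambda>x. c * f x)"
  using sq_integrableD[OF assms]
  by (intro sq_integrable_dominated[OF assms, where c = "cmod c"]) (auto simp: norm_mult)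

lemma sq_integrable_minus: "sq_integrable f \<Longrightarrow> sq_integrable (\<lambda>x. - f x)"
  using sq_integrable_cmult[of f "-1"] by simp

lemma sq_integrable_scaleR: "sq_integrable f \<Longrightarrow> sq_integrable (\<lambda>x. r *\<^sub>R f x)"
  using sq_integrable_cmult[of f "of_real r"] by (simp add: scaleR_conv_of_real)

lemma sq_integrable_diff:
  "sq_integrable f \<Longrightarrow> sq_integrable g \<Longrightarrow> sq_integrable (\<lambda>x. f x - g x)"
  using sq_integrable_add[of f "\<lambda>x. - g x"] sq_integrable_minus[of g] by simp

lemma sq_integrable_indicator:
  assumes "sq_integrable f" "A \<in> sets lebesgue"
  shows "sq_integrable (\<lambda>x. indicator A x * f x)"
proof (rule sq_integrable_dominated[OF assms(1), where c = 1])
  note [measurable] = sq_integrableD(1)[OF assms(1)] assms(2)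
  show "(\<lambda>x. indicator A x * f x) \<in> borel_measurable lebesgue" by measurable
qed (auto simp: indicator_def)

lemma sq_integrable_mult_integrable:
  assumes "sq_integrable f" "sq_integrable g"
  shows "integrable lebesgue (\<lambda>x. f x * cnj (g x))"
proof (rule Bochner_Integration.integrable_bound)
  note [measurable] = sq_integrableD(1)[OF assms(1)] sq_integrableD(1)[OF assms(2)]
  show "integrable lebesgue (\<lambda>x. (cmod (f x))\<^sup>2 + (cmod (g x))\<^sup>2)"
    using sq_integrableD(2)[OF assms(1)] sq_integrableD(2)[OF assms(2)] by simp
  have "cmod (f x) * cmod (g x) \<le> (cmod (f x))\<^sup>2 + (cmod (g x))\<^sup>2" for x
    using sum_squares_bound[of "cmod (f x)" "cmod (g x)"]
      mult_nonneg_nonneg[OF norm_ge_zero[of "f x"] norm_ge_zero[of "g x"]] by linarith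
  then show "AE x in lebesgue. norm (f x * cnj (g x)) \<le> norm ((cmod (f x))\<^sup>2 + (cmod (g x))\<^sup>2)"
    by (simp add: norm_mult)
  have "(\<lambda>x. cnj (g x)) \<in> borel_measurable lebesgue"
    using measurable_compose[OF sq_integrableD(1)[OF assms(2)]
        borel_measurable_continuous_onI[OF continuous_on_cnj[OF continuous_on_id]]] by simp
  then show "(\<lambda>x. f x * cnj (g x)) \<in> borel_measurable lebesgue" by measurable
qed

quotient_type (overloaded) 'a L2 = "'a::euclidean_space \<Rightarrow> complex" / partial:
  "\<lambda>f g. sq_integrable f \<and> sq_integrable g \<and> (AE x in lebesgue. f x = g x)"
proof (rule part_equivpI)
  show "\<exists>f. sq_integrable f \<and> sq_integrable f \<and> (AE x in lebesgue. f x = f x)"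
    using sq_integrable_zero by auto
  show "symp (\<lambda>f g. sq_integrable f \<and> sq_integrable g \<and> (AE x in lebesgue. f x = g x))"
    by (rule sympI) (auto elim: eventually_mono)
  show "transp (\<lambda>f g. sq_integrable f \<and> sq_integrable g \<and> (AE x in lebesgue. f x = g x))"
    by (rule transpI) fastforce
qed

lemma sq_integrable_rep [simp]: "sq_integrable (rep_L2 u)"
  using Quotient_rep_reflp[OF Quotient_L2, of u] by blast

lemma abs_rep_L2 [simp]: "abs_L2 (rep_L2 u) = u"
  by (rule Quotient_abs_rep[OF Quotient_L2])

lemma rep_abs_L2:
  assumes "sq_integrable f" shows "AE x in lebesgue. rep_L2 (abs_L2 f) x = f x"
  using Quotient_rep_abs[OF Quotient_L2, of f] assms by blast

lemma abs_L2_eqI: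
  "sq_integrable f \<Longrightarrow> sq_integrable g \<Longrightarrow> (AE x in lebesgue. f x = g x) \<Longrightarrow> abs_L2 f = abs_L2 g"
  using Quotient_rel_abs[OF Quotient_L2, of f g] by blast

lemma L2_eq_iff: "u = v \<longleftrightarrow> (AE x in lebesgue. rep_L2 u x = rep_L2 v x)"
  using abs_L2_eqI[OF sq_integrable_rep sq_integrable_rep, of u v] by auto

lift_definition cscale :: "complex \<Rightarrow> 'a::euclidean_space L2 \<Rightarrow> 'a L2" is
  "\<lambda>c f x. c * f x"
  by (auto intro: sq_integrable_cmult elim: eventually_mono)

lift_definition cinner :: "'a::euclidean_space L2 \<Rightarrow> 'a L2 \<Rightarrow> complex" is
  "\<lambda>f g. LINT x|lebesgue. f x * cnj (g x)"
proof (goal_cases)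
  case (1 f f' g g')
  then have "AE x in lebesgue. f x = f' x" "AE x in lebesgue. g x = g' x" by auto
  then have "AE x in lebesgue. f x * cnj (g x) = f' x * cnj (g' x)"
    by eventually_elim simp
  moreover have "(\<lambda>x. f x * cnj (g x)) \<in> borel_measurable lebesgue"
    "(\<lambda>x. f' x * cnj (g' x)) \<in> borel_measurable lebesgue"
    using 1 by (auto dest: sq_integrable_mult_integrable)
  ultimately show ?case by (intro integral_cong_AE)
qed

instantiation L2 :: (euclidean_space) real_vector
begin
lift_definition zero_L2 :: "'a L2" is "\<lambda>x. 0" by (simp add: sq_integrable_zero)
lift_definition plus_L2 :: "'a L2 \<Rightarrow> 'a L2 \<Rightarrow> 'a L2" is "\<lambda>f g x. f x + g x"
  by (auto intro: sq_integrable_add)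
lift_definition minus_L2 :: "'a L2 \<Rightarrow> 'a L2 \<Rightarrow> 'a L2" is "\<lambda>f g x. f x - g x"
  by (auto intro: sq_integrable_diff)
lift_definition uminus_L2 :: "'a L2 \<Rightarrow> 'a L2" is "\<lambda>f x. - f x"
  by (auto intro: sq_integrable_minus elim: eventually_mono)
lift_definition scaleR_L2 :: "real \<Rightarrow> 'a L2 \<Rightarrow> 'a L2" is "\<lambda>r f x. r *\<^sub>R f x"
  by (auto intro: sq_integrable_scaleR elim: eventually_mono)
instance
proof
  fix u v w :: "'a L2" and r s :: real
  note sq = sq_integrable_add sq_integrable_diff sq_integrable_scaleR sq_integrable_minus
    sq_integrable_zero
  show "u + v + w = u + (v + w)" by transfer (auto intro!: sq simp: add.assoc)
  show "u + v = v + u" by transfer (auto intro!: sq simp: add.commute)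
  show "0 + u = u" by transfer (auto intro!: sq)
  show "- u + u = 0" by transfer (auto intro!: sq)
  show "u - v = u + - v" by transfer (auto intro!: sq)
  show "r *\<^sub>R (u + v) = r *\<^sub>R u + r *\<^sub>R v" by transfer (auto intro!: sq simp: scaleR_add_right)
  show "(r + s) *\<^sub>R u = r *\<^sub>R u + s *\<^sub>R u" by transfer (auto intro!: sq simp: scaleR_add_left)
  show "r *\<^sub>R s *\<^sub>R u = (r * s) *\<^sub>R u" by transfer (auto intro!: sq)
  show "1 *\<^sub>R u = u" by transfer auto
qed
end

lemma rep_L2_add: "AE x in lebesgue. rep_L2 (u + v) x = rep_L2 u x + rep_L2 v x"
  unfolding plus_L2_def by (auto intro!: rep_abs_L2 sq_integrable_add)

lemma rep_L2_diff: "AE x in lebesgue. rep_L2 (u - v) x = rep_L2 u x - rep_L2 v x"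
  unfolding minus_L2_def by (auto intro!: rep_abs_L2 sq_integrable_diff)

lemma cinner_rep: "cinner u v = (LINT x|lebesgue. rep_L2 u x * cnj (rep_L2 v x))"
  by (simp add: cinner_def)

instantiation L2 :: (euclidean_space) real_inner
begin
definition inner_L2 :: "'a L2 \<Rightarrow> 'a L2 \<Rightarrow> real" where
  "inner_L2 u v = Re (cinner u v)"
definition norm_L2 :: "'a L2 \<Rightarrow> real" where
  "norm_L2 u = sqrt (inner u u)"
definition dist_L2 :: "'a L2 \<Rightarrow> 'a L2 \<Rightarrow> real" where
  "dist_L2 u v = norm (u - v)"
definition sgn_L2 :: "'a L2 \<Rightarrow> 'a L2" where
  "sgn_L2 u = inverse (norm u) *\<^sub>R u"
definition uniformity_L2 :: "('a L2 \<times> 'a L2) filter" where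
  "uniformity_L2 = (INF e\<in>{0<..}. principal {(u, v). dist u v < e})"
definition open_L2 :: "'a L2 set \<Rightarrow> bool" where
  "open_L2 U \<longleftrightarrow> (\<forall>u\<in>U. \<forall>\<^sub>F (u', v) in uniformity. u' = u \<longrightarrow> v \<in> U)"

lemma inner_L2_rep: "inner u v = (LINT x|lebesgue. Re (rep_L2 u x * cnj (rep_L2 v x)))"
  unfolding inner_L2_def cinner_rep
  by (subst integral_Re) (auto intro: sq_integrable_mult_integrable)

lemma integrable_inner_L2: "integrable lebesgue (\<lambda>x. Re (rep_L2 u x * cnj (rep_L2 v x)))"
  by (intro integrable_Re sq_integrable_mult_integrable) auto

lemma inner_L2_abs:
  assumes "sq_integrable f" "sq_integrable g"
  shows "inner (abs_L2 f) (abs_L2 g) = (LINT x|lebesgue. Re (f x * cnj (g x)))"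
proof -
  have "cinner (abs_L2 f) (abs_L2 g) = (LINT x|lebesgue. f x * cnj (g x))"
    using assms by (simp add: cinner.abs_eq)
  then show ?thesis
    unfolding inner_L2_def
    by (subst integral_Re) (auto intro: sq_integrable_mult_integrable assms)
qed

lemma inner_L2_self: "inner u u = (LINT x|lebesgue. (cmod (rep_L2 u x))\<^sup>2)"
  unfolding inner_L2_rep by (simp add: complex_norm_square[symmetric] flip: of_real_power)

instance
proof
  fix u v w :: "'a L2" and r :: real
  show "dist u v = norm (u - v)" by (rule dist_L2_def)
  show "sgn u = inverse (norm u) *\<^sub>R u" by (rule sgn_L2_def)
  show "uniformity = (INF e\<in>{0<..}. principal {(u :: 'a L2, v). dist u v < e})"
    by (rule uniformity_L2_def)
  show "open U \<longleftrightarrow> (\<forall>u\<in>U. \<forall>\<^sub>F (u', v) in uniformity. u' = u \<longrightarrow> v \<in> U)" for U :: "'a L2 set"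
    by (rule open_L2_def)
  show "inner u v = inner v u"
    unfolding inner_L2_rep by (simp add: mult.commute)
  show "inner (u + v) w = inner u w + inner v w"
  proof -
    have "inner (u + v) w =
        (LINT x|lebesgue. Re (rep_L2 u x * cnj (rep_L2 w x)) + Re (rep_L2 v x * cnj (rep_L2 w x)))"
      unfolding inner_L2_rep
      by (rule integral_cong_AE)
         (use rep_L2_add[of u v] in \<open>auto elim!: eventually_mono simp: distrib_right
            intro!: borel_measurable_integrable integrable_inner_L2
              Bochner_Integration.integrable_add simp del: times_complex.sel\<close>)
    also have "\<dots> = inner u w + inner v w"
      unfolding inner_L2_rep by (intro Bochner_Integration.integral_add integrable_inner_L2)
    finally show ?thesis .
  qed
  show "inner (r *\<^sub>R u) v = r * inner u v"
  proof -
    have "AE x in lebesgue. rep_L2 (r *\<^sub>R u) x = r *\<^sub>R rep_L2 u x"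
      unfolding scaleR_L2_def by (auto intro!: rep_abs_L2 sq_integrable_scaleR)
    then have "inner (r *\<^sub>R u) v = (LINT x|lebesgue. r * Re (rep_L2 u x * cnj (rep_L2 v x)))"
      unfolding inner_L2_rep
      by (intro integral_cong_AE)
         (auto elim!: eventually_mono intro!: borel_measurable_times
            borel_measurable_integrable integrable_inner_L2 simp del: times_complex.sel)
    then show ?thesis unfolding inner_L2_rep by simp
  qed
  show "0 \<le> inner u u" unfolding inner_L2_self by simp
  show "inner u u = 0 \<longleftrightarrow> u = 0"
  proof -
    have "AE x in lebesgue. rep_L2 (0 :: 'a L2) x = 0"
      unfolding zero_L2_def by (auto intro!: rep_abs_L2 sq_integrable_zero)
    then have *: "(AE x in lebesgue. rep_L2 u x = rep_L2 (0 :: 'a L2) x) \<longleftrightarrow> (AE x in lebesgue. rep_L2 u x = 0)"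
      by auto
    show ?thesis
      unfolding inner_L2_self L2_eq_iff[of u 0] *
      by (subst integral_nonneg_eq_0_iff_AE) (use sq_integrableD(2)[OF sq_integrable_rep[of u]] in auto)
  qed
  show "norm u = sqrt (inner u u)" by (rule norm_L2_def)
qed
end

lemma norm_abs_L2:
  assumes "sq_integrable f"
  shows "(norm (abs_L2 f))\<^sup>2 = (LINT x|lebesgue. (cmod (f x))\<^sup>2)"
  unfolding power2_norm_eq_inner[of "abs_L2 f"] inner_L2_abs[OF assms assms]
  by (simp add: complex_norm_square[symmetric] flip: of_real_power)

lemma abs_L2_diff:
  "sq_integrable f \<Longrightarrow> sq_integrable g \<Longrightarrow> abs_L2 f - abs_L2 g = abs_L2 (\<lambda>x. f x - g x)"
  by (simp add: minus_L2.abs_eq)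

lemma norm_rep_L2: "(norm u)\<^sup>2 = (LINT x|lebesgue. (cmod (rep_L2 u x))\<^sup>2)"
  by (simp add: power2_norm_eq_inner inner_L2_self)

lemma norm_L2_nn: "ennreal ((norm u)\<^sup>2) = (\<integral>\<^sup>+x. ennreal ((cmod (rep_L2 u x))\<^sup>2) \<partial>lebesgue)"
  unfolding norm_rep_L2
  by (rule nn_integral_eq_integral[symmetric]) (use sq_integrableD(2)[OF sq_integrable_rep[of u]] in auto)


lemma Fatou_L2:
  fixes f :: "nat \<Rightarrow> 'a::euclidean_space \<Rightarrow> complex"
  assumes f: "\<And>j. sq_integrable (f j)" and h: "h \<in> borel_measurable lebesgue"
    and lim: "AE x in lebesgue. (\<lambda>j. f j x) \<longlonglongrightarrow> h x"
    and bound: "\<And>j. j \<ge> N \<Longrightarrow> norm (abs_L2 (f j)) \<le> e"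
  shows "sq_integrable h" "norm (abs_L2 h) \<le> e"
proof -
  note [measurable] = h sq_integrableD(1)[OF f]
  have e: "e \<ge> 0" using bound[of N] norm_ge_zero[of "abs_L2 (f N)"] by linarith
  have "(\<integral>\<^sup>+x. ennreal ((cmod (h x))\<^sup>2) \<partial>lebesgue)
      = (\<integral>\<^sup>+x. liminf (\<lambda>j. ennreal ((cmod (f j x))\<^sup>2)) \<partial>lebesgue)"
  proof (rule nn_integral_cong_AE, use lim in eventually_elim)
    case (elim x)
    then have "(\<lambda>j. ennreal ((cmod (f j x))\<^sup>2)) \<longlonglongrightarrow> ennreal ((cmod (h x))\<^sup>2)"
      by (intro tendsto_intros)
    then show ?case by (metis lim_imp_Liminf trivial_limit_sequentially)
  qed
  also have "\<dots> \<le> liminf (\<lambda>j. \<integral>\<^sup>+x. ennreal ((cmod (f j x))\<^sup>2) \<partial>lebesgue)"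
    by (rule nn_integral_liminf) measurable
  also have "\<dots> = liminf (\<lambda>j. ennreal ((norm (abs_L2 (f j)))\<^sup>2))"
    unfolding norm_abs_L2[OF f] using sq_integrableD(2)[OF f]
    by (subst nn_integral_eq_integral) auto
  also have "\<dots> \<le> liminf (\<lambda>j. ennreal (e\<^sup>2))"
    by (rule Liminf_mono)
      (auto intro!: eventually_sequentiallyI[of N] ennreal_leI power_mono bound)
  also have "\<dots> = ennreal (e\<^sup>2)" by (simp add: Liminf_const)
  finally have *: "(\<integral>\<^sup>+x. ennreal ((cmod (h x))\<^sup>2) \<partial>lebesgue) \<le> ennreal (e\<^sup>2)" .
  have int: "integrable lebesgue (\<lambda>x. (cmod (h x))\<^sup>2)"
    by (rule integrableI_bounded) (use le_less_trans[OF * ennreal_less_top] in auto)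
  then show h2: "sq_integrable h" by (simp add: sq_integrable_def h)
  have "ennreal ((norm (abs_L2 h))\<^sup>2) \<le> ennreal (e\<^sup>2)"
    using * nn_integral_eq_integral[OF int] by (simp add: norm_abs_L2[OF h2])
  then have "(norm (abs_L2 h))\<^sup>2 \<le> e\<^sup>2" by (simp add: e)
  then show "norm (abs_L2 h) \<le> e" using e by (rule power2_le_imp_le)
qed

instance L2 :: (euclidean_space) banach
proof
  fix X :: "nat \<Rightarrow> 'a L2" assume X: "Cauchy X"
  have "\<exists>N. \<forall>m\<ge>N. \<forall>n\<ge>N. dist (X m) (X n) < (1/2) ^ k" for k
    by (rule metric_CauchyD[OF X]) simp
  then obtain N where N: "\<And>k m n. m \<ge> N k \<Longrightarrow> n \<ge> N k \<Longrightarrow> dist (X m) (X n) < (1/2) ^ k"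
    by metis
  define r where "r k = k + (\<Sum>i\<le>k. N i)" for k
  have r: "strict_mono r" by (auto simp: strict_mono_Suc_iff r_def)
  have rN: "r k \<ge> N k" for k
    unfolding r_def using member_le_sum[of k "{..k}" N] by auto
  define f where "f k = rep_L2 (X (r k))" for k
  have f: "sq_integrable (f k)" for k by (simp add: f_def)
  note [measurable] = sq_integrableD(1)[OF f]
  define g where "g k x = f (Suc k) x - f k x" for k x
  have g: "sq_integrable (g k)" for k
    unfolding g_def by (intro sq_integrable_diff f)
  note [measurable] = sq_integrableD(1)[OF g]
  have abs_f: "abs_L2 (f k) = X (r k)" for k by (simp add: f_def)
  have ng: "norm (abs_L2 (g k)) \<le> (1/2) ^ k" for k
  proof -
    have "abs_L2 (g k) = X (r (Suc k)) - X (r k)"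
      unfolding g_def using abs_L2_diff[OF f f, of "Suc k" k] by (simp add: abs_f)
    moreover have "r (Suc k) \<ge> N k"
      using rN[of k] strict_mono_leD[OF r, of k "Suc k"] by simp
    ultimately show ?thesis using N[of k "r (Suc k)" "r k"] rN[of k] by (simp add: dist_norm)
  qed
  have "(\<integral>\<^sup>+x. (\<Sum>k. ennreal (2 ^ k * (cmod (g k x))\<^sup>2)) \<partial>lebesgue)
      = (\<Sum>k. \<integral>\<^sup>+x. ennreal (2 ^ k * (cmod (g k x))\<^sup>2) \<partial>lebesgue)"
    by (rule nn_integral_suminf) measurable
  also have "\<dots> = (\<Sum>k. ennreal (2 ^ k * (norm (abs_L2 (g k)))\<^sup>2))"
    unfolding norm_abs_L2[OF g] using sq_integrableD(2)[OF g]
    by (subst nn_integral_eq_integral) auto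
  also have "\<dots> \<le> (\<Sum>k. ennreal ((1/2) ^ k))"
  proof (intro suminf_le ennreal_leI)
    fix k :: nat
    have "2 ^ k * (norm (abs_L2 (g k)))\<^sup>2 \<le> 2 ^ k * ((1/2) ^ k)\<^sup>2"
      by (intro mult_left_mono power_mono ng) auto
    also have "\<dots> = (1/2) ^ k" by (simp add: power2_eq_square power_divide)
    finally show "2 ^ k * (norm (abs_L2 (g k)))\<^sup>2 \<le> (1/2) ^ k" .
  qed auto
  also have "\<dots> < \<infinity>" by (simp add: suminf_ennreal2 summable_geometric)
  finally have "AE x in lebesgue. (\<Sum>k. ennreal (2 ^ k * (cmod (g k x))\<^sup>2)) \<noteq> \<infinity>"
    by (intro nn_integral_noteq_infinite) auto
  then have conv: "AE x in lebesgue. convergent (\<lambda>k. f k x)"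
  proof eventually_elim
    case (elim x)
    then have s: "summable (\<lambda>k. 2 ^ k * (cmod (g k x))\<^sup>2)"
      by (intro summable_suminf_not_top) auto
    have "summable (\<lambda>k. g k x)"
    proof (rule summable_comparison_test')
      show "summable (\<lambda>k. 2 ^ k * (cmod (g k x))\<^sup>2 + (1/2) ^ k)"
        by (intro summable_add s summable_geometric) auto
      fix k :: nat
      have "sqrt (2 ^ k) * sqrt ((1/2) ^ k) = 1"
        by (simp add: power_divide flip: real_sqrt_mult)
      then have "cmod (g k x) = (sqrt (2 ^ k) * cmod (g k x)) * sqrt ((1/2) ^ k)"
        by simp
      also have "\<dots> \<le> (sqrt (2 ^ k) * cmod (g k x))\<^sup>2 + (sqrt ((1/2) ^ k))\<^sup>2"
      proof -
        have "a * b \<le> a\<^sup>2 + b\<^sup>2" if "a \<ge> 0" "b \<ge> 0" for a b :: real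
          using sum_squares_bound[of a b] mult_nonneg_nonneg[OF that] by linarith
        from this[of "sqrt (2 ^ k) * cmod (g k x)" "sqrt ((1/2) ^ k)"] show ?thesis by simp
      qed
      finally show "norm (g k x) \<le> 2 ^ k * (cmod (g k x))\<^sup>2 + (1/2) ^ k"
        by (simp add: power_mult_distrib)
    qed
    then have "convergent (\<lambda>n. \<Sum>k<n. g k x)" by (simp add: summable_iff_convergent)
    then have "convergent (\<lambda>n. f n x - f 0 x)"
      unfolding g_def by (subst (asm) sum_lessThan_telescope)
    then have "convergent (\<lambda>n. (f n x - f 0 x) + f 0 x)"
      by (intro convergent_add convergent_const)
    then show ?case by simp
  qed
  define h where "h x = lim (\<lambda>k. f k x)" for x
  have h[measurable]: "h \<in> borel_measurable lebesgue"
    unfolding h_def by (rule borel_measurable_lim_metric) measurable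
  have lim: "AE x in lebesgue. (\<lambda>k. f k x) \<longlonglongrightarrow> h x"
    using conv by eventually_elim (simp add: h_def convergent_LIMSEQ_iff)
  have tail: "sq_integrable (\<lambda>x. h x - f k x)" "norm (abs_L2 (\<lambda>x. h x - f k x)) \<le> (1/2) ^ k" for k
  proof -
    have b: "norm (abs_L2 (\<lambda>x. f j x - f k x)) \<le> (1/2) ^ k" if "j \<ge> k" for j
    proof -
      have "N k \<le> r j" using rN[of k] strict_mono_leD[OF r that] by simp
      then show ?thesis
        using N[of k "r j" "r k"] rN[of k] abs_L2_diff[OF f f, of j k]
        by (simp add: abs_f dist_norm)
    qed
    have l: "AE x in lebesgue. (\<lambda>j. f j x - f k x) \<longlonglongrightarrow> h x - f k x"
      using lim by eventually_elim (intro tendsto_intros)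
    have m: "(\<lambda>x. h x - f k x) \<in> borel_measurable lebesgue" by measurable
    show "sq_integrable (\<lambda>x. h x - f k x)" "norm (abs_L2 (\<lambda>x. h x - f k x)) \<le> (1/2) ^ k"
      using Fatou_L2[OF sq_integrable_diff[OF f f] m l b] by auto
  qed
  have h2: "sq_integrable h"
    using sq_integrable_add[OF tail(1) f, of 0 0] by simp
  have "(\<lambda>k. X (r k)) \<longlonglongrightarrow> abs_L2 h"
  proof (rule metric_tendsto_imp_tendsto)
    show "(\<lambda>k. (1/2) ^ k :: real) \<longlonglongrightarrow> 0" by (simp add: LIMSEQ_realpow_zero)
    have "dist (X (r k)) (abs_L2 h) \<le> (1/2) ^ k" for k
      using tail(2)[of k] abs_L2_diff[OF h2 f, of k] by (simp add: abs_f dist_norm norm_minus_commute)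
    then show "\<forall>\<^sub>F k in sequentially. dist (X (r k)) (abs_L2 h) \<le> dist ((1/2) ^ k :: real) 0"
      by (simp add: dist_norm)
  qed
  then show "convergent X"
    using X r by (auto simp: convergent_def o_def intro: Cauchy_converges_subseq[unfolded o_def])
qed


lemma sq_integrable_const_indicator:
  assumes "A \<in> lmeasurable"
  shows "sq_integrable (\<lambda>x. c * indicator A x)"
  unfolding sq_integrable_def
proof
  note [measurable] = fmeasurableD[OF assms]
  show "(\<lambda>x. c * indicator A x) \<in> borel_measurable lebesgue" by measurable
  have "(\<lambda>x. (cmod (c * indicator A x))\<^sup>2) = (\<lambda>x. (cmod c)\<^sup>2 * indicator A x)"
    by (auto simp: indicator_def)
  then show "integrable lebesgue (\<lambda>x. (cmod (c * indicator A x))\<^sup>2)"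
    using assms by (simp add: fmeasurable_def less_top)
qed

lemma norm_const_indicator:
  assumes "A \<in> lmeasurable"
  shows "norm (abs_L2 (\<lambda>x. c * indicator A x)) = cmod c * sqrt (measure lebesgue A)"
proof -
  have "(\<lambda>x. (cmod (c * indicator A x))\<^sup>2) = (\<lambda>x. (cmod c)\<^sup>2 * indicator A x)"
    by (auto simp: indicator_def)
  then have "(norm (abs_L2 (\<lambda>x. c * indicator A x)))\<^sup>2 = (cmod c)\<^sup>2 * measure lebesgue A"
    unfolding norm_abs_L2[OF sq_integrable_const_indicator[OF assms]]
    using assms by (simp add: fmeasurableD)
  also have "\<dots> = (cmod c * sqrt (measure lebesgue A))\<^sup>2"
    by (simp add: power_mult_distrib)
  finally show ?thesis by (rule power2_eq_imp_eq) auto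
qed

lemma ex_countable_dense_L2:
  "\<exists>D :: 'a::euclidean_space L2 set. countable D \<and> closure D = UNIV"
proof -
  obtain B :: "'a set set" where B: "countable B" "topological_basis B"
    using ex_countable_basis by blast
  obtain Q :: "complex set" where Q: "countable Q" "\<And>X. open X \<Longrightarrow> X \<noteq> {} \<Longrightarrow> \<exists>d\<in>Q. d \<in> X"
    using countable_dense_setE by blast
  define C where "C = {A. A \<in> Union ` {F. finite F \<and> F \<subseteq> B} \<and> A \<in> lmeasurable}"
  define ind :: "complex \<Rightarrow> 'a set \<Rightarrow> 'a L2" where "ind c A = abs_L2 (\<lambda>x. c * indicator A x)" for c A
  define D where "D = (\<lambda>xs. sum_list (map (\<lambda>(c, A). ind c A) xs)) ` lists (Q \<times> C)"
  have "countable C"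
    unfolding C_def
    by (rule countable_subset[OF _ countable_image[OF countable_Collect_finite_subset[OF B(1)]]]) auto
  then have D: "countable D"
    unfolding D_def by (intro countable_image countable_lists countable_SIGMA Q(1))
  have indD: "ind q A \<in> D" if "q \<in> Q" "A \<in> C" for q A
    unfolding D_def by (rule image_eqI[where x = "[(q, A)]"]) (use that in auto)
  have zeroD: "0 \<in> D"
    unfolding D_def by (rule image_eqI[where x = "[]"]) auto
  have addD: "u + v \<in> D" if uv: "u \<in> D" "v \<in> D" for u v
  proof -
    obtain xs ys where "xs \<in> lists (Q \<times> C)" "u = sum_list (map (\<lambda>(c, A). ind c A) xs)"
      "ys \<in> lists (Q \<times> C)" "v = sum_list (map (\<lambda>(c, A). ind c A) ys)"
      using uv unfolding D_def by auto
    then show ?thesis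
      unfolding D_def by (intro image_eqI[where x = "xs @ ys"]) auto
  qed
  have zeroW: "0 \<in> closure D" using zeroD closure_subset by blast
  have addW: "u + v \<in> closure D" if uv: "u \<in> closure D" "v \<in> closure D" for u v
  proof -
    obtain a b where "\<And>n. a n \<in> D" "a \<longlonglongrightarrow> u" "\<And>n. b n \<in> D" "b \<longlonglongrightarrow> v"
      using uv unfolding closure_sequential by blast
    then show ?thesis
      unfolding closure_sequential
      by (intro exI[of _ "\<lambda>n. a n + b n"]) (auto intro: addD tendsto_add)
  qed
  have limW: "u \<in> closure D" if "\<And>n. s n \<in> closure D" "s \<longlonglongrightarrow> u" for s u
    using closed_sequentially[OF closed_closure[of D] that] .
  have dist_ind: "dist (ind c A) (ind c A') = cmod c * sqrt (measure lebesgue A - measure lebesgue A')"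
    if "A' \<subseteq> A" "A \<in> lmeasurable" "A' \<in> lmeasurable" for c A A'
  proof -
    have "(\<lambda>x. c * indicator A x - c * indicator A' x) = (\<lambda>x. c * indicator (A - A') x)"
      using that(1) by (auto simp: indicator_def fun_eq_iff of_bool_def)
    then have "ind c A - ind c A' = abs_L2 (\<lambda>x. c * indicator (A - A') x)"
      unfolding ind_def using that
      by (subst abs_L2_diff) (auto intro: sq_integrable_const_indicator)
    then show ?thesis
      using that by (simp add: dist_norm norm_const_indicator fmeasurable.Diff
          measurable_measure_Diff fmeasurableD)
  qed
  have lim_ind: "(\<lambda>n. ind c (A n)) \<longlonglongrightarrow> ind c O'"
    if "\<And>n. A n \<in> lmeasurable" "O' \<in> lmeasurable" "(\<lambda>n. measure lebesgue (A n)) \<longlonglongrightarrow> measure lebesgue O'"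
       "(\<forall>n. A n \<subseteq> O') \<or> (\<forall>n. O' \<subseteq> A n)" for A c O'
  proof -
    have "dist (ind c (A n)) (ind c O') = cmod c * sqrt \<bar>measure lebesgue (A n) - measure lebesgue O'\<bar>" for n
      using that(4)
    proof
      assume "\<forall>n. A n \<subseteq> O'"
      then show ?thesis
        using dist_ind[of "A n" O' c] measure_mono_fmeasurable[of "A n" O' lebesgue] that(1,2)
        by (simp add: dist_commute fmeasurableD)
    next
      assume "\<forall>n. O' \<subseteq> A n"
      then show ?thesis
        using dist_ind[of O' "A n" c] measure_mono_fmeasurable[of O' "A n" lebesgue] that(1,2)
        by (simp add: fmeasurableD)
    qed
    moreover have "(\<lambda>n. cmod c * sqrt \<bar>measure lebesgue (A n) - measure lebesgue O'\<bar>)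
        \<longlonglongrightarrow> cmod c * sqrt \<bar>measure lebesgue O' - measure lebesgue O'\<bar>"
      by (intro tendsto_intros that(3))
    ultimately show ?thesis by (subst tendsto_dist_iff) simp
  qed
  have indC: "ind c A \<in> closure D" if "A \<in> C" for c A
  proof -
    have A: "A \<in> lmeasurable" using that by (simp add: C_def)
    have "\<exists>q\<in>Q. q \<in> ball c (1 / Suc n)" for n by (rule Q(2)) auto
    then obtain q where q: "\<And>n. q n \<in> Q" "\<And>n. q n \<in> ball c (1 / Suc n)" by metis
    have qD: "ind (q n) A \<in> closure D" for n
      using indD[OF q(1) that] closure_subset by blast
    have "dist (ind (q n) A) (ind c A) \<le> sqrt (measure lebesgue A) * (1 / Suc n)" for n
    proof -
      have "ind (q n) A - ind c A = abs_L2 (\<lambda>x. (q n - c) * indicator A x)"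
        unfolding ind_def using A
        by (subst abs_L2_diff) (auto intro: sq_integrable_const_indicator simp: algebra_simps)
      then have "dist (ind (q n) A) (ind c A) = sqrt (measure lebesgue A) * cmod (q n - c)"
        by (simp add: dist_norm norm_const_indicator A)
      also have "\<dots> \<le> sqrt (measure lebesgue A) * (1 / Suc n)"
        using q(2)[of n] by (intro mult_left_mono) (auto simp: dist_norm norm_minus_commute)
      finally show ?thesis .
    qed
    then have b: "\<forall>\<^sub>F n in sequentially.
        norm (dist (ind (q n) A) (ind c A)) \<le> sqrt (measure lebesgue A) * (1 / Suc n)"
      by (intro always_eventually allI) simp
    have "(\<lambda>n. sqrt (measure lebesgue A) * (1 / Suc n)) \<longlonglongrightarrow> sqrt (measure lebesgue A) * 0"
      by (intro tendsto_mult tendsto_const lim_1_over_n[THEN LIMSEQ_Suc])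
    then have "(\<lambda>n. dist (ind (q n) A) (ind c A)) \<longlonglongrightarrow> 0"
      by (intro Lim_null_comparison[OF b]) simp
    then have "(\<lambda>n. ind (q n) A) \<longlonglongrightarrow> ind c A"
      by (subst tendsto_dist_iff)
    then show ?thesis by (rule limW[OF qD])
  qed
  have indO: "ind c U \<in> closure D" if U: "open U" "U \<in> lmeasurable" for c U
  proof -
    obtain F where F: "F \<subseteq> B" "\<Union>F = U"
      using B(2) U(1) unfolding topological_basis_def by blast
    have cF: "countable (insert {} F)" using countable_subset[OF F(1) B(1)] by simp
    define e where "e = from_nat_into (insert {} F)"
    have re: "range e = insert {} F"
      unfolding e_def by (rule range_from_nat_into[OF insert_not_empty cF])
    define A where "A n = \<Union>(e ` {..<n} - {{}})" for n :: nat
    have AU: "A n \<subseteq> U" for n unfolding A_def using re F(2) by auto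
    have oe: "open (e n)" for n
      using re F(1) B(2) topological_basis_open by (metis insertE open_empty rangeI subsetD)
    have oA: "open (A n)" for n unfolding A_def using oe by auto
    have mA: "A n \<in> lmeasurable" for n
      by (rule fmeasurableI2[OF U(2) AU]) (simp add: oA borel_open sets_completionI_sets)
    have AC: "A n \<in> C" for n
      unfolding C_def using mA re F(1) by (auto simp: A_def intro!: imageI)
    have inc: "incseq A" unfolding A_def incseq_def
      by (intro allI impI Union_mono Diff_mono image_mono) auto
    have UA: "(\<Union>n. A n) = U"
    proof (rule antisym[OF UN_least[OF AU]], rule subsetI)
      fix x assume "x \<in> U"
      then obtain n where "x \<in> e n" using F(2) re by (metis UnionE insertI2 rangeE)
      then have "x \<in> A (Suc n)" unfolding A_def by (intro UnionI[of "e n"]) auto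
      then show "x \<in> (\<Union>n. A n)" by blast
    qed
    have "range A \<subseteq> sets lebesgue" using mA by (auto intro: fmeasurableD)
    moreover have "emeasure lebesgue U \<noteq> \<infinity>" using fmeasurableD2[OF U(2)] by simp
    ultimately have "(\<lambda>n. measure lebesgue (A n)) \<longlonglongrightarrow> measure lebesgue U"
      using Lim_measure_incseq[of A lebesgue] inc by (simp add: UA)
    then have "(\<lambda>n. ind c (A n)) \<longlonglongrightarrow> ind c U"
      using AU by (intro lim_ind mA U(2)) auto
    then show ?thesis by (rule limW[OF indC[OF AC]])
  qed
  have indM: "ind c A \<in> closure D" if A: "A \<in> lmeasurable" for c A
  proof -
    have "\<exists>U. open U \<and> A \<subseteq> U \<and> (U - A) \<in> lmeasurable \<and> emeasure lebesgue (U - A) < ennreal (1 / Suc n)"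
      for n :: nat
      by (rule sets_lebesgue_outer_open[OF fmeasurableD[OF A], of "1 / Suc n"]) (simp, blast)
    then obtain U where U: "\<And>n. open (U n)" "\<And>n. A \<subseteq> U n" "\<And>n. U n - A \<in> lmeasurable"
      "\<And>n :: nat. emeasure lebesgue (U n - A) < ennreal (1 / Suc n)" by metis
    have mU: "U n \<in> lmeasurable" for n
      using fmeasurable.Un[OF A U(3)[of n]] U(2)[of n] by (simp add: Un_absorb1)
    have "\<bar>measure lebesgue (U n) - measure lebesgue A\<bar> \<le> 1 / Suc n" for n
    proof -
      have "measure lebesgue (U n) - measure lebesgue A = measure lebesgue (U n - A)"
        using measurable_measure_Diff[OF mU fmeasurableD[OF A] U(2)] by simp
      moreover have "measure lebesgue (U n - A) \<le> 1 / Suc n"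
        using U(4)[of n] emeasure_eq_measure2[OF U(3)[of n]] by (simp add: ennreal_less_iff)
      ultimately show ?thesis by simp
    qed
    then have "(\<lambda>n. measure lebesgue (U n) - measure lebesgue A) \<longlonglongrightarrow> 0"
      by (intro Lim_null_comparison[OF _ lim_1_over_n[THEN LIMSEQ_Suc]])
        (auto intro!: always_eventually)
    then have "(\<lambda>n. measure lebesgue (U n)) \<longlonglongrightarrow> measure lebesgue A"
      by (rule LIM_zero_cancel)
    then have "(\<lambda>n. ind c (U n)) \<longlonglongrightarrow> ind c A"
      using U(2) by (intro lim_ind mU A) auto
    then show ?thesis by (rule limW[OF indO[OF U(1) mU]])
  qed
  have simpleW: "abs_L2 s \<in> closure D" if s: "simple_function lebesgue s" "sq_integrable s" for s
  proof -
    have fin: "finite (range s)" using simple_functionD(1)[OF s(1)] by simp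
    have mS: "s -` {y} \<in> lmeasurable" if "y \<noteq> 0" for y
    proof -
      have meas: "s -` {y} \<in> sets lebesgue"
        using simple_functionD(2)[OF s(1), of "{y}"] by simp
      have "integrable lebesgue (\<lambda>x. indicator (s -` {y}) x :: real)"
      proof (rule Bochner_Integration.integrable_bound)
        show "integrable lebesgue (\<lambda>x. (1 / (cmod y)\<^sup>2) * (cmod (s x))\<^sup>2)"
          using sq_integrableD(2)[OF s(2)] by simp
        show "AE x in lebesgue. norm (indicator (s -` {y}) x :: real)
            \<le> norm ((1 / (cmod y)\<^sup>2) * (cmod (s x))\<^sup>2)"
          using that by (auto simp: indicator_def)
      qed (use meas in measurable)
      then show ?thesis
        using meas by (simp add: integrable_indicator_iff fmeasurable_def)
    qed
    have "sq_integrable (\<lambda>x. \<Sum>y\<in>Y. y * indicator (s -` {y}) x) \<and>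
        abs_L2 (\<lambda>x. \<Sum>y\<in>Y. y * indicator (s -` {y}) x) \<in> closure D"
      if "finite Y" "0 \<notin> Y" for Y
      using that
    proof (induction Y rule: finite_induct)
      case empty
      then show ?case using zeroW by (simp add: sq_integrable_zero zero_L2_def)
    next
      case (insert y Y)
      let ?f = "\<lambda>x. y * indicator (s -` {y}) x" and ?g = "\<lambda>x. \<Sum>y\<in>Y. y * indicator (s -` {y}) x"
      have f: "sq_integrable ?f" using insert.prems by (intro sq_integrable_const_indicator mS) auto
      have g: "sq_integrable ?g" "abs_L2 ?g \<in> closure D" using insert by auto
      have "abs_L2 (\<lambda>x. ?f x + ?g x) = ind y (s -` {y}) + abs_L2 ?g"
        unfolding ind_def using f g(1) by (simp add: plus_L2.abs_eq)
      then have "abs_L2 (\<lambda>x. ?f x + ?g x) \<in> closure D"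
        using addW[OF indM[OF mS] g(2), of y y] insert.prems by simp
      moreover have "(\<lambda>x. \<Sum>y\<in>insert y Y. y * indicator (s -` {y}) x) = (\<lambda>x. ?f x + ?g x)"
        by (simp only: sum.insert[OF insert.hyps])
      ultimately show ?case
        using sq_integrable_add[OF f g(1)] by (simp only: simp_thms)
    qed
    note fs = this[of "range s - {0}"]
    have "(\<Sum>y\<in>range s - {0}. y * indicator (s -` {y}) x) = s x" for x
    proof -
      have "(\<Sum>y\<in>range s - {0}. y * indicator (s -` {y}) x) = (\<Sum>y\<in>range s. y * indicator (s -` {y}) x)"
        by (rule sum.mono_neutral_left) (use fin in auto)
      also have "\<dots> = (\<Sum>y\<in>range s. if y = s x then y else 0)"
        by (rule sum.cong) (auto simp: indicator_def)
      also have "\<dots> = s x" using fin by simp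
      finally show ?thesis .
    qed
    then show ?thesis using fs fin by (simp only: finite_Diff simp_thms Diff_iff insertI1)
  qed
  have "u \<in> closure D" for u
  proof -
    define f where "f = rep_L2 u"
    have f: "sq_integrable f" by (simp add: f_def)
    note [measurable] = sq_integrableD(1)[OF f]
    obtain s where s: "\<And>i. simple_function lebesgue (s i)" "\<And>x. (\<lambda>i. s i x) \<longlonglongrightarrow> f x"
      "\<And>i x. cmod (s i x) \<le> 2 * cmod (f x)"
      using borel_measurable_implies_sequence_metric[OF sq_integrableD(1)[OF f], of 0] by auto
    have ms[measurable]: "s i \<in> borel_measurable lebesgue" for i
      by (rule borel_measurable_simple_function[OF s(1)])
    have sq: "sq_integrable (s i)" for i
      by (rule sq_integrable_dominated[OF f ms s(3)])
    have lim0: "(\<lambda>i. LINT x|lebesgue. (cmod (s i x - f x))\<^sup>2) \<longlonglongrightarrow> (LINT x|(lebesgue :: 'a measure). 0 :: real)"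
    proof (rule integral_dominated_convergence)
      show "integrable lebesgue (\<lambda>x. 9 * (cmod (f x))\<^sup>2)"
        using sq_integrableD(2)[OF f] by simp
      have "(\<lambda>i. (cmod (s i x - f x))\<^sup>2) \<longlonglongrightarrow> (cmod (f x - f x))\<^sup>2" for x
        by (intro tendsto_intros s(2))
      then show "AE x in lebesgue. (\<lambda>i. (cmod (s i x - f x))\<^sup>2) \<longlonglongrightarrow> 0" by simp
      have "(cmod (s i x - f x))\<^sup>2 \<le> 9 * (cmod (f x))\<^sup>2" for i x
      proof -
        have "cmod (s i x - f x) \<le> 3 * cmod (f x)"
          using norm_triangle_ineq4[of "s i x" "f x"] s(3)[of i x] by linarith
        from power_mono[OF this, of 2] show ?thesis by (simp add: power_mult_distrib)
      qed
      then show "AE x in lebesgue. norm ((cmod (s i x - f x))\<^sup>2) \<le> 9 * (cmod (f x))\<^sup>2" for i by simp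
    qed measurable
    have "(\<lambda>i. (dist (abs_L2 (s i)) u)\<^sup>2) \<longlonglongrightarrow> 0"
    proof -
      have "(dist (abs_L2 (s i)) u)\<^sup>2 = (LINT x|lebesgue. (cmod (s i x - f x))\<^sup>2)" for i
        using norm_abs_L2[OF sq_integrable_diff[OF sq f], of i] abs_L2_diff[OF sq f, of i]
        by (simp add: dist_norm f_def)
      then show ?thesis using lim0 by simp
    qed
    then have "(\<lambda>i. sqrt ((dist (abs_L2 (s i)) u)\<^sup>2)) \<longlonglongrightarrow> sqrt 0"
      by (rule tendsto_real_sqrt)
    then have "(\<lambda>i. abs_L2 (s i)) \<longlonglongrightarrow> u"
      by (subst tendsto_dist_iff) simp
    then show ?thesis by (rule limW[OF simpleW[OF s(1) sq]])
  qed
  then show ?thesis using D by blast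
qed

instance L2 :: (euclidean_space) second_countable_topology
proof
  obtain D :: "'a L2 set" where D: "countable D" "closure D = UNIV"
    using ex_countable_dense_L2 by blast
  define \<B> where "\<B> = (\<lambda>(d, n). ball d (1 / Suc n)) ` (D \<times> (UNIV :: nat set))"
  have "countable \<B>" unfolding \<B>_def using D(1) by auto
  moreover have "topological_basis \<B>"
  proof (rule topological_basisI)
    show "open B" if "B \<in> \<B>" for B using that by (auto simp: \<B>_def)
    fix U :: "'a L2 set" and u assume "open U" "u \<in> U"
    then obtain e where e: "e > 0" "ball u e \<subseteq> U" using open_contains_ball by blast
    obtain n where n: "1 / real (Suc n) < e / 2"
      using e(1) nat_approx_posE[of "e / 2"] by auto
    have "u \<in> closure D" using D(2) by simp
    then obtain d where d: "d \<in> D" "dist d u < 1 / Suc n"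
      unfolding closure_approachable by (metis divide_pos_pos of_nat_0_less_iff zero_less_Suc zero_less_one)
    have "ball d (1 / Suc n) \<subseteq> ball u e"
    proof
      fix v assume "v \<in> ball d (1 / Suc n)"
      then show "v \<in> ball u e"
        using d(2) n dist_triangle[of u v d] by (simp add: dist_commute)
    qed
    then show "\<exists>B\<in>\<B>. u \<in> B \<and> B \<subseteq> U"
      using d e(2) by (intro bexI[of _ "ball d (1 / Suc n)"]) (auto simp: \<B>_def)
  qed
  ultimately show "\<exists>B :: 'a L2 set set. countable B \<and> open = generate_topology B"
    using topological_basis_imp_subbasis by blast
qed

definition L2_on :: "'a::euclidean_space set \<Rightarrow> 'a L2 set" where
  "L2_on \<Omega> = {u. AE x in lebesgue. x \<notin> \<Omega> \<longrightarrow> rep_L2 u x = 0}"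

definition restrict_L2 :: "'a::euclidean_space set \<Rightarrow> 'a L2 \<Rightarrow> 'a L2" where
  "restrict_L2 A u = abs_L2 (\<lambda>x. indicator A x * rep_L2 u x)"

text \<open>The essential supremum is \<open>\<infinity>\<close> for functions that are not measurable.\<close>

definition Linf_on :: "'a::euclidean_space set \<Rightarrow> ('a \<Rightarrow> real) \<Rightarrow> bool" where
  "Linf_on \<Omega> V \<longleftrightarrow>
     V \<in> borel_measurable (lebesgue_on \<Omega>) \<and> esssup (lebesgue_on \<Omega>) (\<lambda>x. ereal \<bar>V x\<bar>) < \<infinity>"

definition Linf_norm :: "'a::euclidean_space set \<Rightarrow> ('a \<Rightarrow> real) \<Rightarrow> real" where
  "Linf_norm \<Omega> V = real_of_ereal (esssup (lebesgue_on \<Omega>) (\<lambda>x. ereal \<bar>V x\<bar>))"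


section \<open>Sobolev spaces\<close>

definition partial_deriv :: "'n::finite \<Rightarrow> (real^'n \<Rightarrow> complex) \<Rightarrow> real^'n \<Rightarrow> complex" where
  "partial_deriv i \<phi> x = frechet_derivative \<phi> (at x) (axis i 1)"

text \<open>All iterated partial derivatives exist and are differentiable, hence continuous: \<open>C\<^sup>\<infinity>\<close>.\<close>

definition smooth :: "(real^'n::finite \<Rightarrow> complex) \<Rightarrow> bool" where
  "smooth \<phi> \<longleftrightarrow> (\<forall>js. foldr partial_deriv js \<phi> differentiable_on UNIV)"

definition test_functions :: "(real^'n::finite) set \<Rightarrow> (real^'n \<Rightarrow> complex) set" where
  "test_functions \<Omega> =
     {\<phi>. smooth \<phi> \<and> compact (closure {x. \<phi> x \<noteq> 0}) \<and> closure {x. \<phi> x \<noteq> 0} \<subseteq> \<Omega>}"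

definition is_weak_deriv ::
    "(real^'n::finite) set \<Rightarrow> 'n \<Rightarrow> (real^'n) L2 \<Rightarrow> (real^'n) L2 \<Rightarrow> bool" where
  "is_weak_deriv \<Omega> i f g \<longleftrightarrow>
     (\<forall>\<phi>\<in>test_functions \<Omega>.
        (LINT x:\<Omega>|lebesgue. rep_L2 f x * partial_deriv i \<phi> x) =
        - (LINT x:\<Omega>|lebesgue. rep_L2 g x * \<phi> x))"

definition weak_deriv :: "(real^'n::finite) set \<Rightarrow> 'n \<Rightarrow> (real^'n) L2 \<Rightarrow> (real^'n) L2" where
  "weak_deriv \<Omega> i f = (THE g. g \<in> L2_on \<Omega> \<and> is_weak_deriv \<Omega> i f g)"

definition H1 :: "(real^'n::finite) set \<Rightarrow> (real^'n) L2 set" where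
  "H1 \<Omega> = {f \<in> L2_on \<Omega>. \<forall>i. \<exists>g\<in>L2_on \<Omega>. is_weak_deriv \<Omega> i f g}"

definition H1_norm :: "(real^'n::finite) set \<Rightarrow> (real^'n) L2 \<Rightarrow> real" where
  "H1_norm \<Omega> f = sqrt ((norm f)\<^sup>2 + (\<Sum>i\<in>UNIV. (norm (weak_deriv \<Omega> i f))\<^sup>2))"

definition H10 :: "(real^'n::finite) set \<Rightarrow> (real^'n) L2 set" where
  "H10 \<Omega> = {f \<in> H1 \<Omega>. \<forall>e>0. \<exists>\<phi>\<in>test_functions \<Omega>. H1_norm \<Omega> (f - abs_L2 \<phi>) < e}"


section \<open>The operator \<open>-\<Delta> + V\<close> with Dirichlet or Neumann boundary conditions\<close>

datatype boundary_condition = Dirichlet | Neumann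

fun form_domain :: "boundary_condition \<Rightarrow> (real^'n::finite) set \<Rightarrow> (real^'n) L2 set" where
  "form_domain Dirichlet \<Omega> = H10 \<Omega>"
| "form_domain Neumann \<Omega> = H1 \<Omega>"

definition schroedinger_form ::
    "(real^'n::finite) set \<Rightarrow> (real^'n \<Rightarrow> real) \<Rightarrow> (real^'n) L2 \<Rightarrow> (real^'n) L2 \<Rightarrow> complex" where
  "schroedinger_form \<Omega> V f g =
     (LINT x:\<Omega>|lebesgue. \<Sum>i\<in>UNIV. rep_L2 (weak_deriv \<Omega> i f) x * cnj (rep_L2 (weak_deriv \<Omega> i g) x)) +
     (LINT x:\<Omega>|lebesgue. of_real (V x) * rep_L2 f x * cnj (rep_L2 g x))"

text \<open>
  Unbounded operators are represented by their graphs. The operator associated with a form \<open>a\<close>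
  with domain \<open>Q\<close> maps \<open>f \<in> Q\<close> to \<open>h \<in> L\<^sup>2(\<Omega>)\<close> iff \<open>a(f, g) = \<langle>h, g\<rangle>\<close> for all \<open>g \<in> Q\<close>.
\<close>

definition schroedinger_op ::
    "boundary_condition \<Rightarrow> (real^'n::finite) set \<Rightarrow> (real^'n \<Rightarrow> real) \<Rightarrow>
     ((real^'n) L2 \<times> (real^'n) L2) set" where
  "schroedinger_op bc \<Omega> V =
     {(f, h). f \<in> form_domain bc \<Omega> \<and> h \<in> L2_on \<Omega> \<and>
        (\<forall>g\<in>form_domain bc \<Omega>. schroedinger_form \<Omega> V f g = cinner h g)}"


section \<open>Semigroups and null-controllability\<close>

text \<open>Strongly continuous semigroups of bounded complex-linear operators on a subspace \<open>X\<close>.\<close>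

definition C0_semigroup :: "'a::euclidean_space L2 set \<Rightarrow> (real \<Rightarrow> 'a L2 \<Rightarrow> 'a L2) \<Rightarrow> bool" where
  "C0_semigroup X E \<longleftrightarrow>
     (\<forall>t\<ge>0. (\<forall>f\<in>X. E t f \<in> X) \<and>
        (\<forall>f\<in>X. \<forall>g\<in>X. E t (f + g) = E t f + E t g) \<and>
        (\<forall>c. \<forall>f\<in>X. E t (cscale c f) = cscale c (E t f)) \<and>
        (\<exists>K. \<forall>f\<in>X. norm (E t f) \<le> K * norm f)) \<and>
     (\<forall>f\<in>X. E 0 f = f) \<and>
     (\<forall>s\<ge>0. \<forall>t\<ge>0. \<forall>f\<in>X. E (s + t) f = E s (E t f)) \<and>
     (\<forall>f\<in>X. ((\<lambda>t. E t f) \<longlongrightarrow> f) (at_right 0))"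

definition generator ::
    "'a::euclidean_space L2 set \<Rightarrow> (real \<Rightarrow> 'a L2 \<Rightarrow> 'a L2) \<Rightarrow> ('a L2 \<times> 'a L2) set" where
  "generator X E =
     {(f, h). f \<in> X \<and> h \<in> X \<and> ((\<lambda>t. (1 / t) *\<^sub>R (E t f - f)) \<longlongrightarrow> h) (at_right 0)}"

text \<open>\<open>E t = e\<^sup>-\<^sup>t\<^sup>H\<close>: the strongly continuous semigroup on \<open>X\<close> generated by \<open>-H\<close>.\<close>

definition is_exp_semigroup ::
    "'a::euclidean_space L2 set \<Rightarrow> ('a L2 \<times> 'a L2) set \<Rightarrow> (real \<Rightarrow> 'a L2 \<Rightarrow> 'a L2) \<Rightarrow> bool" where
  "is_exp_semigroup X H E \<longleftrightarrow> C0_semigroup X E \<and> generator X E = {(f, - h) | f h. (f, h) \<in> H}"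

text \<open>\<open>L\<^sup>2((0,T), L\<^sup>2(\<Omega>))\<close>\<close>

definition controls :: "'a::euclidean_space set \<Rightarrow> real \<Rightarrow> (real \<Rightarrow> 'a L2) set" where
  "controls \<Omega> T =
     {v. v \<in> borel_measurable (lebesgue_on {0<..<T}) \<and> (\<forall>s\<in>{0<..<T}. v s \<in> L2_on \<Omega>) \<and>
         integrable (lebesgue_on {0<..<T}) (\<lambda>s. (norm (v s))\<^sup>2)}"

text \<open>
  \<open>v\<close> steers \<open>u\<^sub>0\<close> to zero in time \<open>T\<close>. For lower semibounded self-adjoint \<open>H\<close> the semigroup
  \<open>e\<^sup>-\<^sup>t\<^sup>H\<close> exists, and on \<open>L\<^sup>2(\<Omega>)\<close> and for \<open>t \<ge> 0\<close> it is uniquely determined by its generator,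
  so the existential quantifier only serves to name it.
\<close>

definition null_control ::
    "'a::euclidean_space set \<Rightarrow> ('a L2 \<times> 'a L2) set \<Rightarrow> 'a set \<Rightarrow> real \<Rightarrow> 'a L2 \<Rightarrow>
     (real \<Rightarrow> 'a L2) \<Rightarrow> bool" where
  "null_control \<Omega> H \<omega> T u\<^sub>0 v \<longleftrightarrow> v \<in> controls \<Omega> T \<and>
     (\<exists>E. is_exp_semigroup (L2_on \<Omega>) H E \<and>
        E T u\<^sub>0 + (LINT s|lebesgue_on {0<..<T}. E (T - s) (restrict_L2 \<omega> (v s))) = 0)"

definition null_controllable ::
    "'a::euclidean_space set \<Rightarrow> ('a L2 \<times> 'a L2) set \<Rightarrow> 'a set \<Rightarrow> real \<Rightarrow> bool" where
  "null_controllable \<Omega> H \<omega> T \<longleftrightarrow> (\<forall>u\<^sub>0\<in>L2_on \<Omega>. \<exists>v. null_control \<Omega> H \<omega> T u\<^sub>0 v)"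

definition control_norm :: "'a::euclidean_space set \<Rightarrow> real \<Rightarrow> (real \<Rightarrow> 'a L2) \<Rightarrow> real" where
  "control_norm \<omega> T v = sqrt (LINT s|lebesgue_on {0<..<T}. (norm (restrict_L2 \<omega> (v s)))\<^sup>2)"

definition control_cost ::
    "'a::euclidean_space set \<Rightarrow> ('a L2 \<times> 'a L2) set \<Rightarrow> 'a set \<Rightarrow> real \<Rightarrow> ereal" where
  "control_cost \<Omega> H \<omega> T =
     (SUP u\<^sub>0\<in>{u\<^sub>0 \<in> L2_on \<Omega>. norm u\<^sub>0 = 1}.
        INF v\<in>{v. null_control \<Omega> H \<omega> T u\<^sub>0 v}. ereal (control_norm \<omega> T v))"


section \<open>Equidistributed sets and the constants \<open>D(d)\<close>\<close>

definition equidistributed :: "real \<Rightarrow> real \<Rightarrow> (real^'n::finite) set \<Rightarrow> bool" where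
  "equidistributed G \<delta> S \<longleftrightarrow> S \<in> sets lebesgue \<and>
     (\<exists>z :: int^'n \<Rightarrow> real^'n.
        (\<forall>j. ball (z j) \<delta> \<subseteq>
           {x. \<forall>i. G * of_int (j $ i) < x $ i \<and> x $ i < G * of_int (j $ i) + G}) \<and>
        (\<Union>j. ball (z j) \<delta>) \<subseteq> S)"

definition open_rectangle :: "('n::finite \<Rightarrow> ereal) \<Rightarrow> ('n \<Rightarrow> ereal) \<Rightarrow> (real^'n) set" where
  "open_rectangle \<alpha> \<beta> = {x. \<forall>i. \<alpha> i < ereal (x $ i) \<and> ereal (x $ i) < \<beta> i}"

definition cost_bound ::
    "real \<Rightarrow> real \<Rightarrow> real \<Rightarrow> 'a::euclidean_space set \<Rightarrow> ('a \<Rightarrow> real) \<Rightarrow> real \<Rightarrow> real" where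
  "cost_bound D G \<delta> \<Omega> V T =
     (\<delta> / G) powr (- (D * (1 + G powr (4/3) * Linf_norm \<Omega> V powr (2/3)))) * (D / sqrt T) *
     exp (D * G\<^sup>2 * (ln (\<delta> / G))\<^sup>2 / (2 * T) + Linf_norm \<Omega> (\<lambda>x. max (- V x) 0) * T)"

text \<open>The property characterising \<open>D(d)\<close>; the dimension \<open>d\<close> is \<open>CARD('n)\<close>.\<close>

definition is_cost_constant :: "'n::finite itself \<Rightarrow> real \<Rightarrow> bool" where
  "is_cost_constant (_ :: 'n itself) D \<longleftrightarrow> D > 0 \<and>
     (\<forall>G>0. \<forall>\<delta>. 0 < \<delta> \<and> \<delta> < G / 2 \<longrightarrow>
       (\<forall>(\<alpha> :: 'n \<Rightarrow> ereal) \<beta> V bc (S :: (real^'n) set) T.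
          (\<forall>i. \<alpha> i < \<beta> i) \<and> {x. \<forall>i. 0 < x $ i \<and> x $ i < G} \<subseteq> open_rectangle \<alpha> \<beta> \<and>
          Linf_on (open_rectangle \<alpha> \<beta>) V \<and> equidistributed G \<delta> S \<and> T > 0 \<longrightarrow>
          null_controllable (open_rectangle \<alpha> \<beta>) (schroedinger_op bc (open_rectangle \<alpha> \<beta>) V)
            (open_rectangle \<alpha> \<beta> \<inter> S) T \<and>
          control_cost (open_rectangle \<alpha> \<beta>) (schroedinger_op bc (open_rectangle \<alpha> \<beta>) V)
            (open_rectangle \<alpha> \<beta> \<inter> S) T
            \<le> ereal (cost_bound D G \<delta> (open_rectangle \<alpha> \<beta>) V T)))"

text \<open>The sector of angle \<open>\<theta>\<close>, for \<open>0 < \<theta> < \<pi>/2\<close>.\<close>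

definition sector :: "real \<Rightarrow> (real^2) set" where
  "sector \<theta> = {p. 0 < p $ 1 \<and> 0 < p $ 2 \<and> p $ 2 < tan \<theta> * p $ 1}"

end

theory Submission
  imports Defs
begin

text \<open>
  The sector of angle \<open>\<pi>/2\<^sup>n\<close> is unfolded into the quadrant by \<open>n - 1\<close> reflections, each of which doubles
  the angle. If \<open>\<Omega>\<close> is one half of a domain \<open>\<Omega>'\<close> that is symmetric with respect to a hyperplane, then
  odd (Dirichlet) or even (Neumann) extension \<open>W\<close> is, up to normalisation, an isometry of \<open>L\<^sup>2(\<Omega>)\<close> onto
  an invariant subspace of the reflected operator on \<open>\<Omega>'\<close>: it maps form domain to form domain and form
  to form, and the semigroup on \<open>\<Omega>'\<close> commutes with the reflection. Hence \<open>e\<^sup>-\<^sup>t\<^sup>H = W\<^sup>* e\<^sup>-\<^sup>t\<^sup>H' W\<close>, and \<open>W\<^sup>*\<close> turns a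
  control of \<open>W u\<^sub>0\<close> into a control of \<open>u\<^sub>0\<close> without increasing its norm. The control set stays thick
  under unfolding, because a ball in \<open>\<Omega>'\<close> contains a ball of half the radius on one side of the hyperplane;
  so every cell of size \<open>4\<^sup>n\<^sup>-\<^sup>1 G\<close> of the quadrant contains a reflected ball of the original set.
\<close>

section \<open>The Hilbert space structure of L2\<close>

text \<open>The property of \<open>D\<close> speaks only of rectangles, which is why the unfolding
  has to end at the quadrant. The obstacle is the passage between form domains: the symmetric domain
  is an arbitrary open set, so no traces are at hand. Both boundary conditions are reduced to one
  cutoff \<open>cut m\<close>, supported where the distance to the hyperplane is at least 1/(m+1).
  Its derivative is of the order of the inverse distance, and it is always paired with a factor that
  vanishes linearly at the hyperplane: an odd test function (Dirichlet) or the normal component of a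
  suitable test field (Neumann). The semigroup is known only through its generator, so its symmetry
  is proved by an energy estimate instead of functional calculus, and the semigroup on the half
  domain is built from the one on the full domain. The constant: a ball of radius 2G contains a grid
  cell, and the quadrant needs balls of radius L/2 after n-1 doublings, so L/2^n must be at least
  2G. With L = 4^(n-1) G this holds exactly for n \<ge> 3; the case n = 2 needs its own
  argument.\<close>

lemma rep_L2_cscale: "AE x in lebesgue. rep_L2 (cscale c u) x = c * rep_L2 u x"
  unfolding cscale_def by (auto intro!: rep_abs_L2 sq_integrable_cmult)

lemma rep_L2_zero: "AE x in lebesgue. rep_L2 (0 :: 'a::euclidean_space L2) x = 0"
  unfolding zero_L2_def by (auto intro!: rep_abs_L2 sq_integrable_zero)

lemma scaleR_eq_cscale: "r *\<^sub>R u = cscale (of_real r) u"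
  by transfer (auto intro!: sq_integrable_cmult simp: scaleR_conv_of_real)

lemma abs_L2_add:
  "sq_integrable f \<Longrightarrow> sq_integrable g \<Longrightarrow> abs_L2 f + abs_L2 g = abs_L2 (\<lambda>x. f x + g x)"
  by (simp add: plus_L2.abs_eq)

lemma cscale_abs_L2: "sq_integrable f \<Longrightarrow> cscale c (abs_L2 f) = abs_L2 (\<lambda>x. c * f x)"
  by (simp add: cscale.abs_eq)

lemma L2_eqI: "(AE x in lebesgue. rep_L2 u x = rep_L2 v x) \<Longrightarrow> u = v"
  by (simp add: L2_eq_iff)

lemma cscale_add_right: "cscale c (u + v) = cscale c u + cscale c v"
  by transfer (auto intro!: sq_integrable_cmult sq_integrable_add simp: algebra_simps)

lemma cscale_diff_right: "cscale c (u - v) = cscale c u - cscale c v"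
  by transfer (auto intro!: sq_integrable_cmult sq_integrable_diff simp: algebra_simps)

lemma cscale_cscale: "cscale c (cscale d u) = cscale (c * d) u"
  by transfer (auto intro!: sq_integrable_cmult simp: algebra_simps)

lemma cinner_commute: "cinner v u = cnj (cinner u v)"
  unfolding cinner_rep
  by (subst Bochner_Integration.integral_cnj[symmetric], rule Bochner_Integration.integral_cong) auto

lemma cinner_cscale_left: "cinner (cscale c u) v = c * cinner u v"
proof (transfer, goal_cases)
  case (1 c u v)
  then show ?case by (simp add: mult.assoc)
qed

lemma cinner_cscale_right: "cinner u (cscale c v) = cnj c * cinner u v"
  unfolding cinner_commute[of u "cscale c v"] cinner_commute[of u v]
  by (simp add: cinner_cscale_left)

text \<open>The imaginary part of the complex product is the real product with
  \<open>cscale \<i> v\<close>. Additivity and continuity of \<open>cinner\<close> are inherited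
  from the class \<open>real_inner\<close> through this identity.\<close>

lemma cinner_conv_inner: "cinner u v = Complex (inner u v) (inner u (cscale \<i> v))"
  by (rule complex_eqI) (auto simp: inner_L2_def cinner_cscale_right)

lemma cinner_add_left: "cinner (u + v) w = cinner u w + cinner v w"
  by (simp add: cinner_conv_inner inner_add_left complex_eq_iff)

lemma cinner_add_right: "cinner w (u + v) = cinner w u + cinner w v"
  by (simp add: cinner_conv_inner inner_add_right cscale_add_right complex_eq_iff)

lemma cinner_diff_left: "cinner (u - v) w = cinner u w - cinner v w"
  by (simp add: cinner_conv_inner inner_diff_left complex_eq_iff)

lemma cinner_diff_right: "cinner w (u - v) = cinner w u - cinner w v"
  by (simp add: cinner_conv_inner inner_diff_right cscale_diff_right complex_eq_iff)

lemma cinner_scaleR_left: "cinner (r *\<^sub>R u) v = of_real r * cinner u v"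
  by (simp add: scaleR_eq_cscale cinner_cscale_left)

lemma cinner_scaleR_right: "cinner u (r *\<^sub>R v) = of_real r * cinner u v"
  by (simp add: scaleR_eq_cscale cinner_cscale_right)

lemma cinner_sum_left: "cinner (\<Sum>i\<in>I. u i) v = (\<Sum>i\<in>I. cinner (u i) v)"
  by (simp add: cinner_conv_inner complex_eq_iff inner_sum_left)

lemma cinner_sum_right: "cinner v (\<Sum>i\<in>I. u i) = (\<Sum>i\<in>I. cinner v (u i))"
  unfolding cinner_commute[of v] by (simp add: cinner_sum_left)

lemma norm_cscale: "norm (cscale c u) = cmod c * norm u"
proof -
  have "cinner (cscale c u) (cscale c u) = of_real ((cmod c)\<^sup>2) * cinner u u"
    by (simp add: cinner_cscale_left cinner_cscale_right complex_norm_square mult.assoc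
        mult.left_commute flip: of_real_power)
  then have "inner (cscale c u) (cscale c u) = (cmod c)\<^sup>2 * inner u u"
    by (simp add: inner_L2_def)
  then show ?thesis by (simp add: norm_eq_sqrt_inner real_sqrt_mult)
qed

lemma bounded_linear_cscale: "bounded_linear (cscale c)"
  by (rule bounded_linear_intro[where K = "cmod c"])
    (auto simp: cscale_add_right norm_cscale scaleR_eq_cscale cscale_cscale mult.commute)

lemma tendsto_cinner:
  assumes "(u \<longlongrightarrow> u0) F" "(v \<longlongrightarrow> v0) F"
  shows "((\<lambda>t. cinner (u t) (v t)) \<longlongrightarrow> cinner u0 v0) F"
  unfolding cinner_conv_inner
  by (intro tendsto_Complex tendsto_inner assms bounded_linear.tendsto[OF bounded_linear_cscale])

lemma cinner_eq_inner: "cinner u u = of_real ((norm u)\<^sup>2)"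
  using cinner_commute[of u u]
  by (auto simp: complex_eq_iff power2_norm_eq_inner inner_L2_def)

lemma cinner_abs_L2:
  assumes "sq_integrable f" "sq_integrable g"
  shows "cinner (abs_L2 f) (abs_L2 g) = (LINT x|lebesgue. f x * cnj (g x))"
  using assms by (simp add: cinner.abs_eq)

lemma cinner_rep_abs:
  assumes "sq_integrable g"
  shows "cinner u (abs_L2 g) = (LINT x|lebesgue. rep_L2 u x * cnj (g x))"
  using cinner_abs_L2[OF sq_integrable_rep[of u] assms] by simp

lemma sq_integrable_dominated_AE:
  assumes "sq_integrable f" "g \<in> borel_measurable lebesgue"
    "AE x in lebesgue. cmod (g x) \<le> c * cmod (f x)"
  shows "sq_integrable g"
  unfolding sq_integrable_def
proof
  note [measurable] = assms(2)
  show "integrable lebesgue (\<lambda>x. (cmod (g x))\<^sup>2)"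
  proof (rule Bochner_Integration.integrable_bound)
    show "integrable lebesgue (\<lambda>x. c\<^sup>2 * (cmod (f x))\<^sup>2)"
      using sq_integrableD(2)[OF assms(1)] by simp
    show "AE x in lebesgue. norm ((cmod (g x))\<^sup>2) \<le> norm (c\<^sup>2 * (cmod (f x))\<^sup>2)"
      using assms(3) by eventually_elim (use power_mono[of _ _ 2] in \<open>fastforce simp: power_mult_distrib\<close>)
  qed measurable
qed fact

lemma norm_abs_L2_le:
  assumes "sq_integrable f" "sq_integrable g" "c \<ge> 0"
    "AE x in lebesgue. cmod (g x) \<le> c * cmod (f x)"
  shows "norm (abs_L2 g) \<le> c * norm (abs_L2 f)"
proof (rule power2_le_imp_le)
  have "(norm (abs_L2 g))\<^sup>2 \<le> (LINT x|lebesgue. c\<^sup>2 * (cmod (f x))\<^sup>2)"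
    unfolding norm_abs_L2[OF assms(2)]
  proof (rule integral_mono_AE)
    show "AE x in lebesgue. (cmod (g x))\<^sup>2 \<le> c\<^sup>2 * (cmod (f x))\<^sup>2"
      using assms(4) by eventually_elim (use power_mono[of _ _ 2] in \<open>fastforce simp: power_mult_distrib\<close>)
  qed (use assms(1,2)[THEN sq_integrableD(2)] in auto)
  then show "(norm (abs_L2 g))\<^sup>2 \<le> (c * norm (abs_L2 f))\<^sup>2"
    by (simp add: power_mult_distrib norm_abs_L2[OF assms(1)])
qed (use assms(3) in simp)

lemma abs_L2_dominated_convergence:
  assumes "sq_integrable h" "\<And>k. f k \<in> borel_measurable lebesgue" "g \<in> borel_measurable lebesgue"
    "\<And>k x. cmod (f k x) \<le> cmod (h x)" "\<And>x. (\<lambda>k. f k x) \<longlonglongrightarrow> g x"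
  shows "(\<lambda>k. abs_L2 (f k)) \<longlonglongrightarrow> abs_L2 g"
proof -
  note [measurable] = assms(2,3)
  have gh: "cmod (g x) \<le> cmod (h x)" for x
    by (rule LIMSEQ_le_const2[OF tendsto_norm[OF assms(5)]]) (use assms(4) in auto)
  have f: "sq_integrable (f k)" for k
    by (rule sq_integrable_dominated[OF assms(1,2), where c = 1]) (use assms(4) in auto)
  have g: "sq_integrable g"
    by (rule sq_integrable_dominated[OF assms(1,3), where c = 1]) (use gh in auto)
  have "(\<lambda>k. LINT x|lebesgue. (cmod (f k x - g x))\<^sup>2) \<longlonglongrightarrow> (LINT x|(lebesgue :: 'a measure). 0 :: real)"
  proof (rule integral_dominated_convergence)
    show "integrable lebesgue (\<lambda>x. 4 * (cmod (h x))\<^sup>2)"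
      using sq_integrableD(2)[OF assms(1)] by simp
    have "(\<lambda>k. (cmod (f k x - g x))\<^sup>2) \<longlonglongrightarrow> (cmod (g x - g x))\<^sup>2" for x
      by (intro tendsto_intros assms(5))
    then show "AE x in lebesgue. (\<lambda>k. (cmod (f k x - g x))\<^sup>2) \<longlonglongrightarrow> 0" by simp
    have "(cmod (f k x - g x))\<^sup>2 \<le> 4 * (cmod (h x))\<^sup>2" for k x
    proof -
      have "cmod (f k x - g x) \<le> 2 * cmod (h x)"
        using norm_triangle_ineq4[of "f k x" "g x"] assms(4)[of k x] gh[of x] by linarith
      from power_mono[OF this, of 2] show ?thesis by (simp add: power_mult_distrib)
    qed
    then show "AE x in lebesgue. norm ((cmod (f k x - g x))\<^sup>2) \<le> 4 * (cmod (h x))\<^sup>2" for k by simp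
  qed measurable
  then have "(\<lambda>k. (norm (abs_L2 (f k) - abs_L2 g))\<^sup>2) \<longlonglongrightarrow> 0"
    by (simp add: abs_L2_diff[OF f g] norm_abs_L2[OF sq_integrable_diff[OF f g]])
  then have "(\<lambda>k. norm (abs_L2 (f k) - abs_L2 g)) \<longlonglongrightarrow> 0"
    using tendsto_real_sqrt[of _ 0] by fastforce
  then show ?thesis by (rule LIM_zero_cancel[OF tendsto_norm_zero_cancel])
qed

subsection \<open>Multiplication operators\<close>

definition mult_L2 :: "('a::euclidean_space \<Rightarrow> real) \<Rightarrow> 'a L2 \<Rightarrow> 'a L2" where
  "mult_L2 m u = abs_L2 (\<lambda>x. of_real (m x) * rep_L2 u x)"

text \<open>Serves two kinds of multipliers: indicators, which give \<open>restrict_L2\<close>, and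
  potentials in the form \<open>indicator \<Omega> x * V x\<close>, because \<open>V\<close> is
  arbitrary outside \<Omega>. An explicit bound \<open>M\<close> is easier to carry along than an
  essential supremum.\<close>

definition ess_bounded :: "('a::euclidean_space \<Rightarrow> real) \<Rightarrow> real \<Rightarrow> bool" where
  "ess_bounded m M \<longleftrightarrow> m \<in> borel_measurable lebesgue \<and> (AE x in lebesgue. \<bar>m x\<bar> \<le> M) \<and> 0 \<le> M"

lemma sq_integrable_mult:
  assumes "ess_bounded m M" "sq_integrable f"
  shows "sq_integrable (\<lambda>x. of_real (m x) * f x)"
proof (rule sq_integrable_dominated_AE[OF assms(2)])
  have [measurable]: "m \<in> borel_measurable lebesgue" "f \<in> borel_measurable lebesgue"
    using assms by (auto simp: ess_bounded_def sq_integrable_def)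
  show "(\<lambda>x. of_real (m x) * f x) \<in> borel_measurable lebesgue" by measurable
  have "AE x in lebesgue. \<bar>m x\<bar> \<le> M" using assms(1) by (auto simp: ess_bounded_def)
  then show "AE x in lebesgue. cmod (of_real (m x) * f x) \<le> M * cmod (f x)"
    by eventually_elim (auto simp: norm_mult intro: mult_right_mono)
qed

lemma rep_mult_L2:
  assumes "ess_bounded m M"
  shows "AE x in lebesgue. rep_L2 (mult_L2 m u) x = of_real (m x) * rep_L2 u x"
  unfolding mult_L2_def by (rule rep_abs_L2[OF sq_integrable_mult[OF assms sq_integrable_rep]])

lemma mult_L2_abs:
  assumes "ess_bounded m M" "sq_integrable f"
  shows "mult_L2 m (abs_L2 f) = abs_L2 (\<lambda>x. of_real (m x) * f x)"
  unfolding mult_L2_def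
  by (rule abs_L2_eqI) (use rep_abs_L2[OF assms(2)] in \<open>auto intro: sq_integrable_mult[OF assms(1)] assms(2)\<close>)

lemma norm_mult_L2:
  assumes "ess_bounded m M"
  shows "norm (mult_L2 m u) \<le> M * norm u"
proof -
  have "AE x in lebesgue. \<bar>m x\<bar> \<le> M" "0 \<le> M" using assms(1) by (auto simp: ess_bounded_def)
  then have "norm (mult_L2 m u) \<le> M * norm (abs_L2 (rep_L2 u))"
    unfolding mult_L2_def
    by (intro norm_abs_L2_le sq_integrable_mult[OF assms])
      (auto simp: norm_mult elim!: eventually_mono intro: mult_right_mono)
  then show ?thesis by simp
qed

lemma mult_L2_add:
  assumes "ess_bounded m M"
  shows "mult_L2 m (u + v) = mult_L2 m u + mult_L2 m v"
  by (rule L2_eqI)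
    (use rep_mult_L2[OF assms, of "u + v"] rep_mult_L2[OF assms, of u] rep_mult_L2[OF assms, of v]
       rep_L2_add[of "mult_L2 m u" "mult_L2 m v"] rep_L2_add[of u v]
     in \<open>eventually_elim; simp add: algebra_simps\<close>)

lemma mult_L2_cscale:
  assumes "ess_bounded m M"
  shows "mult_L2 m (cscale c u) = cscale c (mult_L2 m u)"
  by (rule L2_eqI)
    (use rep_mult_L2[OF assms, of "cscale c u"] rep_mult_L2[OF assms, of u]
       rep_L2_cscale[of c u] rep_L2_cscale[of c "mult_L2 m u"]
     in \<open>eventually_elim; simp add: algebra_simps\<close>)

lemma bounded_linear_mult_L2: "ess_bounded m M \<Longrightarrow> bounded_linear (mult_L2 m)"
  by (rule bounded_linear_intro[where K = M])
    (auto simp: scaleR_eq_cscale mult_L2_cscale mult_L2_add norm_mult_L2 mult.commute)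

lemma cinner_mult_L2:
  assumes "ess_bounded m M"
  shows "cinner (mult_L2 m u) v = (LINT x|lebesgue. of_real (m x) * rep_L2 u x * cnj (rep_L2 v x))"
  using cinner_abs_L2[OF sq_integrable_mult[OF assms sq_integrable_rep[of u]] sq_integrable_rep[of v]]
  by (simp add: mult_L2_def)

lemma cinner_mult_L2_right:
  assumes "ess_bounded m M"
  shows "cinner u (mult_L2 m v) = cinner (mult_L2 m u) v"
proof -
  have "cinner u (mult_L2 m v) = cnj (cinner (mult_L2 m v) u)" by (rule cinner_commute)
  also have "\<dots> = cinner (mult_L2 m u) v"
    unfolding cinner_mult_L2[OF assms]
    by (subst Bochner_Integration.integral_cnj[symmetric], rule Bochner_Integration.integral_cong) auto
  finally show ?thesis .
qed

lemma ess_bounded_indicator: "A \<in> sets lebesgue \<Longrightarrow> ess_bounded (indicator A) 1"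
  by (auto simp: ess_bounded_def indicator_def)

lemma restrict_L2_eq_mult: "restrict_L2 A = mult_L2 (indicator A)"
  by (simp add: restrict_L2_def mult_L2_def fun_eq_iff of_real_indicator)

lemma rep_restrict_L2:
  assumes "A \<in> sets lebesgue"
  shows "AE x in lebesgue. rep_L2 (restrict_L2 A u) x = indicator A x * rep_L2 u x"
  using rep_mult_L2[OF ess_bounded_indicator[OF assms], of u]
  by (simp add: restrict_L2_eq_mult of_real_indicator)

lemma bounded_linear_restrict_L2: "A \<in> sets lebesgue \<Longrightarrow> bounded_linear (restrict_L2 A)"
  unfolding restrict_L2_eq_mult by (rule bounded_linear_mult_L2[OF ess_bounded_indicator])

lemma norm_restrict_L2: "A \<in> sets lebesgue \<Longrightarrow> norm (restrict_L2 A u) \<le> norm u"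
  using norm_mult_L2[OF ess_bounded_indicator, of A u] by (simp add: restrict_L2_eq_mult)

lemma restrict_L2_cscale: "A \<in> sets lebesgue \<Longrightarrow> restrict_L2 A (cscale c u) = cscale c (restrict_L2 A u)"
  unfolding restrict_L2_eq_mult by (rule mult_L2_cscale[OF ess_bounded_indicator])

lemma cinner_restrict_L2:
  "A \<in> sets lebesgue \<Longrightarrow> cinner u (restrict_L2 A v) = cinner (restrict_L2 A u) v"
  unfolding restrict_L2_eq_mult by (rule cinner_mult_L2_right[OF ess_bounded_indicator])

lemma restrict_L2_abs:
  "A \<in> sets lebesgue \<Longrightarrow> sq_integrable f \<Longrightarrow>
    restrict_L2 A (abs_L2 f) = abs_L2 (\<lambda>x. indicator A x * f x)"
  using mult_L2_abs[OF ess_bounded_indicator, of A f]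
  by (simp add: restrict_L2_eq_mult of_real_indicator)

lemma restrict_restrict_L2:
  assumes "A \<in> sets lebesgue" "B \<in> sets lebesgue"
  shows "restrict_L2 A (restrict_L2 B u) = restrict_L2 (A \<inter> B) u"
  by (rule L2_eqI)
    (use rep_restrict_L2[OF assms(1), of "restrict_L2 B u"] rep_restrict_L2[OF assms(2), of u]
       rep_restrict_L2[OF sets.Int[OF assms], of u]
     in \<open>eventually_elim; simp add: indicator_inter_arith\<close>)

lemma restrict_L2_in: "A \<in> sets lebesgue \<Longrightarrow> A \<subseteq> B \<Longrightarrow> restrict_L2 A u \<in> L2_on B"
  unfolding L2_on_def using rep_restrict_L2[of A u]
  by (auto elim!: eventually_mono simp: indicator_def)

lemma restrict_L2_ident:
  assumes "A \<in> sets lebesgue" "u \<in> L2_on A"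
  shows "restrict_L2 A u = u"
  by (rule L2_eqI)
    (use rep_restrict_L2[OF assms(1), of u] assms(2)[unfolded L2_on_def mem_Collect_eq]
     in \<open>eventually_elim; auto simp: indicator_def\<close>)

lemma L2_on_iff: "A \<in> sets lebesgue \<Longrightarrow> u \<in> L2_on A \<longleftrightarrow> restrict_L2 A u = u"
  using restrict_L2_ident restrict_L2_in by (metis order_refl)

lemma L2_on_mono: "A \<subseteq> B \<Longrightarrow> L2_on A \<subseteq> L2_on B"
  unfolding L2_on_def by (auto elim!: eventually_mono)

lemma L2_on_lin:
  assumes "A \<in> sets lebesgue" "u \<in> L2_on A" "v \<in> L2_on A"
  shows "u + v \<in> L2_on A" "u - v \<in> L2_on A"
  using assms(2,3) bounded_linear_restrict_L2[OF assms(1)]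
  by (auto simp: L2_on_iff[OF assms(1)] linear_simps)

lemma L2_on_scale:
  assumes "A \<in> sets lebesgue" "u \<in> L2_on A"
  shows "cscale c u \<in> L2_on A" "r *\<^sub>R u \<in> L2_on A" "- u \<in> L2_on A"
  using assms(2) bounded_linear_restrict_L2[OF assms(1)]
  by (auto simp: L2_on_iff[OF assms(1)] restrict_L2_cscale[OF assms(1)] linear_simps)

lemma zero_L2_on: "0 \<in> L2_on A"
  unfolding L2_on_def using rep_L2_zero by (auto elim!: eventually_mono)

lemma closed_L2_on:
  assumes "A \<in> sets lebesgue" shows "closed (L2_on A)"
proof -
  have "L2_on A = {u. restrict_L2 A u = u}" using L2_on_iff[OF assms] by blast
  then show ?thesis
    using closed_Collect_eq[OF linear_continuous_on[OF bounded_linear_restrict_L2[OF assms]]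
        continuous_on_id] by simp
qed

subsection \<open>Measure-preserving involutions\<close>

definition comp_L2 :: "('a::euclidean_space \<Rightarrow> 'a) \<Rightarrow> 'a L2 \<Rightarrow> 'a L2" where
  "comp_L2 R u = abs_L2 (\<lambda>x. rep_L2 u (R x))"

text \<open>Preserving the measure makes \<open>comp_L2 R\<close> unitary, being an involution makes
  it its own inverse; together it is self-adjoint.\<close>

locale measure_involution =
  fixes R :: "'a::euclidean_space \<Rightarrow> 'a"
  assumes meas_R [measurable]: "R \<in> lebesgue \<rightarrow>\<^sub>M lebesgue"
    and distr_R: "distr lebesgue lebesgue R = lebesgue"
    and invol [simp]: "R (R x) = x"
begin

lemma AE_R:
  assumes "AE x in lebesgue. P x" shows "AE x in lebesgue. P (R x)"
proof -
  have "AE x in distr lebesgue lebesgue R. P x" unfolding distr_R by (rule assms)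
  then show ?thesis by (rule AE_distrD[OF meas_R])
qed

lemma integral_R:
  fixes f :: "'a \<Rightarrow> 'b::{banach, second_countable_topology}"
  assumes "f \<in> borel_measurable lebesgue"
  shows "(LINT x|lebesgue. f (R x)) = (LINT x|lebesgue. f x)"
  using integral_distr[OF meas_R, of f] assms by (simp add: distr_R)

lemma sq_integrable_R:
  assumes "sq_integrable f" shows "sq_integrable (\<lambda>x. f (R x))"
proof -
  have [measurable]: "f \<in> borel_measurable lebesgue" using assms by (rule sq_integrableD)
  have "integrable (distr lebesgue lebesgue R) (\<lambda>x. (cmod (f x))\<^sup>2)"
    using assms by (simp add: distr_R sq_integrable_def)
  then show ?thesis
    unfolding sq_integrable_def by (subst (asm) integrable_distr_eq) auto
qed

lemma rep_comp_L2: "AE x in lebesgue. rep_L2 (comp_L2 R u) x = rep_L2 u (R x)"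
  unfolding comp_L2_def by (rule rep_abs_L2[OF sq_integrable_R[OF sq_integrable_rep]])

lemma comp_L2_abs:
  assumes "sq_integrable f" shows "comp_L2 R (abs_L2 f) = abs_L2 (\<lambda>x. f (R x))"
  unfolding comp_L2_def
  by (rule abs_L2_eqI) (use AE_R[OF rep_abs_L2[OF assms]] in \<open>auto intro: sq_integrable_R assms\<close>)

lemma comp_L2_comp_L2 [simp]: "comp_L2 R (comp_L2 R u) = u"
  by (rule L2_eqI)
    (use AE_R[OF rep_comp_L2[of u]] rep_comp_L2[of "comp_L2 R u"] in \<open>eventually_elim; simp\<close>)

lemma comp_L2_add: "comp_L2 R (u + v) = comp_L2 R u + comp_L2 R v"
  by (rule L2_eqI)
    (use AE_R[OF rep_L2_add[of u v]] rep_comp_L2[of "u + v"] rep_comp_L2[of u] rep_comp_L2[of v]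
       rep_L2_add[of "comp_L2 R u" "comp_L2 R v"] in \<open>eventually_elim; simp\<close>)

lemma comp_L2_cscale: "comp_L2 R (cscale c u) = cscale c (comp_L2 R u)"
  by (rule L2_eqI)
    (use AE_R[OF rep_L2_cscale[of c u]] rep_comp_L2[of "cscale c u"] rep_comp_L2[of u]
       rep_L2_cscale[of c "comp_L2 R u"] in \<open>eventually_elim; simp\<close>)

lemma cinner_comp_comp: "cinner (comp_L2 R u) (comp_L2 R v) = cinner u v"
proof -
  note [measurable] = sq_integrable_mult_integrable[OF sq_integrable_rep[of u] sq_integrable_rep[of v],
      THEN borel_measurable_integrable]
  show ?thesis
    unfolding comp_L2_def
    by (subst cinner_abs_L2[OF sq_integrable_R sq_integrable_R])
      (auto simp: cinner_rep integral_R[of "\<lambda>x. rep_L2 u x * cnj (rep_L2 v x)"])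
qed

lemma cinner_comp_left: "cinner (comp_L2 R u) v = cinner u (comp_L2 R v)"
  using cinner_comp_comp[of u "comp_L2 R v"] by simp

lemma norm_comp_L2 [simp]: "norm (comp_L2 R u) = norm u"
  by (simp add: norm_eq_sqrt_inner inner_L2_def cinner_comp_comp)

lemma bounded_linear_comp_L2: "bounded_linear (comp_L2 R)"
  by (rule bounded_linear_intro[where K = 1])
    (auto simp: scaleR_eq_cscale comp_L2_cscale comp_L2_add)

lemma comp_L2_on: "u \<in> L2_on A \<Longrightarrow> (\<And>x. R x \<in> A \<longleftrightarrow> x \<in> B) \<Longrightarrow> comp_L2 R u \<in> L2_on B"
  unfolding L2_on_def
  using rep_comp_L2[of u] AE_R[of "\<lambda>x. x \<notin> A \<longrightarrow> rep_L2 u x = 0"] by (auto elim!: eventually_elim2)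

lemma comp_mult_L2:
  assumes "ess_bounded m M" "ess_bounded m' M" "AE x in lebesgue. m' x = m (R x)"
  shows "comp_L2 R (mult_L2 m u) = mult_L2 m' (comp_L2 R u)"
  by (rule L2_eqI)
    (use AE_R[OF rep_mult_L2[OF assms(1), of u]] rep_mult_L2[OF assms(2), of "comp_L2 R u"]
       rep_comp_L2[of u] rep_comp_L2[of "mult_L2 m u"] assms(3) in \<open>eventually_elim; simp\<close>)

lemma comp_restrict_L2:
  assumes "A \<in> sets lebesgue" "B \<in> sets lebesgue" "\<And>x. R x \<in> A \<longleftrightarrow> x \<in> B"
  shows "comp_L2 R (restrict_L2 A u) = restrict_L2 B (comp_L2 R u)"
  unfolding restrict_L2_eq_mult
  by (rule comp_mult_L2[OF ess_bounded_indicator[OF assms(1)] ess_bounded_indicator[OF assms(2)]])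
    (auto simp: indicator_def assms(3))

end

section \<open>Semigroups commute with symmetries of their generators\<close>

text \<open>Banach-Steinhaus. The closed sets \<open>F k\<close> cover a complete space, so by Baire
  one of them contains a ball around some \<open>x0\<close>; subtracting \<open>A n x0\<close> moves
  the bound to a ball around 0, and scaling finishes.\<close>

lemma uniform_boundedness:
  fixes A :: "nat \<Rightarrow> 'a::banach \<Rightarrow> 'b::real_normed_vector"
  assumes lin: "\<And>n. bounded_linear (A n)" and pw: "\<And>x. Bseq (\<lambda>n. A n x)"
  shows "\<exists>K. \<forall>n x. norm (A n x) \<le> K * norm x"
proof -
  define F where "F k = {x. \<forall>n. norm (A n x) \<le> real k}" for k
  have clF: "closed (F k)" for k
    unfolding F_def
    by (intro closed_Collect_all closed_Collect_le continuous_on_norm continuous_on_const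
        linear_continuous_on lin)
  have "\<exists>k. interior (F k) \<noteq> {}"
  proof (rule ccontr)
    assume "\<not> ?thesis"
    then have "euclidean interior_of \<Union>(range F) = {}"
      using clF completely_metrizable_space_euclidean by (intro Baire_category_alt) auto
    moreover have "\<Union>(range F) = UNIV"
    proof -
      have "\<exists>k. x \<in> F k" for x
      proof -
        obtain B where B: "\<And>n. norm (A n x) \<le> B" using pw[of x] by (auto simp: Bseq_def)
        obtain k where "B \<le> real k" using real_arch_simple by blast
        then show ?thesis using B unfolding F_def by (intro exI[of _ k]) (auto intro: order_trans)
      qed
      then show ?thesis by blast
    qed
    ultimately show False by simp
  qed
  then obtain k x0 e where e: "e > 0" "ball x0 e \<subseteq> F k"
    by (metis all_not_in_conv mem_interior)
  have small: "norm (A n y) \<le> 2 * real k" if "norm y < e" for n y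
  proof -
    have "x0 + y \<in> F k" "x0 \<in> F k" using e that by (auto simp: dist_norm subset_iff)
    then have "norm (A n (x0 + y)) \<le> real k" "norm (A n x0) \<le> real k" by (auto simp: F_def)
    moreover have "A n y = A n (x0 + y) - A n x0"
      using lin[of n] by (simp add: linear_simps)
    ultimately show ?thesis using norm_triangle_ineq4[of "A n (x0 + y)" "A n x0"] by simp
  qed
  have "norm (A n x) \<le> (4 * real k / e) * norm x" for n x
  proof (cases "x = 0")
    case True
    then show ?thesis using lin[of n] by (simp add: linear_simps)
  next
    case False
    let ?c = "e / (2 * norm x)"
    have "norm (A n (?c *\<^sub>R x)) \<le> 2 * real k"
      using False e(1) by (intro small) (simp add: field_simps)
    then show ?thesis
      using False e(1) lin[of n] by (simp add: linear_simps field_simps)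
  qed
  then show ?thesis by blast
qed

text \<open>Bridges two formats: integrals of orbits are differentiable within a closed interval,
  whereas \<open>generator\<close> asks for a limit of right difference quotients.\<close>

lemma vector_derivative_at_right:
  fixes f :: "real \<Rightarrow> 'a::real_normed_vector"
  assumes "(f has_vector_derivative D) (at t within {0..d})" "0 \<le> t" "t < d"
  shows "((\<lambda>h. (1 / h) *\<^sub>R (f (t + h) - f t)) \<longlongrightarrow> D) (at_right 0)"
proof -
  have "(f has_vector_derivative D) (at t within {t<..<d})"
    by (rule has_vector_derivative_within_subset[OF assms(1)]) (use assms(2) in auto)
  then have "((\<lambda>z. (1 / norm (z - t)) *\<^sub>R (f z - (f t + (z - t) *\<^sub>R D))) \<longlongrightarrow> 0) (at t within {t<..<d})"
    by (simp add: has_vector_derivative_def has_derivative_within)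
  moreover have "at t within {t<..<d} = at_right t"
    using assms(3) by (intro at_within_nhd[of _ "{..<d}"]) auto
  ultimately have "((\<lambda>z. (1 / norm (z - t)) *\<^sub>R (f z - (f t + (z - t) *\<^sub>R D))) \<longlongrightarrow> 0) (at_right t)"
    by simp
  then have *: "((\<lambda>h. (1 / norm (h + t - t)) *\<^sub>R (f (h + t) - (f t + (h + t - t) *\<^sub>R D))) \<longlongrightarrow> 0) (at_right 0)"
    by (simp add: filterlim_at_right_to_0[of _ _ t])
  have "((\<lambda>h. (1 / h) *\<^sub>R (f (t + h) - f t) - D) \<longlongrightarrow> 0) (at_right 0)"
    by (rule Lim_transform_eventually[OF *])
      (auto simp: eventually_at_right_field algebra_simps intro!: exI[of _ 1])
  then show ?thesis by (rule LIM_zero_cancel)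
qed

section \<open>Orbits of a strongly continuous semigroup on \<open>L2_on \<Omega>\<close>\<close>

context
  fixes \<Omega> :: "'a::euclidean_space set" and E :: "real \<Rightarrow> 'a L2 \<Rightarrow> 'a L2"
  assumes \<Omega>: "\<Omega> \<in> sets lebesgue" and C0: "C0_semigroup (L2_on \<Omega>) E"
begin

lemma C0_in: "t \<ge> 0 \<Longrightarrow> f \<in> L2_on \<Omega> \<Longrightarrow> E t f \<in> L2_on \<Omega>"
  and C0_add: "t \<ge> 0 \<Longrightarrow> f \<in> L2_on \<Omega> \<Longrightarrow> g \<in> L2_on \<Omega> \<Longrightarrow> E t (f + g) = E t f + E t g"
  and C0_cscale: "t \<ge> 0 \<Longrightarrow> f \<in> L2_on \<Omega> \<Longrightarrow> E t (cscale c f) = cscale c (E t f)"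
  and C0_bound: "t \<ge> 0 \<Longrightarrow> \<exists>K. \<forall>f\<in>L2_on \<Omega>. norm (E t f) \<le> K * norm f"
  and C0_0: "f \<in> L2_on \<Omega> \<Longrightarrow> E 0 f = f"
  and C0_semi: "s \<ge> 0 \<Longrightarrow> t \<ge> 0 \<Longrightarrow> f \<in> L2_on \<Omega> \<Longrightarrow> E (s + t) f = E s (E t f)"
  and C0_lim: "f \<in> L2_on \<Omega> \<Longrightarrow> ((\<lambda>t. E t f) \<longlongrightarrow> f) (at_right 0)"
  using C0 unfolding C0_semigroup_def by auto

lemma C0_scaleR: "t \<ge> 0 \<Longrightarrow> f \<in> L2_on \<Omega> \<Longrightarrow> E t (r *\<^sub>R f) = r *\<^sub>R E t f"
  by (simp add: scaleR_eq_cscale C0_cscale)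

lemma C0_diff:
  assumes "t \<ge> 0" "f \<in> L2_on \<Omega>" "g \<in> L2_on \<Omega>" shows "E t (f - g) = E t f - E t g"
  using C0_add[OF assms(1) L2_on_lin(2)[OF \<Omega> assms(2,3)] assms(3)] by simp

text \<open>Nothing is known about \<open>E t\<close> off \<open>L2_on \<Omega>\<close>.
  Precomposing with the projection \<open>restrict_L2 \<Omega>\<close> gives a bounded operator on
  the whole Hilbert space, as uniform boundedness and the exchange with integrals require.\<close>

lemma C0_bounded_linear:
  assumes "t \<ge> 0" shows "bounded_linear (\<lambda>f. E t (restrict_L2 \<Omega> f))"
proof -
  note P = bounded_linear_restrict_L2[OF \<Omega>] and in_X = restrict_L2_in[OF \<Omega> order_refl]
  obtain K where K: "\<And>f. f \<in> L2_on \<Omega> \<Longrightarrow> norm (E t f) \<le> K * norm f"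
    using C0_bound[OF assms] by blast
  show ?thesis
  proof (rule bounded_linear_intro[where K = "\<bar>K\<bar>"])
    fix f
    have "norm (E t (restrict_L2 \<Omega> f)) \<le> \<bar>K\<bar> * norm (restrict_L2 \<Omega> f)"
      using order_trans[OF K[OF in_X[of f]] mult_right_mono[of K "\<bar>K\<bar>"]] by simp
    also have "\<dots> \<le> \<bar>K\<bar> * norm f" by (intro mult_left_mono norm_restrict_L2 \<Omega>) auto
    finally show "norm (E t (restrict_L2 \<Omega> f)) \<le> norm f * \<bar>K\<bar>" by (simp add: mult.commute)
  qed (use P assms in_X in \<open>auto simp: linear_simps C0_add C0_scaleR\<close>)
qed

text \<open>Otherwise there are times \<open>t n\<close> tending to 0 at which the operator norm
  exceeds \<open>n\<close>. Strong continuity at 0 makes every sequence \<open>E (t n) g\<close>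
  convergent, hence bounded, which contradicts the uniform boundedness principle.\<close>

lemma C0_locally_bounded: "\<exists>\<delta>>0. \<exists>K\<ge>0. \<forall>t\<in>{0..\<delta>}. \<forall>f\<in>L2_on \<Omega>. norm (E t f) \<le> K * norm f"
proof (rule ccontr)
  assume not: "\<not> ?thesis"
  have "\<exists>t f. 0 \<le> t \<and> t \<le> 1 / real (Suc n) \<and> f \<in> L2_on \<Omega> \<and> norm (E t f) > real n * norm f" for n
  proof (rule ccontr)
    assume "\<not> ?thesis"
    then have "\<forall>t\<in>{0..1 / real (Suc n)}. \<forall>f\<in>L2_on \<Omega>. norm (E t f) \<le> real n * norm f"
      by (metis atLeastAtMost_iff linorder_not_less)
    then show False using not by (metis divide_pos_pos of_nat_0_le_iff of_nat_0_less_iff zero_less_Suc zero_less_one)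
  qed
  then obtain t f where t: "\<And>n. 0 \<le> t n" "\<And>n. t n \<le> 1 / real (Suc n)"
    and f: "\<And>n. f n \<in> L2_on \<Omega>" "\<And>n. norm (E (t n) (f n)) > real n * norm (f n)"
    by metis
  have t0: "t \<longlonglongrightarrow> 0"
    by (rule tendsto_sandwich[OF _ _ tendsto_const lim_1_over_n[THEN LIMSEQ_Suc]]) (use t in auto)
  have conv: "(\<lambda>n. E (t n) g) \<longlonglongrightarrow> g" if g: "g \<in> L2_on \<Omega>" for g
  proof (rule tendstoI)
    fix e :: real assume e: "e > 0"
    have "\<forall>\<^sub>F s in at_right 0. dist (E s g) g < e" using C0_lim[OF g] e by (rule tendstoD)
    then obtain d where d: "d > 0" "\<And>s. 0 < s \<Longrightarrow> s < d \<Longrightarrow> dist (E s g) g < e"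
      by (auto simp: eventually_at_right_field)
    have "\<forall>\<^sub>F n in sequentially. t n < d" using order_tendstoD(2)[OF t0 d(1)] .
    then show "\<forall>\<^sub>F n in sequentially. dist (E (t n) g) g < e"
    proof eventually_elim
      case (elim n)
      then show ?case using d(2)[of "t n"] t(1)[of n] e C0_0[OF g] by (cases "t n = 0") auto
    qed
  qed
  have "\<exists>K. \<forall>n x. norm (E (t n) (restrict_L2 \<Omega> x)) \<le> K * norm x"
  proof (rule uniform_boundedness)
    show "bounded_linear (\<lambda>x. E (t n) (restrict_L2 \<Omega> x))" for n
      by (rule C0_bounded_linear[OF t(1)])
    show "Bseq (\<lambda>n. E (t n) (restrict_L2 \<Omega> x))" for x
      using conv[OF restrict_L2_in[OF \<Omega> order_refl]] by (intro convergent_imp_Bseq) (auto simp: convergent_def)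
  qed
  then obtain K where K: "\<And>n x. norm (E (t n) (restrict_L2 \<Omega> x)) \<le> K * norm x" by blast
  obtain n where "K \<le> real n" using real_arch_simple by blast
  have "real n * norm (f n) < norm (E (t n) (f n))" by (rule f)
  also have "\<dots> \<le> K * norm (f n)" using K[of n "f n"] by (simp add: restrict_L2_ident[OF \<Omega> f(1)])
  also have "\<dots> \<le> real n * norm (f n)" using \<open>K \<le> real n\<close> by (intro mult_right_mono) auto
  finally show False by simp
qed

text \<open>The earlier time is always factored out:
  \<open>E b g - E a g = E a (E (b - a) g - g)\<close>. So continuity from the right at 0 and the
  local bound give two-sided continuity. Dividing by \<open>K + 1\<close> covers
  \<open>K = 0\<close>.\<close>

lemma C0_continuous:
  assumes K: "0 \<le> K" "\<forall>t\<in>{0..\<delta>}. \<forall>f\<in>L2_on \<Omega>. norm (E t f) \<le> K * norm f" and g: "g \<in> L2_on \<Omega>"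
  shows "continuous_on {0..\<delta>} (\<lambda>s. E s g)"
  unfolding continuous_on_iff
proof (intro ballI allI impI)
  fix s e :: real assume s: "s \<in> {0..\<delta>}" and e: "e > 0"
  have "\<forall>\<^sub>F h in at_right 0. dist (E h g) g < e / (K + 1)"
    using C0_lim[OF g] by (rule tendstoD) (use e K(1) in simp)
  then obtain d where d: "d > 0" "\<And>h. 0 < h \<Longrightarrow> h < d \<Longrightarrow> dist (E h g) g < e / (K + 1)"
    by (auto simp: eventually_at_right_field)
  have near: "dist (E b g) (E a g) < e" if "a \<in> {0..\<delta>}" "a \<le> b" "b - a < d" for a b
  proof (cases "a = b")
    case False
    then have h: "0 < b - a" using that by simp
    have Eg: "E (b - a) g \<in> L2_on \<Omega>" using h g by (intro C0_in) auto
    have "E b g - E a g = E a (E (b - a) g - g)"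
      using C0_semi[of a "b - a" g] C0_diff[of a "E (b - a) g" g] h that(1) g Eg by simp
    then have "dist (E b g) (E a g) \<le> K * dist (E (b - a) g) g"
      using K(2) that(1) L2_on_lin(2)[OF \<Omega> Eg g] by (simp add: dist_norm)
    also have "\<dots> \<le> K * (e / (K + 1))"
      using d(2)[OF h] that(3) K(1) by (intro mult_left_mono) auto
    also have "\<dots> < e" using K(1) e by (simp add: field_simps)
    finally show ?thesis .
  qed (use e in simp)
  have "dist (E s' g) (E s g) < e" if "s' \<in> {0..\<delta>}" "dist s' s < d" for s'
    using near[of s s'] near[of s' s] s that by (cases "s \<le> s'") (auto simp: dist_real_def dist_commute)
  then show "\<exists>d>0. \<forall>s'\<in>{0..\<delta>}. dist s' s < d \<longrightarrow> dist (E s' g) (E s g) < e"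
    using d(1) by blast
qed

lemma generator_diff:
  assumes "(a, b) \<in> generator (L2_on \<Omega>) E" "(c, d) \<in> generator (L2_on \<Omega>) E"
  shows "(a - c, b - d) \<in> generator (L2_on \<Omega>) E"
proof -
  from assms have X: "a \<in> L2_on \<Omega>" "b \<in> L2_on \<Omega>" "c \<in> L2_on \<Omega>" "d \<in> L2_on \<Omega>"
    and l: "((\<lambda>t. (1 / t) *\<^sub>R (E t a - a)) \<longlongrightarrow> b) (at_right 0)"
      "((\<lambda>t. (1 / t) *\<^sub>R (E t c - c)) \<longlongrightarrow> d) (at_right 0)"
    by (auto simp: generator_def)
  have "((\<lambda>t. (1 / t) *\<^sub>R (E t (a - c) - (a - c))) \<longlongrightarrow> b - d) (at_right 0)"
  proof (rule Lim_transform_eventually[OF tendsto_diff[OF l]])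
    show "\<forall>\<^sub>F t in at_right 0. (1 / t) *\<^sub>R (E t a - a) - (1 / t) *\<^sub>R (E t c - c)
        = (1 / t) *\<^sub>R (E t (a - c) - (a - c))"
      using C0_diff[OF _ X(1,3)]
      by (auto simp: eventually_at_right_field scaleR_right_diff_distrib intro!: exI[of _ 1])
  qed
  then show ?thesis using L2_on_lin(2)[OF \<Omega>] X by (auto simp: generator_def)
qed

text \<open>Averaging an orbit produces elements of the domain of the generator for an arbitrary
  starting point. The bound \<open>t < \<delta>\<close> leaves room for \<open>t + h\<close> inside
  the interval on which the orbit is known to be continuous.\<close>

lemma C0_orbit_integral:
  assumes K: "0 \<le> K" "\<forall>t\<in>{0..\<delta>}. \<forall>f\<in>L2_on \<Omega>. norm (E t f) \<le> K * norm f" and g: "g \<in> L2_on \<Omega>"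
    and t: "0 \<le> t" "t < \<delta>"
  shows "(integral {0..t} (\<lambda>s. E s g), E t g - g) \<in> generator (L2_on \<Omega>) E"
proof -
  define y where "y t = integral {0..t} (\<lambda>s. E s g)" for t
  have cont: "continuous_on {0..\<delta>} (\<lambda>s. E s g)" by (rule C0_continuous[OF K g])
  have int: "(\<lambda>s. E s g) integrable_on {a..b}" if "0 \<le> a" "b \<le> \<delta>" for a b
    by (rule integrable_continuous_interval, rule continuous_on_subset[OF cont]) (use that in auto)
  have yd: "(y has_vector_derivative E s g) (at s within {0..\<delta>})" if "s \<in> {0..\<delta>}" for s
    unfolding y_def by (rule integral_has_vector_derivative[OF cont that])
  have Ph: "integral {0..t} (\<lambda>s. E h (E s g)) = E h (restrict_L2 \<Omega> (y t))" if "h \<ge> 0" for h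
  proof -
    have "integral {0..t} ((\<lambda>f. E h (restrict_L2 \<Omega> f)) \<circ> (\<lambda>s. E s g)) = E h (restrict_L2 \<Omega> (y t))"
      unfolding y_def using t by (intro integral_linear int C0_bounded_linear that) auto
    moreover have "integral {0..t} ((\<lambda>f. E h (restrict_L2 \<Omega> f)) \<circ> (\<lambda>s. E s g)) = integral {0..t} (\<lambda>s. E h (E s g))"
      by (rule integral_cong) (simp add: restrict_L2_ident[OF \<Omega> C0_in] g)
    ultimately show ?thesis by simp
  qed
  have yX: "y t \<in> L2_on \<Omega>"
  proof -
    have "y t = integral {0..t} (\<lambda>s. E 0 (E s g))"
      unfolding y_def by (rule integral_cong) (simp add: C0_0 C0_in g)
    also have "\<dots> = restrict_L2 \<Omega> (y t)"
      using Ph[of 0] by (simp add: C0_0 restrict_L2_in[OF \<Omega>])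
    finally show ?thesis using restrict_L2_in[OF \<Omega> order_refl, of "y t"] by simp
  qed
  \<comment> \<open>The semigroup law turns \<open>E h\<close> into a shift of the domain of
    integration, so the difference quotient of \<open>E h (y t)\<close> is the one of
    \<open>y\<close> at \<open>t\<close> minus the one at 0.\<close>
  have Ey: "E h (y t) = y (t + h) - y h" if h: "0 < h" "h < \<delta> - t" for h
  proof -
    have "E h (y t) = integral {0..t} (\<lambda>s. E h (E s g))"
      using Ph[of h] h(1) by (simp add: restrict_L2_ident[OF \<Omega> yX])
    also have "\<dots> = integral {0..t} (\<lambda>s. E (h + s) g)"
      by (rule integral_cong) (use h g in \<open>simp add: C0_semi\<close>)
    also have "\<dots> = integral {h..t + h} (\<lambda>s. E s g)"
      using integral_shift_Icc_real[of 0 t "\<lambda>s. E s g" h] by (simp add: o_def add.commute)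
    also have "\<dots> = y (t + h) - y h"
      unfolding y_def
      using Henstock_Kurzweil_Integration.integral_combine[of 0 h "t + h" "\<lambda>s. E s g"] int[of 0 "t + h"] h t
      by (simp add: algebra_simps)
    finally show ?thesis .
  qed
  have "((\<lambda>h. (1 / h) *\<^sub>R (y (t + h) - y t) - (1 / h) *\<^sub>R (y (0 + h) - y 0)) \<longlongrightarrow> E t g - E 0 g) (at_right 0)"
    by (intro tendsto_diff vector_derivative_at_right[where d = \<delta>] yd) (use t in auto)
  then have lim: "((\<lambda>h. (1 / h) *\<^sub>R (E h (y t) - y t)) \<longlongrightarrow> E t g - g) (at_right 0)"
    unfolding C0_0[OF g]
  proof (rule Lim_transform_eventually)
    have "y 0 = 0" by (simp add: y_def)
    then show "\<forall>\<^sub>F h in at_right 0. (1 / h) *\<^sub>R (y (t + h) - y t) - (1 / h) *\<^sub>R (y (0 + h) - y 0)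
        = (1 / h) *\<^sub>R (E h (y t) - y t)"
      using Ey t by (auto simp: eventually_at_right_field scaleR_diff_right intro!: exI[of _ "\<delta> - t"])
  qed
  have "E t g - g \<in> L2_on \<Omega>" using C0_in[OF t(1) g] g by (rule L2_on_lin[OF \<Omega>])
  with lim yX show ?thesis by (auto simp: generator_def y_def)
qed

text \<open>
  With \<open>y f t = \<integral>\<^sub>0\<^sup>t E s f ds\<close>, which lies in the domain of the generator for every \<open>f\<close>, the difference
  \<open>w t = U (y f t) - y (U f) t\<close> is an orbit of the semigroup starting at \<open>0\<close>; the energy estimate gives
  \<open>w = 0\<close>, and differentiation yields the claim.
\<close>

lemma C0_commute:
  assumes diss: "\<And>f h. (f, h) \<in> generator (L2_on \<Omega>) E \<Longrightarrow> inner h f \<le> M * (norm f)\<^sup>2"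
    and U: "bounded_linear U" "\<And>f. f \<in> L2_on \<Omega> \<Longrightarrow> U f \<in> L2_on \<Omega>"
    and inv: "\<And>f h. (f, h) \<in> generator (L2_on \<Omega>) E \<Longrightarrow> (U f, U h) \<in> generator (L2_on \<Omega>) E"
    and "t \<ge> 0" "f \<in> L2_on \<Omega>"
  shows "U (E t f) = E t (U f)"
proof -
  obtain \<delta> K where \<delta>: "\<delta> > 0"
    and K: "0 \<le> K" "\<forall>t\<in>{0..\<delta>}. \<forall>f\<in>L2_on \<Omega>. norm (E t f) \<le> K * norm f"
    using C0_locally_bounded by blast
  have local: "U (E t f) = E t (U f)" if t: "0 < t" "t < \<delta>" and f: "f \<in> L2_on \<Omega>" for t f
  proof -
    define y where "y g t = integral {0..t} (\<lambda>s. E s g)" for g t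
    define w where "w t = U (y f t) - y (U f) t" for t
    define w' where "w' t = U (E t f) - E t (U f)" for t
    have yd: "(y g has_vector_derivative E s g) (at s within {0..\<delta>})"
      if "g \<in> L2_on \<Omega>" "s \<in> {0..\<delta>}" for g s
      unfolding y_def by (rule integral_has_vector_derivative[OF C0_continuous[OF K that(1)] that(2)])
    have wd: "(w has_vector_derivative w' s) (at s within {0..\<delta>})" if "s \<in> {0..\<delta>}" for s
      unfolding w_def w'_def
      by (intro has_vector_derivative_diff bounded_linear.has_vector_derivative[OF U(1)] yd f U(2) that)
    have gen: "(w s, w' s) \<in> generator (L2_on \<Omega>) E" if s: "0 \<le> s" "s < \<delta>" for s
    proof -
      have "w' s = U (E s f - f) - (E s (U f) - U f)"
        using U(1) by (simp add: w'_def linear_simps)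
      then show ?thesis
        unfolding w_def y_def
        using generator_diff[OF inv[OF C0_orbit_integral[OF K f s]] C0_orbit_integral[OF K U(2)[OF f] s]]
        by simp
    qed
    have w0: "w s = 0" if s: "0 \<le> s" "s < \<delta>" for s
    proof -
      \<comment> \<open>Gronwall weight: since \<open>w' r\<close> is the generator applied to
        \<open>w r\<close>, the derivative of the squared norm is at most 2M times the squared
        norm.\<close>
      define \<phi> where "\<phi> r = exp (- (2 * M * r)) * inner (w r) (w r)" for r
      have "\<phi> s \<le> \<phi> 0"
      proof (rule DERIV_nonpos_imp_decreasing_open[OF s(1)])
        have "continuous_on {0..s} w"
          by (rule continuous_on_vector_derivative)
            (rule has_vector_derivative_within_subset[OF wd], use s in auto)
        then show "continuous_on {0..s} \<phi>" unfolding \<phi>_def by (intro continuous_intros)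
        fix r assume r: "0 < r" "r < s"
        have "(w has_vector_derivative w' r) (at r)"
          using wd[of r] r s at_within_Icc_at[of 0 r \<delta>] by simp
        then have "((\<lambda>r. inner (w r) (w r)) has_vector_derivative (inner (w r) (w' r) + inner (w' r) (w r))) (at r)"
          by (rule bounded_bilinear.has_vector_derivative[OF bounded_bilinear_inner]) fact
        then have i: "((\<lambda>r. inner (w r) (w r)) has_real_derivative 2 * inner (w' r) (w r)) (at r)"
          by (simp add: has_real_derivative_iff_has_vector_derivative inner_commute)
        have "(\<phi> has_real_derivative exp (- (2 * M * r)) * (2 * inner (w' r) (w r))
            + exp (- (2 * M * r)) * (- (2 * M)) * inner (w r) (w r)) (at r)"
          unfolding \<phi>_def by (rule derivative_eq_intros i refl | simp)+
        moreover have "exp (- (2 * M * r)) * (2 * inner (w' r) (w r))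
            + exp (- (2 * M * r)) * (- (2 * M)) * inner (w r) (w r)
            = exp (- (2 * M * r)) * (2 * (inner (w' r) (w r) - M * (norm (w r))\<^sup>2))"
          by (simp add: power2_norm_eq_inner algebra_simps)
        moreover have "\<dots> \<le> 0"
          using diss[OF gen, of r] r s by (intro mult_nonneg_nonpos) auto
        ultimately show "\<exists>y. (\<phi> has_real_derivative y) (at r) \<and> y \<le> 0" by metis
      qed
      also have "\<phi> 0 = 0" using U(1) by (simp add: \<phi>_def w_def y_def linear_simps)
      finally have "inner (w s) (w s) \<le> 0" by (simp add: \<phi>_def mult_le_0_iff)
      then show ?thesis by (metis inner_eq_zero_iff inner_ge_zero order_antisym)
    qed
    \<comment> \<open>At an interior time the identically vanishing \<open>w\<close> has derivative
      0, and its derivative \<open>w' t\<close> is the commutator.\<close>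
    have "(w has_vector_derivative w' t) (at t)"
      using wd[of t] t at_within_Icc_at[of 0 t \<delta>] by simp
    moreover have "(w has_vector_derivative 0) (at t)"
      by (rule has_vector_derivative_transform_within_open[OF has_vector_derivative_const, of "{0<..<\<delta>}" _ 0])
        (use t w0 in auto)
    ultimately have "w' t = 0" by (rule vector_derivative_unique_at)
    then show ?thesis by (simp add: w'_def)
  qed
  show ?thesis
  proof (cases "t = 0")
    case True
    then show ?thesis using assms(6) U(2) by (simp add: C0_0)
  next
    case False
    \<comment> \<open>An arbitrary time is cut into \<open>n\<close> equal steps shorter than
      \<delta>, along which the commutation is iterated.\<close>
    obtain n where n: "t / \<delta> < real n" using reals_Archimedean2 by blast
    have npos: "n > 0" using n assms(5) \<delta> False by (cases n) (auto simp: field_simps)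
    define s where "s = t / real n"
    have s: "0 < s" "s < \<delta>" using n npos False assms(5) \<delta> by (auto simp: s_def field_simps)
    have "U (E (real m * s) f) = E (real m * s) (U f)" for m
    proof (induction m)
      case 0
      then show ?case using assms(6) U(2) by (simp add: C0_0)
    next
      case (Suc m)
      have "E (real (Suc m) * s) g = E s (E (real m * s) g)" if "g \<in> L2_on \<Omega>" for g
        using C0_semi[of s "real m * s" g] s that by (simp add: algebra_simps)
      then show ?case
        using Suc local[OF s] C0_in[of "real m * s" f] s assms(6) U(2) by simp
    qed
    from this[of n] show ?thesis using npos by (simp add: s_def)
  qed
qed

end

section \<open>Smooth functions and test functions\<close>

lemma partial_deriv_eqI: "(f has_derivative f') (at x) \<Longrightarrow> partial_deriv i f x = f' (axis i 1)"
  unfolding partial_deriv_def by (simp add: frechet_derivative_at[symmetric])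

text \<open>Smoothness is the greatest property that implies differentiability and is inherited by
  partial derivatives, so it may be proved by exhibiting an invariant set.\<close>

lemma smooth_coinduct:
  assumes "f \<in> X" "\<And>f. f \<in> X \<Longrightarrow> f differentiable_on UNIV"
    "\<And>f i. f \<in> X \<Longrightarrow> partial_deriv i f \<in> X"
  shows "smooth f"
proof -
  have "foldr partial_deriv js f \<in> X" for js
    by (induction js) (auto intro: assms)
  then show ?thesis unfolding smooth_def using assms(2) by blast
qed

lemma smooth_partial_deriv: "smooth f \<Longrightarrow> smooth (partial_deriv i f)"
  unfolding smooth_def
proof
  fix js assume "\<forall>js. foldr partial_deriv js f differentiable_on UNIV"
  \<comment> \<open>\<open>foldr\<close> applies the last index of the list first.\<close>
  from this[rule_format, of "js @ [i]"]
  show "foldr partial_deriv js (partial_deriv i f) differentiable_on UNIV" by simp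
qed

lemma smooth_has_derivative: "smooth f \<Longrightarrow> (f has_derivative frechet_derivative f (at x)) (at x)"
  unfolding smooth_def
  by (drule spec[of _ "[]"]) (simp add: differentiable_on_def frechet_derivative_works)

lemma smooth_continuous: "smooth f \<Longrightarrow> continuous_on UNIV f"
  by (rule has_derivative_continuous_on[OF has_derivative_at_withinI[OF smooth_has_derivative]])

text \<open>A witnessing sequence of successive derivatives is convenient because for
  \<open>bump\<close> it is explicit: polynomials in 1/t times the exponential.\<close>

definition smooth1 :: "(real \<Rightarrow> real) \<Rightarrow> bool" where
  "smooth1 h \<longleftrightarrow> (\<exists>F :: nat \<Rightarrow> real \<Rightarrow> real. F 0 = h \<and> (\<forall>k t. (F k has_real_derivative F (Suc k) t) (at t)))"

lemma smooth1E:
  assumes "smooth1 h"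
  obtains h' where "smooth1 h'" "\<And>t. (h has_real_derivative h' t) (at t)"
proof -
  obtain F where F: "F 0 = h" "\<And>k t. (F k has_real_derivative F (Suc k) t) (at t)"
    using assms by (auto simp: smooth1_def)
  then show thesis
    by (intro that[of "F 1"]) (auto simp: smooth1_def intro!: exI[of _ "\<lambda>k. F (Suc k)"])
qed

text \<open>
  This set contains the partial derivatives of its elements, so it consists of smooth functions. The
  rule \<open>base\<close> makes closure under the other rules a statement about all smooth functions.
\<close>

inductive_set smooth_algebra :: "(real^'n::finite \<Rightarrow> complex) set" where
  base: "smooth f \<Longrightarrow> f \<in> smooth_algebra"
| add: "f \<in> smooth_algebra \<Longrightarrow> g \<in> smooth_algebra \<Longrightarrow> (\<lambda>x. f x + g x) \<in> smooth_algebra"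
| mult: "f \<in> smooth_algebra \<Longrightarrow> g \<in> smooth_algebra \<Longrightarrow> (\<lambda>x. f x * g x) \<in> smooth_algebra"
| cmult: "f \<in> smooth_algebra \<Longrightarrow> (\<lambda>x. c * f x) \<in> smooth_algebra"
| conj: "f \<in> smooth_algebra \<Longrightarrow> (\<lambda>x. cnj (f x)) \<in> smooth_algebra"
| comp: "smooth f \<Longrightarrow> linear (L :: real^'n \<Rightarrow> real^'n) \<Longrightarrow> (\<lambda>x. f (L x)) \<in> smooth_algebra"
| ridge: "smooth1 h \<Longrightarrow> (\<lambda>x. of_real (h (inner b x + c))) \<in> smooth_algebra"

lemma partial_deriv_add:
  assumes "f differentiable (at x)" "g differentiable (at x)"
  shows "partial_deriv i (\<lambda>x. f x + g x) x = partial_deriv i f x + partial_deriv i g x"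
  by (subst partial_deriv_eqI[OF has_derivative_add[OF assms[unfolded frechet_derivative_works]]])
    (simp add: partial_deriv_def)

lemma partial_deriv_mult:
  assumes "f differentiable (at x)" "g differentiable (at x)"
  shows "partial_deriv i (\<lambda>x. f x * g x) x = f x * partial_deriv i g x + partial_deriv i f x * g x"
  by (subst partial_deriv_eqI[OF has_derivative_mult[OF assms[unfolded frechet_derivative_works]]])
    (simp add: partial_deriv_def)

lemma partial_deriv_cmult:
  assumes "f differentiable (at x)"
  shows "partial_deriv i (\<lambda>x. c * f x) x = c * partial_deriv i f x"
  by (subst partial_deriv_eqI[OF has_derivative_mult_right[OF assms[unfolded frechet_derivative_works]]])
    (simp add: partial_deriv_def)

lemma partial_deriv_cnj:
  assumes "f differentiable (at x)"
  shows "partial_deriv i (\<lambda>x. cnj (f x)) x = cnj (partial_deriv i f x)"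
  by (subst partial_deriv_eqI[OF bounded_linear.has_derivative[OF bounded_linear_cnj
        assms[unfolded frechet_derivative_works]]])
    (simp add: partial_deriv_def)

lemma frechet_derivative_eq_sum_partial:
  fixes f :: "real^'n::finite \<Rightarrow> complex"
  assumes "f differentiable (at x)"
  shows "frechet_derivative f (at x) v = (\<Sum>j\<in>UNIV. of_real (v $ j) * partial_deriv j f x)"
proof -
  have lin: "linear (frechet_derivative f (at x))"
    using assms frechet_derivative_works has_derivative_linear by blast
  have "frechet_derivative f (at x) (\<Sum>j\<in>UNIV. (v $ j) *\<^sub>R axis j 1)
      = (\<Sum>j\<in>UNIV. (v $ j) *\<^sub>R frechet_derivative f (at x) (axis j 1))"
    by (simp add: linear_sum[OF lin] linear_scale[OF lin])
  also have "(\<Sum>j\<in>UNIV. (v $ j) *\<^sub>R axis j 1) = v"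
    using basis_expansion[of v] by (simp add: scalar_mult_eq_scaleR)
  finally show ?thesis by (simp add: partial_deriv_def scaleR_conv_of_real)
qed

lemma has_derivative_comp_linear:
  fixes f :: "real^'n::finite \<Rightarrow> complex" and L :: "real^'n \<Rightarrow> real^'n"
  assumes "f differentiable (at (L x))" "linear L"
  shows "((\<lambda>x. f (L x)) has_derivative (\<lambda>v. frechet_derivative f (at (L x)) (L v))) (at x)"
  using diff_chain_at[OF linear_imp_has_derivative[OF assms(2)] assms(1)[unfolded frechet_derivative_works]]
  by (simp add: o_def)

lemma partial_deriv_comp_linear:
  fixes f :: "real^'n::finite \<Rightarrow> complex" and L :: "real^'n \<Rightarrow> real^'n"
  assumes "f differentiable (at (L x))" "linear L"
  shows "partial_deriv i (\<lambda>x. f (L x)) x = (\<Sum>j\<in>UNIV. of_real (L (axis i 1) $ j) * partial_deriv j f (L x))"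
  using partial_deriv_eqI[OF has_derivative_comp_linear[OF assms]]
  by (simp add: frechet_derivative_eq_sum_partial[OF assms(1)])

lemma has_derivative_ridge:
  assumes "(h has_real_derivative d) (at (inner b x + c))"
  shows "((\<lambda>x. complex_of_real (h (inner b x + c))) has_derivative (\<lambda>v. of_real (inner b v * d))) (at x)"
proof -
  have "((\<lambda>x. inner b x + c) has_derivative (\<lambda>v. inner b v)) (at x)"
    by (auto intro!: derivative_eq_intros)
  from diff_chain_at[OF this assms[unfolded has_field_derivative_def]]
  show ?thesis
    by (intro bounded_linear.has_derivative[OF bounded_linear_of_real]) (simp add: o_def mult.commute)
qed

lemma partial_deriv_ridge:
  assumes "(h has_real_derivative d) (at (inner b x + c))"
  shows "partial_deriv i (\<lambda>x. complex_of_real (h (inner b x + c))) x = of_real (b $ i) * of_real d"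
  using partial_deriv_eqI[OF has_derivative_ridge[OF assms], of i] by (simp add: inner_axis)

lemma smooth_differentiable: "smooth f \<Longrightarrow> f differentiable (at x)"
  using smooth_has_derivative differentiableI by blast

lemma smooth_algebra_zero: "(\<lambda>x. 0) \<in> smooth_algebra"
proof -
  have "smooth (\<lambda>x. 0)"
  proof (rule smooth_coinduct[of _ "{\<lambda>x. 0}"])
    have "partial_deriv i (\<lambda>x :: real^'n. 0) = (\<lambda>x. 0)" for i
      by (rule ext) (rule partial_deriv_eqI[OF has_derivative_const])
    then show "partial_deriv i f \<in> {\<lambda>x. 0}" if "f \<in> {\<lambda>x. 0}" for f :: "real^'n \<Rightarrow> complex" and i
      using that by simp
  qed auto
  then show ?thesis by (rule smooth_algebra.base)
qed

lemma smooth_algebra_sum: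
  "(\<And>j. j \<in> J \<Longrightarrow> f j \<in> smooth_algebra) \<Longrightarrow> (\<lambda>x. \<Sum>j\<in>J. f j x) \<in> smooth_algebra"
  by (induction J rule: infinite_finite_induct) (auto intro: smooth_algebra.add smooth_algebra_zero)

text \<open>Differentiability and closure under partial derivatives are proved together, since the
  sum and product rules for the derivatives already require the factors to be
  differentiable.\<close>

lemma smooth_algebra_step:
  "f \<in> smooth_algebra \<Longrightarrow> (\<forall>x. f differentiable (at x)) \<and> (\<forall>i. partial_deriv i f \<in> smooth_algebra)"
proof (induction rule: smooth_algebra.induct)
  case (base f)
  then show ?case by (auto simp: smooth_differentiable smooth_partial_deriv intro: smooth_algebra.base)
next
  case (add f g)
  then have "partial_deriv i (\<lambda>x. f x + g x) = (\<lambda>x. partial_deriv i f x + partial_deriv i g x)" for i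
    by (auto simp: partial_deriv_add)
  then show ?case using add by (auto intro: smooth_algebra.intros)
next
  case (mult f g)
  then have "partial_deriv i (\<lambda>x. f x * g x) = (\<lambda>x. f x * partial_deriv i g x + partial_deriv i f x * g x)" for i
    by (auto simp: partial_deriv_mult)
  then show ?case using mult by (auto intro!: smooth_algebra.add smooth_algebra.mult)
next
  case (cmult f c)
  then have "partial_deriv i (\<lambda>x. c * f x) = (\<lambda>x. c * partial_deriv i f x)" for i
    by (auto simp: partial_deriv_cmult)
  then show ?case using cmult by (auto intro!: smooth_algebra.cmult)
next
  case (conj f)
  then have "partial_deriv i (\<lambda>x. cnj (f x)) = (\<lambda>x. cnj (partial_deriv i f x))" for i
    by (auto simp: partial_deriv_cnj)
  moreover have "(\<lambda>x. cnj (f x)) differentiable (at x)" for x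
    using conj.IH differentiableI[OF bounded_linear.has_derivative[OF bounded_linear_cnj]]
    unfolding frechet_derivative_works[of f] by blast
  ultimately show ?case using conj by (auto intro!: smooth_algebra.conj)
next
  case (comp f L)
  have "partial_deriv i (\<lambda>x. f (L x)) = (\<lambda>x. \<Sum>j\<in>UNIV. of_real (L (axis i 1) $ j) * partial_deriv j f (L x))" for i
    using comp by (auto simp: partial_deriv_comp_linear smooth_differentiable)
  moreover have "(\<lambda>x. f (L x)) differentiable (at x)" for x
    using has_derivative_comp_linear[OF smooth_differentiable[OF comp(1)] comp(2)] by (rule differentiableI)
  ultimately show ?case
    using comp by (auto intro!: smooth_algebra_sum smooth_algebra.cmult smooth_algebra.comp smooth_partial_deriv)
next
  case (ridge h b c)
  obtain h' where h': "smooth1 h'" "\<And>t. (h has_real_derivative h' t) (at t)" by (rule smooth1E[OF ridge]) (rule that)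
  have "partial_deriv i (\<lambda>x. complex_of_real (h (inner b x + c)))
      = (\<lambda>x. of_real (b $ i) * of_real (h' (inner b x + c)))" for i
    by (rule ext) (rule partial_deriv_ridge[OF h'(2)])
  then show ?case
    using differentiableI[OF has_derivative_ridge[OF h'(2)]] h'(1)
    by (auto intro!: smooth_algebra.cmult smooth_algebra.ridge)
qed

lemma smooth_iff_algebra: "smooth f \<longleftrightarrow> f \<in> smooth_algebra"
proof
  assume "f \<in> smooth_algebra"
  then show "smooth f"
    by (rule smooth_coinduct)
      (use smooth_algebra_step in \<open>auto simp: differentiable_on_def intro: differentiable_at_withinI\<close>)
qed (rule smooth_algebra.base)

lemmas smooth_add = smooth_algebra.add[folded smooth_iff_algebra]
  and smooth_mult = smooth_algebra.mult[folded smooth_iff_algebra]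
  and smooth_cmult = smooth_algebra.cmult[folded smooth_iff_algebra]
  and smooth_cnj = smooth_algebra.conj[folded smooth_iff_algebra]
  and smooth_comp = smooth_algebra.comp[folded smooth_iff_algebra]
  and smooth_ridge = smooth_algebra.ridge[folded smooth_iff_algebra]
  and smooth_zero = smooth_algebra_zero[folded smooth_iff_algebra]

lemma smooth_prod:
  "(\<And>j. j \<in> J \<Longrightarrow> smooth (f j)) \<Longrightarrow> smooth (\<lambda>x. \<Prod>j\<in>J. f j x)"
proof (induction J rule: infinite_finite_induct)
  case (insert j J)
  then show ?case by (auto intro: smooth_mult)
next
  have "smooth1 (\<lambda>t. 1)"
    unfolding smooth1_def
    by (rule exI[of _ "\<lambda>k t. if k = 0 then 1 else 0"]) auto
  from smooth_ridge[OF this] have one: "smooth (\<lambda>x. 1)" by simp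
  { case (infinite J) then show ?case using one by simp }
  { case empty then show ?case using one by simp }
qed

subsection \<open>The function exp(-1/t)\<close>

definition bump :: "real \<Rightarrow> real" where
  "bump t = (if t > 0 then exp (- inverse t) else 0)"

lemma bump_ge_0: "0 \<le> bump t" and bump_le_1: "bump t \<le> 1" and bump_eq_0: "t \<le> 0 \<Longrightarrow> bump t = 0"
  by (auto simp: bump_def)

lemma poly_exp_tendsto_0: "((\<lambda>u. poly p u * exp (- u)) \<longlongrightarrow> (0 :: real)) at_top"
proof -
  have "((\<lambda>u. \<Sum>i\<le>degree p. coeff p i * (u ^ i / exp u)) \<longlongrightarrow> (\<Sum>i\<le>degree p. coeff p i * 0)) at_top"
    by (intro tendsto_sum tendsto_mult tendsto_const tendsto_power_div_exp_0)
  then show ?thesis by (simp add: poly_altdef sum_distrib_right exp_minus divide_inverse mult.assoc)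
qed

text \<open>With u = 1/t the chain rule gives the derivative u^2 (p(u) - p'(u)) exp(-u); the factor
  u^2 is the polynomial \<open>[:0, 0, 1:]\<close>. At 0 exponential decay beats every
  polynomial.\<close>

lemma poly_bump_derivative:
  fixes p :: "real poly"
  defines "F \<equiv> \<lambda>p t. if t > 0 then poly p (inverse t) * exp (- inverse t) else 0"
  shows "(F p has_real_derivative F ([:0, 0, 1:] * (p - pderiv p)) t) (at t)"
proof -
  consider "t > 0" | "t < 0" | "t = 0" by linarith
  then show ?thesis
  proof cases
    case 1
    have "((\<lambda>t. poly p (inverse t) * exp (- inverse t)) has_real_derivative
        F ([:0, 0, 1:] * (p - pderiv p)) t) (at t)"
      using 1 unfolding F_def
      by (auto intro!: derivative_eq_intros DERIV_chain2[OF poly_DERIV] simp: algebra_simps power2_eq_square)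
    then show ?thesis
      by (rule has_field_derivative_transform_within_open[of _ _ _ "{0<..}"]) (use 1 in \<open>auto simp: F_def\<close>)
  next
    case 2
    have "((\<lambda>t. 0) has_real_derivative F ([:0, 0, 1:] * (p - pderiv p)) t) (at t)"
      using 2 by (simp add: F_def)
    then show ?thesis
      by (rule has_field_derivative_transform_within_open[of _ _ _ "{..<0}"]) (use 2 in \<open>auto simp: F_def\<close>)
  next
    case 3
    have "((\<lambda>h. F p h / h) \<longlongrightarrow> 0) (at_left 0)"
      by (rule tendsto_eventually) (auto simp: eventually_at_left_field F_def intro!: exI[of _ "-1"])
    moreover have "((\<lambda>h. F p h / h) \<longlongrightarrow> 0) (at_right 0)"
      unfolding filterlim_at_right_to_top
      \<comment> \<open>In the variable u = 1/h the quotient \<open>F p h / h\<close> is u p(u)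
        exp(-u), hence the polynomial \<open>[:0, 1:] * p\<close>.\<close>
      by (rule Lim_transform_eventually[OF poly_exp_tendsto_0[of "[:0, 1:] * p"]])
        (auto simp: F_def eventually_at_top_dense field_simps intro!: exI[of _ 0])
    ultimately have "((\<lambda>h. F p h / h) \<longlongrightarrow> 0) (at 0)"
      by (simp add: filterlim_split_at)
    then show ?thesis
      using 3 by (simp add: has_field_derivative_iff F_def)
  qed
qed

lemma smooth1_bump: "smooth1 bump"
proof -
  define F where "F k t = (if t > 0 then poly (((\<lambda>p. [:0, 0, 1:] * (p - pderiv p)) ^^ k) 1) (inverse t)
    * exp (- inverse t) else 0)" for k and t :: real
  have "F 0 = bump" by (auto simp: F_def bump_def)
  moreover have "(F k has_real_derivative F (Suc k) t) (at t)" for k t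
    unfolding F_def funpow.simps o_apply by (rule poly_bump_derivative)
  ultimately show ?thesis unfolding smooth1_def by blast
qed

definition bump' :: "real \<Rightarrow> real" where
  "bump' t = (if t > 0 then exp (- inverse t) * (inverse t)\<^sup>2 else 0)"

lemma bump_has_derivative: "(bump has_real_derivative bump' t) (at t)"
  using poly_bump_derivative[of 1 t]
  by (simp add: bump_def[abs_def] bump'_def power2_eq_square mult_ac cong: if_cong)

text \<open>The bound behind the cutoff near a hyperplane: \<open>t \<mapsto> bump (m t - 1)\<close> has derivative \<open>O(1 / t)\<close>.\<close>

lemma bump'_bound: "\<bar>t * bump' (t - 1)\<bar> \<le> 3"
proof (cases "t > 1")
  case True
  define u where "u = inverse (t - 1)"
  have u: "u > 0" using True by (simp add: u_def)
  have t: "t * u = 1 + u" using True by (simp add: u_def field_simps)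
  \<comment> \<open>The Taylor bound dominates u by exp u and u^2 by 2 exp u, which is where 3 comes
    from.\<close>
  have e: "1 + u + u\<^sup>2 / 2 \<le> exp u" using u exp_lower_Taylor_quadratic by simp
  have "t * bump' (t - 1) = exp (- u) * (t * u) * u"
    using True by (simp add: bump'_def u_def power2_eq_square)
  also have "\<dots> = (u + u\<^sup>2) / exp u" unfolding t by (simp add: exp_minus field_simps power2_eq_square)
  also have "\<dots> \<le> 3"
  proof -
    have "u + u\<^sup>2 \<le> 3 * exp u" using e u zero_le_power2[of u] by linarith
    then show ?thesis by (simp add: pos_divide_le_eq)
  qed
  finally have "t * bump' (t - 1) \<le> 3" .
  moreover have "t * bump' (t - 1) \<ge> 0" using True by (simp add: bump'_def)
  ultimately show ?thesis by simp
qed (auto simp: bump'_def)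

text \<open>Together with the uniform bound \<open>bump'_bound\<close> this is what dominated
  convergence needs in \<open>dcut_tendsto\<close>.\<close>

lemma bump'_tendsto: "((\<lambda>t. t * bump' (t - 1)) \<longlongrightarrow> 0) at_top"
proof -
  have "((\<lambda>t :: real. t * (inverse (t - 1))\<^sup>2) \<longlongrightarrow> 0) at_top" by real_asymp
  moreover have "\<forall>\<^sub>F t in at_top. norm (t * bump' (t - 1)) \<le> t * (inverse (t - 1))\<^sup>2"
    using eventually_gt_at_top[of 1]
    by eventually_elim (auto simp: bump'_def intro!: mult_left_mono mult_left_le_one_le)
  ultimately show ?thesis by (rule Lim_null_comparison[rotated])
qed

lemma bump_tendsto: "(bump \<longlongrightarrow> 1) at_top"
proof -
  have "((\<lambda>t :: real. exp (- inverse t)) \<longlongrightarrow> 1) at_top" by real_asymp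
  then show ?thesis
    by (rule Lim_transform_eventually)
      (use eventually_gt_at_top[of "0 :: real"] in \<open>eventually_elim; simp add: bump_def\<close>)
qed

subsection \<open>Test functions\<close>

text \<open>This rule and the elimination rule below replace the closure of the support by any
  compact set containing it, which is easier to transport under products, reflections and
  cutoffs.\<close>

lemma test_functionsI:
  assumes "smooth \<phi>" "compact K" "K \<subseteq> \<Omega>" "\<And>x. x \<notin> K \<Longrightarrow> \<phi> x = 0"
  shows "\<phi> \<in> test_functions \<Omega>"
proof -
  have "closure {x. \<phi> x \<noteq> 0} \<subseteq> K"
    by (rule closure_minimal) (use assms compact_imp_closed in auto)
  moreover have "bounded {x. \<phi> x \<noteq> 0}"
    by (rule bounded_subset[OF compact_imp_bounded[OF assms(2)]]) (use assms(4) in auto)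
  ultimately show ?thesis using assms by (auto simp: test_functions_def)
qed

lemma test_functionsE:
  assumes "\<phi> \<in> test_functions \<Omega>"
  obtains K where "smooth \<phi>" "compact K" "K \<subseteq> \<Omega>" "\<And>x. x \<notin> K \<Longrightarrow> \<phi> x = 0"
  using assms closure_subset[of "{x. \<phi> x \<noteq> 0}"]
  by (intro that[of "closure {x. \<phi> x \<noteq> 0}"]) (auto simp: test_functions_def)

lemma partial_deriv_zero_outside:
  assumes "compact K" "\<And>x. x \<notin> K \<Longrightarrow> \<phi> x = 0" "x \<notin> K"
  shows "partial_deriv i \<phi> x = 0"
proof -
  have "(\<phi> has_derivative (\<lambda>v. 0)) (at x)"
    by (rule has_derivative_transform_within_open[OF has_derivative_const[of 0], of "- K"])
      (use assms compact_imp_closed in auto)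
  then show ?thesis by (rule partial_deriv_eqI)
qed

lemma test_functions_partial_deriv:
  "\<phi> \<in> test_functions \<Omega> \<Longrightarrow> partial_deriv i \<phi> \<in> test_functions \<Omega>"
  by (elim test_functionsE, rule test_functionsI)
    (auto intro: smooth_partial_deriv partial_deriv_zero_outside)

lemma test_functions_mono: "A \<subseteq> B \<Longrightarrow> \<phi> \<in> test_functions A \<Longrightarrow> \<phi> \<in> test_functions B"
  by (auto simp: test_functions_def)

lemma test_functions_add:
  assumes "\<phi> \<in> test_functions \<Omega>" "\<psi> \<in> test_functions \<Omega>"
  shows "(\<lambda>x. \<phi> x + \<psi> x) \<in> test_functions \<Omega>"
proof -
  obtain K where K: "smooth \<phi>" "compact K" "K \<subseteq> \<Omega>" "\<And>x. x \<notin> K \<Longrightarrow> \<phi> x = 0"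
    using assms(1) by (auto elim: test_functionsE)
  obtain L where L: "smooth \<psi>" "compact L" "L \<subseteq> \<Omega>" "\<And>x. x \<notin> L \<Longrightarrow> \<psi> x = 0"
    using assms(2) by (auto elim: test_functionsE)
  show ?thesis
    by (rule test_functionsI[OF smooth_add[OF K(1) L(1)] compact_Un[OF K(2) L(2)]]) (use K L in auto)
qed

lemma test_functions_mult:
  assumes "\<phi> \<in> test_functions \<Omega>" "smooth f"
  shows "(\<lambda>x. f x * \<phi> x) \<in> test_functions \<Omega>"
  using assms by (elim test_functionsE, intro test_functionsI) (auto intro: smooth_mult)

lemma test_functions_cmult:
  assumes "\<phi> \<in> test_functions \<Omega>"
  shows "(\<lambda>x. c * \<phi> x) \<in> test_functions \<Omega>"
  using assms by (elim test_functionsE, intro test_functionsI) (auto intro: smooth_cmult)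

lemma test_functions_cnj:
  assumes "\<phi> \<in> test_functions \<Omega>"
  shows "(\<lambda>x. cnj (\<phi> x)) \<in> test_functions \<Omega>"
  using assms by (elim test_functionsE, intro test_functionsI) (auto intro: smooth_cnj)

lemma continuous_lebesgue_measurable:
  fixes f :: "'a::euclidean_space \<Rightarrow> 'b::topological_space"
  shows "continuous_on UNIV f \<Longrightarrow> f \<in> borel_measurable lebesgue"
  by (rule measurable_completion) (simp add: borel_measurable_continuous_onI)

lemma compact_support_bounded:
  fixes f :: "'a::euclidean_space \<Rightarrow> complex"
  assumes "continuous_on UNIV f" "compact K" "\<And>x. x \<notin> K \<Longrightarrow> f x = 0"
  obtains B where "B \<ge> 0" "\<And>x. cmod (f x) \<le> B"
proof -
  have "bounded (f ` K)"
    using assms(1,2) by (intro compact_imp_bounded compact_continuous_image) (auto intro: continuous_on_subset)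
  then obtain B where "B > 0" "\<And>x. x \<in> K \<Longrightarrow> cmod (f x) \<le> B"
    unfolding bounded_pos by auto
  then show thesis using assms(3) by (intro that[of B]) (metis less_eq_real_def norm_zero)+
qed

lemma sq_integrable_compact_support:
  assumes "f \<in> borel_measurable lebesgue" "compact K" "\<And>x. x \<notin> K \<Longrightarrow> f x = 0" "\<And>x. cmod (f x) \<le> B"
  shows "sq_integrable f"
proof (rule sq_integrable_dominated[OF sq_integrable_const_indicator[of K 1] assms(1), where c = B])
  show "K \<in> lmeasurable" using assms(2) by (rule lmeasurable_compact)
  show "cmod (f x) \<le> B * cmod (1 * indicator K x)" for x
    using assms(3,4)[of x] by (cases "x \<in> K") auto
qed

lemma sq_integrable_test:
  assumes "\<phi> \<in> test_functions \<Omega>" shows "sq_integrable \<phi>"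
proof -
  obtain K where K: "smooth \<phi>" "compact K" "\<And>x. x \<notin> K \<Longrightarrow> \<phi> x = 0"
    using assms by (auto elim: test_functionsE)
  obtain B where "B \<ge> 0" "\<And>x. cmod (\<phi> x) \<le> B"
    by (rule compact_support_bounded[OF smooth_continuous[OF K(1)] K(2,3)]) (auto intro: that)
  then show ?thesis
    by (intro sq_integrable_compact_support[OF continuous_lebesgue_measurable[OF smooth_continuous[OF K(1)]] K(2,3)])
qed

text \<open>The partial derivatives are continuous with compact support, hence bounded, and the mean
  value inequality applies. The constant later dominates difference quotients and controls odd parts
  near the hyperplane.\<close>

lemma test_function_lipschitz:
  assumes "\<phi> \<in> test_functions \<Omega>"
  obtains B where "B \<ge> 0" "\<And>x y. cmod (\<phi> x - \<phi> y) \<le> B * norm (x - y)"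
proof -
  obtain K where K: "smooth \<phi>" "compact K" "\<And>x. x \<notin> K \<Longrightarrow> \<phi> x = 0"
    using assms by (auto elim: test_functionsE)
  have "\<exists>b\<ge>0. \<forall>x. cmod (partial_deriv i \<phi> x) \<le> b" for i
    by (rule compact_support_bounded[OF smooth_continuous[OF smooth_partial_deriv[OF K(1)]] K(2)
          partial_deriv_zero_outside[OF K(2,3)]]) auto
  then obtain b where b: "\<And>i. b i \<ge> 0" "\<And>i x. cmod (partial_deriv i \<phi> x) \<le> b i" by metis
  have "onorm (frechet_derivative \<phi> (at x)) \<le> (\<Sum>i\<in>UNIV. b i)" for x
  proof (rule onorm_le)
    fix v
    have "norm (frechet_derivative \<phi> (at x) v) \<le> (\<Sum>i\<in>UNIV. norm v * b i)"
      unfolding frechet_derivative_eq_sum_partial[OF smooth_differentiable[OF K(1)]]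
      by (intro sum_norm_le) (auto simp: norm_mult intro!: mult_mono b component_le_norm_cart)
    then show "norm (frechet_derivative \<phi> (at x) v) \<le> (\<Sum>i\<in>UNIV. b i) * norm v"
      by (simp add: sum_distrib_left mult.commute)
  qed
  then have "cmod (\<phi> x - \<phi> y) \<le> (\<Sum>i\<in>UNIV. b i) * norm (x - y)" for x y
    by (intro differentiable_bound[of UNIV]) (auto intro: smooth_has_derivative[OF K(1)] has_derivative_at_withinI)
  then show thesis using b(1) by (intro that[of "\<Sum>i\<in>UNIV. b i"]) (auto intro: sum_nonneg)
qed

section \<open>Weak derivatives\<close>

lemma integrable_test:
  assumes "\<phi> \<in> test_functions \<Omega>" shows "integrable lebesgue \<phi>"
proof -
  obtain K where K: "smooth \<phi>" "compact K" "\<And>x. x \<notin> K \<Longrightarrow> \<phi> x = 0"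
    using assms by (auto elim: test_functionsE)
  obtain B where B: "B \<ge> 0" "\<And>x. cmod (\<phi> x) \<le> B"
    by (rule compact_support_bounded[OF smooth_continuous[OF K(1)] K(2,3)]) (auto intro: that)
  show ?thesis
  proof (rule Bochner_Integration.integrable_bound)
    show "integrable lebesgue (\<lambda>x. B * indicator K x)"
      using lmeasurable_compact[OF K(2)] by (intro integrable_mult_right integrable_real_indicator) (auto simp only: fmeasurable_def mem_Collect_eq infinity_ennreal_def)
    show "\<phi> \<in> borel_measurable lebesgue"
      by (rule continuous_lebesgue_measurable[OF smooth_continuous[OF K(1)]])
    show "AE x in lebesgue. norm (\<phi> x) \<le> norm (B * indicator K x)"
      using B K(3) by (auto simp: indicator_def)
  qed
qed

lemma integral_translation:
  fixes f :: "'a::euclidean_space \<Rightarrow> complex"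
  assumes "continuous_on UNIV f"
  shows "(LINT x|lebesgue. f (a + x)) = (LINT x|lebesgue. f x)"
    and "integrable lebesgue f \<Longrightarrow> integrable lebesgue (\<lambda>x. f (a + x))"
proof -
  have f: "f \<in> borel_measurable borel" by (rule borel_measurable_continuous_onI[OF assms])
  have [measurable]: "f \<in> borel_measurable lborel" "(\<lambda>x. f (a + x)) \<in> borel_measurable lborel"
    using f by (auto intro: measurable_compose[OF _ f])
  have "(LINT x|lborel. f (a + x)) = (LINT x|distr lborel borel ((+) a). f x)"
    by (rule integral_distr[symmetric]) (use f in auto)
  then show "(LINT x|lebesgue. f (a + x)) = (LINT x|lebesgue. f x)"
    by (simp add: lborel_distr_plus integral_completion)
  show "integrable lebesgue (\<lambda>x. f (a + x))" if "integrable lebesgue f"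
  proof -
    have "integrable (distr lborel borel ((+) a)) f"
      using that by (simp add: lborel_distr_plus integrable_completion)
    then show ?thesis
      by (subst (asm) integrable_distr_eq) (use f in \<open>auto simp: integrable_completion\<close>)
  qed
qed

text \<open>Translation invariance gives every difference quotient integral 0, and the quotients
  converge dominatedly to the partial derivative; no iterated integral is involved.\<close>

lemma integral_partial_deriv:
  assumes "\<phi> \<in> test_functions \<Omega>"
  shows "(LINT x|lebesgue. partial_deriv i \<phi> x) = 0"
proof -
  obtain K where K: "smooth \<phi>" "compact K" "\<And>x. x \<notin> K \<Longrightarrow> \<phi> x = 0"
    using assms by (auto elim: test_functionsE)
  obtain r where "\<forall>x\<in>K. norm x \<le> r"
    using compact_imp_bounded[OF K(2)] by (auto simp: bounded_iff)
  then have r: "K \<subseteq> cball 0 r" by auto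
  obtain B where B: "B \<ge> 0" "\<And>x y. cmod (\<phi> x - \<phi> y) \<le> B * norm (x - y)"
    by (rule test_function_lipschitz[OF assms]) (auto intro: that)
  define h where "h k = inverse (real (Suc k))" for k
  have h: "0 < h k" "h k \<le> 1" for k by (auto simp: h_def inverse_le_1_iff)
  let ?e = "axis i (1 :: real)"
  define s where "s k x = (1 / h k) *\<^sub>R (\<phi> (h k *\<^sub>R ?e + x) - \<phi> x)" for k x
  note cont = smooth_continuous[OF K(1)]
  have "(\<lambda>k. LINT x|lebesgue. s k x) \<longlonglongrightarrow> (LINT x|lebesgue. partial_deriv i \<phi> x)"
  proof (rule integral_dominated_convergence)
    show "partial_deriv i \<phi> \<in> borel_measurable lebesgue"
      by (intro continuous_lebesgue_measurable smooth_continuous smooth_partial_deriv K)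
    show "s k \<in> borel_measurable lebesgue" for k
      unfolding s_def by (intro continuous_lebesgue_measurable continuous_intros
          continuous_on_compose2[OF cont]) auto
    \<comment> \<open>The shifts have length at most 1, so all difference quotients vanish outside
      the ball of radius \<open>r + 1\<close>.\<close>
    have "cball 0 (r + 1) \<in> lmeasurable" by (rule lmeasurable_cball)
    then show "integrable lebesgue (\<lambda>x. B * indicator (cball (0 :: real^'a) (r + 1)) x)"
      by (intro integrable_mult_right integrable_real_indicator) (auto simp only: fmeasurable_def mem_Collect_eq infinity_ennreal_def)
    have "(\<lambda>k. s k x) \<longlonglongrightarrow> partial_deriv i \<phi> x" for x
    proof -
      have "((\<lambda>t. x + t *\<^sub>R ?e) has_derivative (\<lambda>t. t *\<^sub>R ?e)) (at 0)"
        by (auto intro!: derivative_eq_intros)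
      from diff_chain_at[OF this smooth_has_derivative[OF K(1)]]
      have "((\<lambda>t. \<phi> (x + t *\<^sub>R ?e)) has_derivative (\<lambda>t. frechet_derivative \<phi> (at x) (t *\<^sub>R ?e))) (at 0)"
        by (simp add: o_def)
      moreover have "frechet_derivative \<phi> (at x) (t *\<^sub>R ?e) = t *\<^sub>R partial_deriv i \<phi> x" for t
        using has_derivative_linear[OF smooth_has_derivative[OF K(1)], of x]
        by (simp add: partial_deriv_def linear_scale)
      ultimately have "((\<lambda>t. \<phi> (x + t *\<^sub>R ?e)) has_vector_derivative partial_deriv i \<phi> x) (at 0 within {0..1})"
        by (auto simp: has_vector_derivative_def intro: has_derivative_at_withinI)
      then have lim: "((\<lambda>h. (1 / h) *\<^sub>R (\<phi> (x + (0 + h) *\<^sub>R ?e) - \<phi> (x + 0 *\<^sub>R ?e)))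
          \<longlongrightarrow> partial_deriv i \<phi> x) (at_right 0)"
        by (rule vector_derivative_at_right) auto
      have "filterlim h (at_right 0) sequentially"
        unfolding h_def
        by (rule tendsto_imp_filterlim_at_right[OF LIMSEQ_inverse_real_of_nat]) auto
      from filterlim_compose[OF lim this] show ?thesis by (simp add: s_def add.commute)
    qed
    then show "AE x in lebesgue. (\<lambda>k. s k x) \<longlonglongrightarrow> partial_deriv i \<phi> x" by simp
    have "norm (s k x) \<le> B * indicator (cball 0 (r + 1)) x" for k x
    proof (cases "x \<in> cball 0 (r + 1)")
      case True
      have "norm (s k x) = (1 / h k) * norm (\<phi> (h k *\<^sub>R ?e + x) - \<phi> x)"
        using h[of k] by (simp add: s_def)
      also have "\<dots> \<le> (1 / h k) * (B * norm (h k *\<^sub>R ?e + x - x))"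
        using h[of k] by (intro mult_left_mono B) auto
      also have "\<dots> = B" using h(1)[of k] by (simp add: norm_axis_1)
      finally show ?thesis using True by simp
    next
      case False
      have "norm (h k *\<^sub>R ?e) \<le> 1" using h[of k] by (simp add: norm_axis_1)
      then have "r < norm (h k *\<^sub>R ?e + x)"
        using False norm_triangle_ineq4[of "h k *\<^sub>R ?e + x" "h k *\<^sub>R ?e"] by simp
      then have "h k *\<^sub>R ?e + x \<notin> K" "x \<notin> K" using r False by auto
      then show ?thesis using False by (simp add: s_def K)
    qed
    then show "AE x in lebesgue. norm (s k x) \<le> B * indicator (cball 0 (r + 1)) x" for k by simp
  qed
  moreover have "(LINT x|lebesgue. s k x) = 0" for k
    unfolding s_def
    by (simp add: Bochner_Integration.integral_diff[OF integral_translation(2)[OF cont integrable_test[OF assms]]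
          integrable_test[OF assms]] integral_translation(1)[OF cont])
  ultimately have "(\<lambda>k :: nat. 0) \<longlonglongrightarrow> (LINT x|lebesgue. partial_deriv i \<phi> x)" by simp
  then show ?thesis using LIMSEQ_const_iff by metis
qed

lemma set_integral_test:
  assumes "\<psi> \<in> test_functions \<Omega>"
  shows "(LINT x:\<Omega>|lebesgue. rep_L2 f x * \<psi> x) = cinner f (abs_L2 (\<lambda>x. cnj (\<psi> x)))"
proof -
  have "\<psi> x = 0" if "x \<notin> \<Omega>" for x
    using assms that by (auto elim!: test_functionsE)
  then have "indicator \<Omega> x *\<^sub>R (rep_L2 f x * \<psi> x) = rep_L2 f x * cnj (cnj (\<psi> x))" for x
    by (cases "x \<in> \<Omega>") auto
  then show ?thesis
    unfolding set_lebesgue_integral_def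
    by (simp add: cinner_rep_abs[OF sq_integrable_test[OF test_functions_cnj[OF assms]]])
qed

text \<open>The definition pairs bilinearly and \<open>cinner\<close> sesquilinearly. Conjugation is
  a bijection of the test functions that commutes with partial derivatives, so the two families of
  conditions agree.\<close>

lemma is_weak_deriv_iff:
  "is_weak_deriv \<Omega> i f g \<longleftrightarrow>
    (\<forall>\<phi>\<in>test_functions \<Omega>. cinner f (abs_L2 (partial_deriv i \<phi>)) = - cinner g (abs_L2 \<phi>))"
proof -
  have pc: "partial_deriv i (\<lambda>x. cnj (\<phi> x)) = (\<lambda>x. cnj (partial_deriv i \<phi> x))"
    if "\<phi> \<in> test_functions \<Omega>" for \<phi>
    using that by (intro ext partial_deriv_cnj) (auto elim!: test_functionsE intro: smooth_differentiable)
  have "is_weak_deriv \<Omega> i f g \<longleftrightarrow>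
    (\<forall>\<phi>\<in>test_functions \<Omega>. cinner f (abs_L2 (partial_deriv i (\<lambda>x. cnj (\<phi> x)))) = - cinner g (abs_L2 (\<lambda>x. cnj (\<phi> x))))"
    unfolding is_weak_deriv_def
    by (intro ball_cong refl)
      (simp add: set_integral_test test_functions_partial_deriv pc)
  also have "\<dots> \<longleftrightarrow> (\<forall>\<phi>\<in>test_functions \<Omega>. cinner f (abs_L2 (partial_deriv i \<phi>)) = - cinner g (abs_L2 \<phi>))"
    using test_functions_cnj[of _ \<Omega>] by (metis (no_types, lifting) complex_cnj_cnj ext)
  finally show ?thesis .
qed

text \<open>The product of \<phi> with the conjugate of \<psi> is again a test function, and the
  integral of its partial derivative vanishes.\<close>

lemma integration_by_parts:
  assumes "\<phi> \<in> test_functions A" "\<psi> \<in> test_functions \<Omega>"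
  shows "cinner (abs_L2 \<phi>) (abs_L2 (partial_deriv i \<psi>)) = - cinner (abs_L2 (partial_deriv i \<phi>)) (abs_L2 \<psi>)"
proof -
  have sm: "smooth \<phi>" "smooth \<psi>" using assms by (auto elim: test_functionsE)
  have prod: "(\<lambda>x. \<phi> x * cnj (\<psi> x)) \<in> test_functions \<Omega>"
    by (intro test_functions_mult test_functions_cnj assms sm)
  have "partial_deriv i (\<lambda>x. \<phi> x * cnj (\<psi> x)) x
      = \<phi> x * cnj (partial_deriv i \<psi> x) + partial_deriv i \<phi> x * cnj (\<psi> x)" for x
    using smooth_differentiable[OF sm(1)] smooth_differentiable[OF sm(2)]
      smooth_differentiable[OF smooth_cnj[OF sm(2)]]
    by (simp add: partial_deriv_mult partial_deriv_cnj)
  then have "0 = (LINT x|lebesgue. \<phi> x * cnj (partial_deriv i \<psi> x) + partial_deriv i \<phi> x * cnj (\<psi> x))"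
    using integral_partial_deriv[OF prod, of i] by simp
  also have "\<dots> = cinner (abs_L2 \<phi>) (abs_L2 (partial_deriv i \<psi>)) + cinner (abs_L2 (partial_deriv i \<phi>)) (abs_L2 \<psi>)"
    using sq_integrable_test[OF assms(1)] sq_integrable_test[OF assms(2)]
      sq_integrable_test[OF test_functions_partial_deriv[OF assms(1)]]
      sq_integrable_test[OF test_functions_partial_deriv[OF assms(2)]]
    by (simp add: cinner_abs_L2 sq_integrable_mult_integrable)
  finally show ?thesis by (simp add: eq_neg_iff_add_eq_0)
qed

section \<open>The fundamental lemma of the calculus of variations\<close>

lemma integral_box_eq_0:
  fixes g :: "(real^'n::finite) L2"
  assumes g: "\<And>\<phi>. \<phi> \<in> test_functions \<Omega> \<Longrightarrow> cinner g (abs_L2 \<phi>) = 0" and ab: "cbox a b \<subseteq> \<Omega>"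
  shows "(LINT x|lebesgue. indicator (box a b) x *\<^sub>R rep_L2 g x) = 0"
proof -
  \<comment> \<open>Smooth approximations of the indicator of the open box: every factor vanishes
    beyond its face and tends to 1 inside as \<open>k\<close> grows. The closed box lies in
    \<Omega>, so it serves as the compact support.\<close>
  define p where "p k x = (\<Prod>i\<in>UNIV. bump (real k * (x $ i - a $ i)) * bump (real k * (b $ i - x $ i)))" for k x
  have p01: "0 \<le> p k x" "p k x \<le> 1" for k x
    unfolding p_def by (auto intro!: prod_nonneg prod_le_1 mult_nonneg_nonneg mult_le_one bump_ge_0 bump_le_1)
  have p0: "p k x = 0" if x: "x \<notin> box a b" for k x
  proof -
    obtain i where "\<not> (a $ i < x $ i \<and> x $ i < b $ i)" using x unfolding mem_box_cart by blast
    then have "real k * (x $ i - a $ i) \<le> 0 \<or> real k * (b $ i - x $ i) \<le> 0"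
      by (auto simp: mult_le_0_iff)
    then have "bump (real k * (x $ i - a $ i)) * bump (real k * (b $ i - x $ i)) = 0"
      using bump_eq_0 by auto
    then show ?thesis unfolding p_def by (auto simp: prod_zero_iff)
  qed
  have ridge: "smooth (\<lambda>x. of_real (bump (real k * (x $ i - a $ i))))"
    "smooth (\<lambda>x. of_real (bump (real k * (b $ i - x $ i))))" for k i
    using smooth_ridge[OF smooth1_bump, of "real k *\<^sub>R axis i 1" "- real k * a $ i"]
      smooth_ridge[OF smooth1_bump, of "(- real k) *\<^sub>R axis i 1" "real k * b $ i"]
    by (simp_all add: inner_axis' algebra_simps)
  have sm: "smooth (\<lambda>x. complex_of_real (p k x))" for k
    unfolding p_def of_real_prod of_real_mult by (intro smooth_prod smooth_mult ridge)
  have test: "(\<lambda>x. complex_of_real (p k x)) \<in> test_functions \<Omega>" for k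
    by (rule test_functionsI[OF sm compact_cbox ab], unfold of_real_eq_0_iff) (use p0 box_subset_cbox[of a b] in blast)
  have ind: "sq_integrable (\<lambda>x. 1 * indicator (box a b) x)"
    by (rule sq_integrable_const_indicator) (rule lmeasurable_box)
  have "(\<lambda>k. abs_L2 (\<lambda>x. complex_of_real (p k x))) \<longlonglongrightarrow> abs_L2 (\<lambda>x. 1 * indicator (box a b) x)"
  proof (rule abs_L2_dominated_convergence[OF ind])
    show "(\<lambda>x. complex_of_real (p k x)) \<in> borel_measurable lebesgue" for k
      using sq_integrable_test[OF test] by (rule sq_integrableD)
    show "(\<lambda>x. 1 * indicator (box a b) x :: complex) \<in> borel_measurable lebesgue"
      using ind by (rule sq_integrableD)
    show "cmod (complex_of_real (p k x)) \<le> cmod (1 * indicator (box a b) x)" for k x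
      using p01[of k x] p0[of x k] by (cases "x \<in> box a b") auto
    show "(\<lambda>k. complex_of_real (p k x)) \<longlonglongrightarrow> 1 * indicator (box a b) x" for x
    proof (cases "x \<in> box a b")
      case True
      have lim: "(\<lambda>k. bump (real k * c)) \<longlonglongrightarrow> 1" if "c > 0" for c
        by (rule filterlim_compose[OF bump_tendsto])
          (use that in \<open>intro filterlim_tendsto_pos_mult_at_top[OF tendsto_const _ filterlim_real_sequentially]
            | simp add: mult.commute[of _ c]\<close>)+
      have "(\<lambda>k. p k x) \<longlonglongrightarrow> (\<Prod>i\<in>(UNIV :: 'n set). 1 * 1)"
        unfolding p_def by (intro tendsto_prod tendsto_mult lim) (use True in \<open>auto simp: mem_box_cart\<close>)
      then show ?thesis using True tendsto_of_real[of _ 1] by simp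
    qed (simp add: p0)
  qed
  from tendsto_cinner[OF tendsto_const this, of g]
  have "(\<lambda>k :: nat. 0) \<longlonglongrightarrow> cinner g (abs_L2 (\<lambda>x. 1 * indicator (box a b) x))"
    by (simp add: g[OF test])
  then have "cinner g (abs_L2 (\<lambda>x. 1 * indicator (box a b) x)) = 0"
    using LIMSEQ_const_iff by metis
  moreover have "(\<lambda>x. rep_L2 g x * cnj (1 * indicator (box a b) x)) = (\<lambda>x. indicator (box a b) x *\<^sub>R rep_L2 g x)"
    by (auto simp: indicator_def)
  ultimately show ?thesis
    unfolding cinner_rep_abs[OF ind] by simp
qed

lemma sigma_finite_lebesgue: "sigma_finite_measure (lebesgue :: 'a::euclidean_space measure)"
proof
  have "(\<Union>n. cball (0 :: 'a) (real n)) = UNIV"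
    using real_arch_simple by (auto simp: set_eq_iff)
  moreover have "emeasure lebesgue (cball (0 :: 'a) (real n)) \<noteq> \<infinity>" for n
    using fmeasurableD2[OF lmeasurable_cball] by auto
  ultimately show "\<exists>A. countable A \<and> A \<subseteq> sets (lebesgue :: 'a measure) \<and> \<Union>A = space lebesgue \<and>
      (\<forall>a\<in>A. emeasure lebesgue a \<noteq> \<infinity>)"
    by (intro exI[of _ "range (\<lambda>n. cball 0 (real n))"]) auto
qed

text \<open>Open boxes form an intersection-stable generator of the Borel sets, so the vanishing of
  integrals spreads to all Borel sets by Dynkin's argument; \<open>total\<close> is what the
  complement step uses. Lebesgue sets differ from Borel sets by null sets.\<close>

lemma AE_box_eq_0:
  fixes h :: "'a::euclidean_space \<Rightarrow> complex"
  assumes h: "integrable lebesgue h" and box: "\<And>c d. (LINT x|lebesgue. indicator (box c d) x *\<^sub>R h x) = 0"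
    and total: "(LINT x|lebesgue. h x) = 0"
  shows "AE x in lebesgue. h x = 0"
proof (rule sigma_finite_measure.density_zero[OF sigma_finite_lebesgue h])
  let ?G = "range (\<lambda>(c, d). box c d :: 'a set)"
  have borel: "(LINT x|lebesgue. indicator A x *\<^sub>R h x) = 0" if "A \<in> sets borel" for A
  proof -
    have "Int_stable ?G" by (auto simp: Int_stable_def box_Int_box)
    moreover have "?G \<subseteq> Pow UNIV" by simp
    moreover have "A \<in> sigma_sets UNIV ?G"
      using that by (simp add: borel_eq_box)
    ultimately show ?thesis
    proof (induction A rule: sigma_sets_induct_disjoint)
      case (basic A)
      then show ?case using box by auto
    next
      case empty
      show ?case by simp
    next
      case (compl A)
      then have A: "A \<in> sets lebesgue" by (simp add: borel_eq_box)
      have "(LINT x|lebesgue. indicator (UNIV - A) x *\<^sub>R h x) = (LINT x|lebesgue. h x - indicator A x *\<^sub>R h x)"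
        by (rule Bochner_Integration.integral_cong) (auto simp: indicator_def)
      also have "\<dots> = 0"
        using h A by (subst Bochner_Integration.integral_diff) (auto simp: compl total integrable_mult_indicator)
      finally show ?case .
    next
      case (union A)
      have A: "A i \<in> sets lebesgue" for i
        using union(2) by (intro sets_completionI_sets) (auto simp: borel_eq_box subset_iff)
      have "(LINT x:(\<Union>i. A i)|lebesgue. h x) = (\<Sum>i. (LINT x:(A i)|lebesgue. h x))"
        using union(1) A h
        by (intro lebesgue_integral_countable_add)
          (auto simp: disjoint_family_on_def set_integrable_def intro!: integrable_mult_indicator)
      then show ?case using union by (simp add: set_lebesgue_integral_def)
    qed
  qed
  fix A :: "'a set" assume "A \<in> sets lebesgue"
  then obtain S N N' where A: "A = S \<union> N" "N \<subseteq> N'" "N' \<in> null_sets lborel" "S \<in> sets lborel"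
    by (rule sets_completionE)
  have N': "AE x in lebesgue. x \<notin> N'"
    using A(3) by (intro AE_not_in) (rule null_sets_completionI)
  have "(LINT x|lebesgue. indicator A x *\<^sub>R h x) = (LINT x|lebesgue. indicator S x *\<^sub>R h x)"
  proof (rule integral_cong_AE)
    have "S \<in> sets lebesgue" using A(4) by auto
    then show "(\<lambda>x. indicator A x *\<^sub>R h x) \<in> borel_measurable lebesgue"
      "(\<lambda>x. indicator S x *\<^sub>R h x) \<in> borel_measurable lebesgue"
      using \<open>A \<in> sets lebesgue\<close> h by (auto intro!: borel_measurable_integrable integrable_mult_indicator)
    show "AE x in lebesgue. indicator A x *\<^sub>R h x = indicator S x *\<^sub>R h x"
      using N' by eventually_elim (use A(1,2) in \<open>auto simp: indicator_def\<close>)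
  qed
  then show "(LINT x:A|lebesgue. h x) = 0"
    using borel[of S] A(4) by (simp add: set_lebesgue_integral_def)
qed

text \<open>An open set is a countable union of closed boxes, so it is enough that \<open>g\<close>
  vanishes almost everywhere on each of them.\<close>

lemma test_functions_separating:
  fixes g :: "(real^'n::finite) L2"
  assumes \<Omega>: "open \<Omega>" and g: "g \<in> L2_on \<Omega>" "\<And>\<phi>. \<phi> \<in> test_functions \<Omega> \<Longrightarrow> cinner g (abs_L2 \<phi>) = 0"
  shows "g = 0"
proof -
  have box: "AE x in lebesgue. x \<in> cbox a b \<longrightarrow> rep_L2 g x = 0" if ab: "cbox a b \<subseteq> \<Omega>" for a b
  proof -
    have ind: "sq_integrable (\<lambda>x. 1 * indicator (box a b) x)"
      by (rule sq_integrable_const_indicator) (rule lmeasurable_box)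
    have "AE x in lebesgue. indicator (box a b) x *\<^sub>R rep_L2 g x = 0"
    proof (rule AE_box_eq_0)
      have "(\<lambda>x. rep_L2 g x * cnj (1 * indicator (box a b) x)) = (\<lambda>x. indicator (box a b) x *\<^sub>R rep_L2 g x)"
        by (auto simp: indicator_def)
      then show "integrable lebesgue (\<lambda>x. indicator (box a b) x *\<^sub>R rep_L2 g x)"
        using sq_integrable_mult_integrable[OF sq_integrable_rep[of g] ind] by simp
      show "(LINT x|lebesgue. indicator (box a b) x *\<^sub>R rep_L2 g x) = 0"
        by (rule integral_box_eq_0[OF g(2) ab])
      fix c d :: "real^'n"
      \<comment> \<open>The intersection is again a box whose closed version lies in \<Omega>, so
        the vanishing on single boxes applies to it.\<close>
      obtain p q where pq: "box c d \<inter> box a b = box p q" "cbox c d \<inter> cbox a b = cbox p q"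
        using box_Int_box[of c d a b] Int_interval[of c d a b] by blast
      have "(LINT x|lebesgue. indicator (box p q) x *\<^sub>R rep_L2 g x) = 0"
        by (rule integral_box_eq_0[OF g(2)]) (use pq ab in auto)
      then show "(LINT x|lebesgue. indicator (box c d) x *\<^sub>R (indicator (box a b) x *\<^sub>R rep_L2 g x)) = 0"
        by (simp add: pq(1)[symmetric] indicator_inter_arith)
    qed
    moreover have "AE x in lebesgue. x \<notin> cbox a b - box a b"
      using negligible_frontier_interval[of a b] by (intro AE_not_in) (simp add: negligible_iff_null_sets)
    ultimately show ?thesis by eventually_elim (auto simp: indicator_def split: if_splits)
  qed
  obtain \<D> where \<D>: "countable \<D>" "\<D> \<subseteq> Pow \<Omega>" "\<And>X. X \<in> \<D> \<Longrightarrow> \<exists>a b. X = cbox a b" "\<Union>\<D> = \<Omega>"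
    by (rule open_countable_Union_open_cbox[OF \<Omega>]) (auto intro: that)
  have "AE x in lebesgue. \<forall>X\<in>\<D>. x \<in> X \<longrightarrow> rep_L2 g x = 0"
    using \<D>(1)
  proof (rule AE_ball_countable[THEN iffD2], intro ballI)
    fix X assume X: "X \<in> \<D>"
    then obtain a b where "X = cbox a b" using \<D>(3) by blast
    then show "AE x in lebesgue. x \<in> X \<longrightarrow> rep_L2 g x = 0"
      using box[of a b] X \<D>(2) by auto
  qed
  moreover have "AE x in lebesgue. x \<notin> \<Omega> \<longrightarrow> rep_L2 g x = 0" using g(1) by (simp add: L2_on_def)
  moreover have "AE x in lebesgue. rep_L2 (0 :: (real^'n) L2) x = 0" by (rule rep_L2_zero)
  ultimately have "AE x in lebesgue. rep_L2 g x = rep_L2 0 x"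
    by eventually_elim (use \<D>(4) in auto)
  then show ?thesis by (rule L2_eqI)
qed

text \<open>A relational substitute for \<open>weak_deriv\<close>: the gradient is an explicit
  witness, so linearity, limits and reflections can be treated without the definite description,
  which is resolved once in \<open>weak_deriv_eq\<close>.\<close>

definition weak_grad :: "(real^'n::finite) set \<Rightarrow> (real^'n) L2 \<Rightarrow> ('n \<Rightarrow> (real^'n) L2) \<Rightarrow> bool" where
  "weak_grad \<Omega> f F \<longleftrightarrow> f \<in> L2_on \<Omega> \<and> (\<forall>i. F i \<in> L2_on \<Omega> \<and>
    (\<forall>\<phi>\<in>test_functions \<Omega>. cinner f (abs_L2 (partial_deriv i \<phi>)) = - cinner (F i) (abs_L2 \<phi>)))"

lemma H1_iff: "f \<in> H1 \<Omega> \<longleftrightarrow> (\<exists>F. weak_grad \<Omega> f F)"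
  unfolding H1_def weak_grad_def is_weak_deriv_iff by (simp add: choice_iff Bex_def)

context
  fixes \<Omega> :: "(real^'n::finite) set"
  assumes \<Omega>: "open \<Omega>"
begin

lemma open_sets_lebesgue: "\<Omega> \<in> sets lebesgue"
  using \<Omega> by auto

lemma weak_deriv_eq:
  assumes "weak_grad \<Omega> f F" shows "weak_deriv \<Omega> i f = F i"
  unfolding weak_deriv_def
proof (rule the_equality)
  show "F i \<in> L2_on \<Omega> \<and> is_weak_deriv \<Omega> i f (F i)"
    using assms by (auto simp: weak_grad_def is_weak_deriv_iff)
  fix g assume g: "g \<in> L2_on \<Omega> \<and> is_weak_deriv \<Omega> i f g"
  have "g - F i = 0"
  proof (rule test_functions_separating[OF \<Omega>])
    show "g - F i \<in> L2_on \<Omega>"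
      using g assms L2_on_lin(2)[OF open_sets_lebesgue] by (auto simp: weak_grad_def)
    show "cinner (g - F i) (abs_L2 \<phi>) = 0" if "\<phi> \<in> test_functions \<Omega>" for \<phi>
      using g assms that by (simp add: cinner_diff_left weak_grad_def is_weak_deriv_iff)
  qed
  then show "g = F i" by simp
qed

lemma weak_grad_lin:
  assumes "weak_grad \<Omega> f F" "weak_grad \<Omega> g K"
  shows "weak_grad \<Omega> (f + g) (\<lambda>i. F i + K i)" "weak_grad \<Omega> (f - g) (\<lambda>i. F i - K i)"
  using assms L2_on_lin[OF open_sets_lebesgue]
  by (auto simp: weak_grad_def cinner_add_left cinner_diff_left)

lemma weak_grad_cscale:
  "weak_grad \<Omega> f F \<Longrightarrow> weak_grad \<Omega> (cscale c f) (\<lambda>i. cscale c (F i))"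
  using L2_on_scale(1)[OF open_sets_lebesgue] by (auto simp: weak_grad_def cinner_cscale_left)

lemma weak_grad_test:
  assumes "\<phi> \<in> test_functions \<Omega>"
  shows "weak_grad \<Omega> (abs_L2 \<phi>) (\<lambda>i. abs_L2 (partial_deriv i \<phi>))"
proof -
  have "abs_L2 \<psi> \<in> L2_on \<Omega>" if "\<psi> \<in> test_functions \<Omega>" for \<psi>
    unfolding L2_on_def using rep_abs_L2[OF sq_integrable_test[OF that]] that
    by (auto elim!: eventually_mono test_functionsE)
  then show ?thesis
    unfolding weak_grad_def
    using assms test_functions_partial_deriv[OF assms] integration_by_parts[OF assms] by auto
qed

text \<open>The weak gradient is a closed operator, because the defining identity is continuous in
  \<open>f\<close> and in the gradient for each fixed test function.\<close>

lemma weak_grad_limit: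
  assumes "\<And>k :: nat. weak_grad \<Omega> (f k) (F k)" "f \<longlonglongrightarrow> g" "\<And>i. (\<lambda>k. F k i) \<longlonglongrightarrow> K i"
  shows "weak_grad \<Omega> g K"
  unfolding weak_grad_def
proof (intro conjI allI ballI)
  show "g \<in> L2_on \<Omega>" "K i \<in> L2_on \<Omega>" for i
    using assms(1) closed_sequentially[OF closed_L2_on[OF open_sets_lebesgue] _ assms(2)]
      closed_sequentially[OF closed_L2_on[OF open_sets_lebesgue] _ assms(3)]
    by (auto simp: weak_grad_def)
  fix i \<phi> assume \<phi>: "\<phi> \<in> test_functions \<Omega>"
  have "(\<lambda>k. cinner (f k) (abs_L2 (partial_deriv i \<phi>))) \<longlonglongrightarrow> cinner g (abs_L2 (partial_deriv i \<phi>))"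
    by (intro tendsto_cinner assms tendsto_const)
  moreover have "(\<lambda>k. - cinner (F k i) (abs_L2 \<phi>)) \<longlonglongrightarrow> - cinner (K i) (abs_L2 \<phi>)"
    by (intro tendsto_minus tendsto_cinner assms tendsto_const)
  moreover have "cinner (f k) (abs_L2 (partial_deriv i \<phi>)) = - cinner (F k i) (abs_L2 \<phi>)" for k
    using assms(1) \<phi> by (auto simp: weak_grad_def)
  ultimately show "cinner g (abs_L2 (partial_deriv i \<phi>)) = - cinner (K i) (abs_L2 \<phi>)"
    using LIMSEQ_unique by auto
qed

lemma H1_norm_eq:
  "weak_grad \<Omega> f F \<Longrightarrow> H1_norm \<Omega> f = sqrt ((norm f)\<^sup>2 + (\<Sum>i\<in>UNIV. (norm (F i))\<^sup>2))"
  by (simp add: H1_norm_def weak_deriv_eq)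

text \<open>The \<open>H1_norm\<close> of a difference dominates each of its components, so
  approximation in this norm is the same as convergence of the functions and of all partial
  derivatives separately.\<close>

lemma H10_iff:
  "f \<in> H10 \<Omega> \<longleftrightarrow> (\<exists>F \<phi>. weak_grad \<Omega> f F \<and> (\<forall>k :: nat. \<phi> k \<in> test_functions \<Omega>) \<and>
    (\<lambda>k. abs_L2 (\<phi> k)) \<longlonglongrightarrow> f \<and> (\<forall>i. (\<lambda>k. abs_L2 (partial_deriv i (\<phi> k))) \<longlonglongrightarrow> F i))"
    (is "_ \<longleftrightarrow> ?R")
proof
  assume f: "f \<in> H10 \<Omega>"
  then obtain F where F: "weak_grad \<Omega> f F" by (auto simp: H10_def H1_iff)
  have "\<exists>\<phi>\<in>test_functions \<Omega>. H1_norm \<Omega> (f - abs_L2 \<phi>) < inverse (real (Suc k))" for k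
    using f by (auto simp: H10_def)
  then obtain \<phi> where \<phi>: "\<And>k. \<phi> k \<in> test_functions \<Omega>"
    "\<And>k. H1_norm \<Omega> (f - abs_L2 (\<phi> k)) < inverse (real (Suc k))" by metis
  note N = H1_norm_eq[OF weak_grad_lin(2)[OF F weak_grad_test[OF \<phi>(1)]]]
  have "norm (f - abs_L2 (\<phi> k)) \<le> H1_norm \<Omega> (f - abs_L2 (\<phi> k))" for k
    unfolding N by (rule real_le_rsqrt) (auto intro!: sum_nonneg)
  then have "norm (abs_L2 (\<phi> k) - f) \<le> inverse (real (Suc k))" for k
    using \<phi>(2)[of k] by (simp add: norm_minus_commute) (meson less_eq_real_def order_trans)
  then have 1: "(\<lambda>k. abs_L2 (\<phi> k)) \<longlonglongrightarrow> f"
    by (intro LIM_zero_cancel[OF Lim_null_comparison[OF _ LIMSEQ_inverse_real_of_nat]]) auto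
  have "norm (F i - abs_L2 (partial_deriv i (\<phi> k))) \<le> H1_norm \<Omega> (f - abs_L2 (\<phi> k))" for k i
    unfolding N
    using member_le_sum[of i UNIV "\<lambda>i. (norm (F i - abs_L2 (partial_deriv i (\<phi> k))))\<^sup>2"]
    by (intro real_le_rsqrt) (simp add: add_increasing)
  then have "norm (abs_L2 (partial_deriv i (\<phi> k)) - F i) \<le> inverse (real (Suc k))" for k i
    using \<phi>(2)[of k] by (simp add: norm_minus_commute) (meson less_eq_real_def order_trans)
  then have 2: "(\<lambda>k. abs_L2 (partial_deriv i (\<phi> k))) \<longlonglongrightarrow> F i" for i
    by (intro LIM_zero_cancel[OF Lim_null_comparison[OF _ LIMSEQ_inverse_real_of_nat]]) auto
  show ?R using F \<phi>(1) 1 2 by blast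
next
  assume ?R
  then obtain F \<phi> where F: "weak_grad \<Omega> f F" and \<phi>: "\<And>k :: nat. \<phi> k \<in> test_functions \<Omega>"
    and lim: "(\<lambda>k. abs_L2 (\<phi> k)) \<longlonglongrightarrow> f" "\<And>i. (\<lambda>k. abs_L2 (partial_deriv i (\<phi> k))) \<longlonglongrightarrow> F i"
    by blast
  have "(\<lambda>k. H1_norm \<Omega> (f - abs_L2 (\<phi> k))) \<longlonglongrightarrow>
      sqrt ((norm (f - f))\<^sup>2 + (\<Sum>i\<in>UNIV. (norm (F i - F i))\<^sup>2))"
    unfolding H1_norm_eq[OF weak_grad_lin(2)[OF F weak_grad_test[OF \<phi>]]]
    by (intro tendsto_intros lim)
  then have lim0: "(\<lambda>k. H1_norm \<Omega> (f - abs_L2 (\<phi> k))) \<longlonglongrightarrow> 0" by simp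
  have "\<exists>\<phi>\<in>test_functions \<Omega>. H1_norm \<Omega> (f - abs_L2 \<phi>) < e" if "e > 0" for e
    using order_tendstoD(2)[OF lim0 that] \<phi> by (auto simp: eventually_sequentially)
  then show "f \<in> H10 \<Omega>" using F by (auto simp: H10_def H1_iff)
qed

end

section \<open>Reflection in a hyperplane\<close>

lemma abs_L2_sum:
  assumes "\<And>j. j \<in> J \<Longrightarrow> sq_integrable (f j)"
  shows "sq_integrable (\<lambda>x. \<Sum>j\<in>J. of_real (c j) * f j x) \<and>
    abs_L2 (\<lambda>x. \<Sum>j\<in>J. of_real (c j) * f j x) = (\<Sum>j\<in>J. c j *\<^sub>R abs_L2 (f j))"
  using assms
proof (induction J rule: infinite_finite_induct)
  case (insert j J)
  then show ?case
    by (simp add: sq_integrable_add sq_integrable_cmult scaleR_eq_cscale cscale_abs_L2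
        flip: abs_L2_add)
qed (auto simp: sq_integrable_zero zero_L2_def)

lemma H10_I:
  assumes \<Omega>: "open \<Omega>" and F: "weak_grad \<Omega> f F"
    and approx: "\<And>e. e > 0 \<Longrightarrow> \<exists>\<phi>\<in>test_functions \<Omega>.
      norm (abs_L2 \<phi> - f) < e \<and> (\<forall>i. norm (abs_L2 (partial_deriv i \<phi>) - F i) < e)"
  shows "f \<in> H10 \<Omega>"
proof -
  have "\<exists>\<phi>\<in>test_functions \<Omega>. norm (abs_L2 \<phi> - f) < inverse (real (Suc k)) \<and>
      (\<forall>i. norm (abs_L2 (partial_deriv i \<phi>) - F i) < inverse (real (Suc k)))" for k
    by (rule approx) simp
  then obtain \<phi> where \<phi>: "\<And>k. \<phi> k \<in> test_functions \<Omega>"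
    "\<And>k. norm (abs_L2 (\<phi> k) - f) < inverse (real (Suc k))"
    "\<And>k i. norm (abs_L2 (partial_deriv i (\<phi> k)) - F i) < inverse (real (Suc k))" by metis
  have "(\<lambda>k. abs_L2 (\<phi> k)) \<longlonglongrightarrow> f" "(\<lambda>k. abs_L2 (partial_deriv i (\<phi> k))) \<longlonglongrightarrow> F i" for i
    using \<phi>(2) \<phi>(3)[of i]
    by (auto intro!: LIM_zero_cancel[OF Lim_null_comparison[OF _ LIMSEQ_inverse_real_of_nat]]
        always_eventually less_imp_le)
  then show ?thesis unfolding H10_iff[OF \<Omega>] using F \<phi>(1) by blast
qed

text \<open>By uniqueness of weak gradients, the test functions approximating \<open>f k\<close>
  have derivatives converging to the given \<open>F k\<close>; an e/2 argument then approximates the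
  limit directly.\<close>

lemma H10_closed:
  assumes \<Omega>: "open \<Omega>" and f: "\<And>k :: nat. f k \<in> H10 \<Omega>" "\<And>k. weak_grad \<Omega> (f k) (F k)"
    and lim: "f \<longlonglongrightarrow> g" "\<And>i. (\<lambda>k. F k i) \<longlonglongrightarrow> K i"
  shows "g \<in> H10 \<Omega>"
proof (rule H10_I[OF \<Omega> weak_grad_limit[OF \<Omega> f(2) lim]])
  fix e :: real assume e: "e > 0"
  have "\<forall>\<^sub>F k in sequentially. dist (f k) g < e / 2 \<and> (\<forall>i. dist (F k i) (K i) < e / 2)"
    using e by (intro eventually_conj eventually_all_finite tendstoD lim) auto
  then obtain k where k: "dist (f k) g < e / 2" "\<And>i. dist (F k i) (K i) < e / 2"
    by (auto simp: eventually_sequentially)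
  obtain F' \<phi> where \<phi>: "weak_grad \<Omega> (f k) F'" "\<And>m :: nat. \<phi> m \<in> test_functions \<Omega>"
    "(\<lambda>m. abs_L2 (\<phi> m)) \<longlonglongrightarrow> f k" "\<And>i. (\<lambda>m. abs_L2 (partial_deriv i (\<phi> m))) \<longlonglongrightarrow> F' i"
    using f(1)[of k] unfolding H10_iff[OF \<Omega>] by blast
  have "F' i = F k i" for i
    using weak_deriv_eq[OF \<Omega> \<phi>(1)] weak_deriv_eq[OF \<Omega> f(2)[of k]] by metis
  then have "\<forall>\<^sub>F m in sequentially. dist (abs_L2 (\<phi> m)) (f k) < e / 2 \<and>
      (\<forall>i. dist (abs_L2 (partial_deriv i (\<phi> m))) (F k i) < e / 2)"
    using e \<phi>(3,4) by (intro eventually_conj eventually_all_finite tendstoD) auto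
  then obtain m where m: "dist (abs_L2 (\<phi> m)) (f k) < e / 2"
    "\<And>i. dist (abs_L2 (partial_deriv i (\<phi> m))) (F k i) < e / 2"
    by (auto simp: eventually_sequentially)
  have "dist (abs_L2 (\<phi> m)) g < e" "dist (abs_L2 (partial_deriv i (\<phi> m))) (K i) < e" for i
    using dist_triangle[of "abs_L2 (\<phi> m)" g "f k"] m(1) k(1)
      dist_triangle[of "abs_L2 (partial_deriv i (\<phi> m))" "K i" "F k i"] m(2)[of i] k(2)[of i]
    by linarith+
  then show "\<exists>\<phi>\<in>test_functions \<Omega>.
      norm (abs_L2 \<phi> - g) < e \<and> (\<forall>i. norm (abs_L2 (partial_deriv i \<phi>) - K i) < e)"
    using \<phi>(2) by (auto simp: dist_norm)
qed

lemma form_domain_weak_grad: "f \<in> form_domain bc \<Omega> \<Longrightarrow> \<exists>F. weak_grad \<Omega> f F"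
  by (cases bc) (auto simp: H10_def H1_iff)

lemma form_domain_lin:
  assumes \<Omega>: "open \<Omega>" and f: "f \<in> form_domain bc \<Omega>" and g: "g \<in> form_domain bc \<Omega>"
  shows "f + c *\<^sub>R g \<in> form_domain bc \<Omega>"
proof -
  obtain F where F: "weak_grad \<Omega> f F" using form_domain_weak_grad[OF f] by blast
  obtain K where K: "weak_grad \<Omega> g K" using form_domain_weak_grad[OF g] by blast
  have W: "weak_grad \<Omega> (f + c *\<^sub>R g) (\<lambda>i. F i + c *\<^sub>R K i)"
    unfolding scaleR_eq_cscale by (intro weak_grad_lin weak_grad_cscale \<Omega> F K)
  show ?thesis
  proof (cases bc)
    case Neumann
    then show ?thesis using W by (auto simp: H1_iff)
  next
    case Dirichlet
    then have "f \<in> H10 \<Omega>" "g \<in> H10 \<Omega>" using f g by auto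
    then obtain F' \<phi> K' \<psi> where
      \<phi>: "weak_grad \<Omega> f F'" "\<And>k :: nat. \<phi> k \<in> test_functions \<Omega>"
        "(\<lambda>k. abs_L2 (\<phi> k)) \<longlonglongrightarrow> f" "\<And>i. (\<lambda>k. abs_L2 (partial_deriv i (\<phi> k))) \<longlonglongrightarrow> F' i" and
      \<psi>: "weak_grad \<Omega> g K'" "\<And>k :: nat. \<psi> k \<in> test_functions \<Omega>"
        "(\<lambda>k. abs_L2 (\<psi> k)) \<longlonglongrightarrow> g" "\<And>i. (\<lambda>k. abs_L2 (partial_deriv i (\<psi> k))) \<longlonglongrightarrow> K' i"
      unfolding H10_iff[OF \<Omega>] by blast
    define \<theta> where "\<theta> k x = \<phi> k x + of_real c * \<psi> k x" for k x
    have \<theta>: "\<theta> k \<in> test_functions \<Omega>" for k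
      unfolding \<theta>_def by (intro test_functions_add test_functions_cmult \<phi> \<psi>)
    have pd: "partial_deriv i (\<theta> k) = (\<lambda>x. partial_deriv i (\<phi> k) x + of_real c * partial_deriv i (\<psi> k) x)" for i k
    proof
      fix x
      have d: "\<phi> k differentiable (at x)" "\<psi> k differentiable (at x)"
        "(\<lambda>x. of_real c * \<psi> k x) differentiable (at x)"
        using \<phi>(2)[of k] \<psi>(2)[of k] test_functions_cmult[OF \<psi>(2)[of k], of "of_real c"]
        by (auto elim!: test_functionsE intro: smooth_differentiable)
      then show "partial_deriv i (\<theta> k) x = partial_deriv i (\<phi> k) x + of_real c * partial_deriv i (\<psi> k) x"
        unfolding \<theta>_def by (simp add: partial_deriv_add partial_deriv_cmult)
    qed
    note sq = sq_integrable_test[OF \<phi>(2)] sq_integrable_test[OF \<psi>(2)]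
      sq_integrable_test[OF test_functions_partial_deriv[OF \<phi>(2)]]
      sq_integrable_test[OF test_functions_partial_deriv[OF \<psi>(2)]]
    have eq: "abs_L2 (\<theta> k) = abs_L2 (\<phi> k) + c *\<^sub>R abs_L2 (\<psi> k)"
      "abs_L2 (partial_deriv i (\<theta> k)) = abs_L2 (partial_deriv i (\<phi> k)) + c *\<^sub>R abs_L2 (partial_deriv i (\<psi> k))" for i k
      unfolding pd \<theta>_def
      by (simp_all add: scaleR_eq_cscale cscale_abs_L2 abs_L2_add sq sq_integrable_cmult)
    have "f + c *\<^sub>R g \<in> H10 \<Omega>"
      unfolding H10_iff[OF \<Omega>]
    proof (intro exI[of _ "\<lambda>i. F' i + c *\<^sub>R K' i"] exI[of _ \<theta>] conjI allI)
      show "weak_grad \<Omega> (f + c *\<^sub>R g) (\<lambda>i. F' i + c *\<^sub>R K' i)"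
        unfolding scaleR_eq_cscale by (intro weak_grad_lin weak_grad_cscale \<Omega> \<phi> \<psi>)
    qed (auto simp: eq intro!: \<theta> tendsto_intros \<phi> \<psi>)
    then show ?thesis using Dirichlet by simp
  qed
qed

lemma form_domain_0: "open \<Omega> \<Longrightarrow> f \<in> form_domain bc \<Omega> \<Longrightarrow> 0 \<in> form_domain bc \<Omega>"
  using form_domain_lin[of \<Omega> f bc f "-1"] by simp

lemma form_domain_scaleR: "open \<Omega> \<Longrightarrow> f \<in> form_domain bc \<Omega> \<Longrightarrow> c *\<^sub>R f \<in> form_domain bc \<Omega>"
  using form_domain_lin[OF _ form_domain_0, of \<Omega> f bc f c] by simp

lemma weak_grad_scaleR:
  "open \<Omega> \<Longrightarrow> weak_grad \<Omega> f F \<Longrightarrow> weak_grad \<Omega> (c *\<^sub>R f) (\<lambda>i. c *\<^sub>R F i)"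
  unfolding scaleR_eq_cscale by (rule weak_grad_cscale)

text \<open>\<open>a\<close> is the unit normal of a hyperplane through the origin. The reflection
  is an involution, so the implication \<open>sym\<close> yields the equivalence
  \<open>R_in\<close>. The sort \<open>wellorder\<close> is the one under which the library states
  the measure of orthogonal images.\<close>

locale reflection =
  fixes a :: "real^'n::{finite,wellorder}" and \<Omega>' :: "(real^'n::{finite,wellorder}) set"
  assumes norm_a: "norm a = 1" and open': "open \<Omega>'"
    and sym: "\<And>x. x \<in> \<Omega>' \<Longrightarrow> x - (2 * inner a x) *\<^sub>R a \<in> \<Omega>'"
begin

definition R :: "(real, 'n) vec \<Rightarrow> (real, 'n) vec" where "R x = x - (2 * inner a x) *\<^sub>R a"

definition \<Omega> :: "((real, 'n) vec) set" where "\<Omega> = \<Omega>' \<inter> {x. 0 < inner a x}"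

text \<open>The entries of the Householder matrix I - 2 a a^T, which represents \<open>R\<close> and
  is symmetric.\<close>

definition rc :: "'n \<Rightarrow> 'n \<Rightarrow> real" where "rc i j = (if i = j then 1 else 0) - 2 * a $ i * a $ j"

lemma inner_a_a: "inner a a = 1"
  using norm_a by (simp add: norm_eq_sqrt_inner)

lemma R_R [simp]: "R (R x) = x"
  by (simp add: R_def inner_diff_right inner_a_a algebra_simps)

lemma inner_a_R [simp]: "inner a (R x) = - inner a x"
  by (simp add: R_def inner_diff_right inner_a_a)

lemma linear_R: "linear R"
  by (rule linearI) (auto simp: R_def inner_add_right algebra_simps)

lemma norm_R [simp]: "norm (R x) = norm x"
proof -
  have "inner (R x) (R x) = inner x x"
    by (simp add: R_def inner_diff_left inner_diff_right inner_a_a inner_commute[of x a] algebra_simps)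
  then show ?thesis by (simp add: norm_eq_sqrt_inner)
qed

lemma dist_R: "dist (R x) (R y) = dist x y"
  using norm_R[of "x - y"] by (simp add: dist_norm linear_diff[OF linear_R])

lemma R_in [simp]: "R x \<in> \<Omega>' \<longleftrightarrow> x \<in> \<Omega>'"
  using sym[of x, folded R_def] sym[of "R x", folded R_def] by auto

lemma R_axis: "R (axis i 1) $ j = rc i j"
  by (simp add: R_def rc_def inner_axis) (simp add: axis_def)

lemma rc_sym: "rc i j = rc j i"
  by (simp add: rc_def)

text \<open>The normal is an eigenvector of \<open>R\<close> for -1. This is what makes the test
  field in \<open>weak_grad_even\<close> tangential.\<close>

lemma rc_a: "(\<Sum>j\<in>UNIV. rc i j * a $ j) = - a $ i"
proof -
  have "(\<Sum>j\<in>UNIV. rc i j * a $ j) = (\<Sum>j\<in>UNIV. (if i = j then a $ j else 0) - 2 * a $ i * (a $ j * a $ j))"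
    by (rule sum.cong) (auto simp: rc_def algebra_simps)
  also have "\<dots> = a $ i - 2 * a $ i * inner a a"
    by (simp add: sum_subtractf sum_distrib_left[symmetric] inner_vec_def)
  finally show ?thesis by (simp add: inner_a_a)
qed

lemma open_\<Omega>: "open \<Omega>"
  unfolding \<Omega>_def by (intro open_Int open' open_Collect_less continuous_intros)

lemma \<Omega>_sub: "\<Omega> \<subseteq> \<Omega>'" by (auto simp: \<Omega>_def)

lemma sets_\<Omega> [simp]: "\<Omega> \<in> sets lebesgue" and sets_\<Omega>' [simp]: "\<Omega>' \<in> sets lebesgue"
  using open_\<Omega> open' by auto

lemma orthogonal_R: "orthogonal_transformation R"
  by (simp add: orthogonal_transformation linear_R)

sublocale measure_involution R
proof
  have vimage: "R -` A = R ` A" for A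
    by (auto intro: rev_image_eqI)
  have sets_image: "R ` A \<in> sets lebesgue" if "A \<in> sets lebesgue" for A
    by (rule differentiable_image_in_sets_lebesgue[OF that])
      (auto intro: linear_imp_differentiable_on linear_R)
  show m: "R \<in> lebesgue \<rightarrow>\<^sub>M lebesgue"
    by (rule measurableI) (auto simp: vimage sets_image)
  show "distr lebesgue lebesgue R = lebesgue"
  proof (rule measure_eqI)
    fix A assume "A \<in> sets (distr lebesgue lebesgue R)"
    then have A: "A \<in> sets lebesgue" by simp
    have "emeasure (distr lebesgue lebesgue R) A = emeasure lebesgue (R ` A)"
      by (subst emeasure_distr[OF m A]) (simp add: vimage)
    also have "\<dots> = emeasure lebesgue A"
    proof (cases "A \<in> lmeasurable")
      case True
      have "emeasure lebesgue (R ` A) = ennreal (measure lebesgue (R ` A))"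
        using measurable_orthogonal_image[OF orthogonal_R True] by (rule emeasure_eq_measure2)
      also have "\<dots> = emeasure lebesgue A"
        using emeasure_eq_measure2[OF True] by (simp add: measure_orthogonal_image[OF orthogonal_R True])
      finally show ?thesis .
    next
      case False
      have "R ` R ` A = A" by (auto simp: image_image)
      then have "R ` A \<notin> lmeasurable"
        using measurable_orthogonal_image[OF orthogonal_R, of "R ` A"] False by auto
      then show ?thesis using False A sets_image[OF A] by (simp add: fmeasurable_def less_top[symmetric] del: emeasure_completion)
    qed
    finally show "emeasure (distr lebesgue lebesgue R) A = emeasure lebesgue A" .
  qed simp
qed simp

section \<open>Action of the reflection on functions, gradients and form domains\<close>

abbreviation RL :: "((real, 'n) vec) L2 \<Rightarrow> ((real, 'n) vec) L2" where "RL \<equiv> comp_L2 R"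

text \<open>The gradient of a reflected function: by the chain rule it is the Householder matrix
  applied to the reflected gradient.\<close>

definition RG :: "('n \<Rightarrow> ((real, 'n) vec) L2) \<Rightarrow> 'n \<Rightarrow> ((real, 'n) vec) L2" where
  "RG F i = (\<Sum>j\<in>UNIV. rc i j *\<^sub>R RL (F j))"

lemma test_R: "\<phi> \<in> test_functions \<Omega>' \<Longrightarrow> (\<lambda>x. \<phi> (R x)) \<in> test_functions \<Omega>'"
proof (elim test_functionsE)
  fix K assume K: "smooth \<phi>" "compact K" "K \<subseteq> \<Omega>'" "\<And>x. x \<notin> K \<Longrightarrow> \<phi> x = 0"
  show ?thesis
  proof (rule test_functionsI[OF smooth_comp[OF K(1) linear_R]])
    show "compact (R ` K)"
      using K(2) linear_continuous_on[OF linear_R[unfolded linear_conv_bounded_linear]]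
      by (intro compact_continuous_image)
    show "R ` K \<subseteq> \<Omega>'" using K(3) by auto
    show "\<phi> (R x) = 0" if "x \<notin> R ` K" for x
      using that K(4)[of "R x"] by (metis R_R imageI)
  qed
qed

lemma partial_deriv_R:
  assumes "smooth \<phi>"
  shows "partial_deriv i (\<lambda>x. \<phi> (R x)) = (\<lambda>x. \<Sum>j\<in>UNIV. of_real (rc i j) * partial_deriv j \<phi> (R x))"
  by (rule ext) (simp add: partial_deriv_comp_linear[OF smooth_differentiable[OF assms] linear_R] R_axis)

lemma abs_partial_R:
  assumes "\<phi> \<in> test_functions \<Omega>'"
  shows "abs_L2 (partial_deriv i (\<lambda>x. \<phi> (R x))) = RG (\<lambda>j. abs_L2 (partial_deriv j \<phi>)) i"
proof -
  have "smooth \<phi>" using assms by (auto elim: test_functionsE)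
  note sq = sq_integrable_test[OF test_functions_partial_deriv[OF assms]]
  show ?thesis
    unfolding partial_deriv_R[OF \<open>smooth \<phi>\<close>] RG_def comp_L2_abs[OF sq]
    by (rule conjunct2[OF abs_L2_sum]) (rule sq_integrable_R[OF sq])
qed

lemma RL_abs_partial:
  assumes "\<phi> \<in> test_functions \<Omega>'"
  shows "RL (abs_L2 (partial_deriv i \<phi>)) = (\<Sum>j\<in>UNIV. rc i j *\<^sub>R abs_L2 (partial_deriv j (\<lambda>x. \<phi> (R x))))"
proof -
  have "RL (abs_L2 (partial_deriv i (\<lambda>x. \<phi> (R (R x))))) = RL (RG (\<lambda>j. abs_L2 (partial_deriv j (\<lambda>x. \<phi> (R x)))) i)"
    by (subst abs_partial_R[OF test_R[OF assms]]) simp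
  then show ?thesis
    by (simp add: RG_def linear_sum[OF bounded_linear.linear[OF bounded_linear_comp_L2]]
        linear_scale[OF bounded_linear.linear[OF bounded_linear_comp_L2]])
qed

lemma L2_on_RL: "u \<in> L2_on \<Omega>' \<Longrightarrow> RL u \<in> L2_on \<Omega>'"
  by (rule comp_L2_on) auto

lemma L2_on_sum: "(\<And>j. j \<in> J \<Longrightarrow> u j \<in> L2_on \<Omega>') \<Longrightarrow> (\<Sum>j\<in>J. u j) \<in> L2_on \<Omega>'"
  by (induction J rule: infinite_finite_induct) (auto intro: L2_on_lin(1) zero_L2_on)

lemma L2_on_RG: "(\<And>j. F j \<in> L2_on \<Omega>') \<Longrightarrow> RG F i \<in> L2_on \<Omega>'"
  unfolding RG_def by (intro L2_on_sum L2_on_scale(2) L2_on_RL sets_\<Omega>')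

text \<open>The matrix is symmetric and \<open>RL\<close> is self-adjoint, so \<open>RG\<close> is
  self-adjoint on vector fields. This carries the gradient part of the form across \<open>W\<close>
  and \<open>RL\<close>.\<close>

lemma cinner_RG_sum: "(\<Sum>i\<in>UNIV. cinner (RG F i) (K i)) = (\<Sum>i\<in>UNIV. cinner (F i) (RG K i))"
proof -
  have "(\<Sum>i\<in>UNIV. cinner (RG F i) (K i)) = (\<Sum>i\<in>UNIV. \<Sum>j\<in>UNIV. of_real (rc i j) * cinner (F j) (RL (K i)))"
    by (simp add: RG_def cinner_sum_left cinner_scaleR_left cinner_comp_left)
  also have "\<dots> = (\<Sum>j\<in>UNIV. \<Sum>i\<in>UNIV. of_real (rc j i) * cinner (F j) (RL (K i)))"
    by (subst sum.swap) (simp add: rc_sym[of _ _])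
  also have "\<dots> = (\<Sum>i\<in>UNIV. cinner (F i) (RG K i))"
    by (simp add: RG_def cinner_sum_right cinner_scaleR_right)
  finally show ?thesis .
qed

lemma tendsto_RL: "(f \<longlongrightarrow> l) X \<Longrightarrow> ((\<lambda>x. RL (f x)) \<longlongrightarrow> RL l) X"
  by (rule bounded_linear.tendsto[OF bounded_linear_comp_L2])

lemma tendsto_RG: "(\<And>i. ((\<lambda>x. F x i) \<longlongrightarrow> K i) X) \<Longrightarrow> ((\<lambda>x. RG (F x) i) \<longlongrightarrow> RG K i) X"
  unfolding RG_def by (intro tendsto_intros tendsto_RL)

lemma weak_grad_RL:
  assumes "weak_grad \<Omega>' f F" shows "weak_grad \<Omega>' (RL f) (RG F)"
  unfolding weak_grad_def
proof (intro conjI allI ballI)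
  show "RL f \<in> L2_on \<Omega>'" "RG F i \<in> L2_on \<Omega>'" for i
    using assms by (auto simp: weak_grad_def intro: L2_on_RL L2_on_RG)
  fix i \<phi> assume \<phi>: "\<phi> \<in> test_functions \<Omega>'"
  define \<psi> where "\<psi> = (\<lambda>x. \<phi> (R x))"
  have \<psi>: "\<psi> \<in> test_functions \<Omega>'" unfolding \<psi>_def by (rule test_R[OF \<phi>])
  have "cinner (RL f) (abs_L2 (partial_deriv i \<phi>)) = (\<Sum>j\<in>UNIV. of_real (rc i j) * cinner f (abs_L2 (partial_deriv j \<psi>)))"
    by (simp add: cinner_comp_left RL_abs_partial[OF \<phi>] cinner_sum_right cinner_scaleR_right \<psi>_def)
  also have "\<dots> = (\<Sum>j\<in>UNIV. of_real (rc i j) * - cinner (F j) (abs_L2 \<psi>))"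
    using assms \<psi> by (simp add: weak_grad_def)
  also have "abs_L2 \<psi> = RL (abs_L2 \<phi>)"
    unfolding \<psi>_def by (simp add: comp_L2_abs sq_integrable_test[OF \<phi>])
  finally show "cinner (RL f) (abs_L2 (partial_deriv i \<phi>)) = - cinner (RG F i) (abs_L2 \<phi>)"
    by (simp add: RG_def cinner_sum_left cinner_scaleR_left cinner_comp_left sum_negf)
qed

lemma form_domain_RL:
  assumes "f \<in> form_domain bc \<Omega>'" shows "RL f \<in> form_domain bc \<Omega>'"
proof (cases bc)
  case Neumann
  then show ?thesis using assms weak_grad_RL by (auto simp: H1_iff)
next
  case Dirichlet
  then obtain F \<phi> where \<phi>: "weak_grad \<Omega>' f F" "\<And>k :: nat. \<phi> k \<in> test_functions \<Omega>'"
    "(\<lambda>k. abs_L2 (\<phi> k)) \<longlonglongrightarrow> f" "\<And>i. (\<lambda>k. abs_L2 (partial_deriv i (\<phi> k))) \<longlonglongrightarrow> F i"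
    using assms by (auto simp: H10_iff[OF open'])
  have "RL f \<in> H10 \<Omega>'"
    unfolding H10_iff[OF open']
  proof (intro exI[of _ "RG F"] exI[of _ "\<lambda>k x. \<phi> k (R x)"] conjI allI)
    show "weak_grad \<Omega>' (RL f) (RG F)" by (rule weak_grad_RL[OF \<phi>(1)])
    show "(\<lambda>x. \<phi> k (R x)) \<in> test_functions \<Omega>'" for k by (rule test_R[OF \<phi>(2)])
    show "(\<lambda>k. abs_L2 (\<lambda>x. \<phi> k (R x))) \<longlonglongrightarrow> RL f"
      using tendsto_RL[OF \<phi>(3)] by (simp add: comp_L2_abs sq_integrable_test[OF \<phi>(2)])
    show "(\<lambda>k. abs_L2 (partial_deriv i (\<lambda>x. \<phi> k (R x)))) \<longlonglongrightarrow> RG F i" for i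
      unfolding abs_partial_R[OF \<phi>(2)] by (rule tendsto_RG[OF \<phi>(4)])
  qed
  then show ?thesis using Dirichlet by simp
qed

subsection \<open>Cutting off near the hyperplane\<close>

text \<open>The shift by -1 keeps the support at distance at least 1/(m+1) from the hyperplane, so
  multiplying a test function on the symmetric domain gives one on the half domain. On the positive
  side the cutoff tends to 1.\<close>

definition cut :: "nat \<Rightarrow> (real, 'n) vec \<Rightarrow> complex" where
  "cut m x = of_real (bump (real (Suc m) * inner a x - 1))"

definition dcut :: "nat \<Rightarrow> (real, 'n) vec \<Rightarrow> complex" where
  "dcut m x = of_real (real (Suc m) * bump' (real (Suc m) * inner a x - 1))"

lemma smooth_cut: "smooth (cut m)"
  using smooth_ridge[OF smooth1_bump, of "real (Suc m) *\<^sub>R a" "-1"]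
  by (simp add: cut_def[abs_def] del: of_nat_Suc)

lemma partial_deriv_cut: "partial_deriv i (cut m) x = of_real (a $ i) * dcut m x"
proof -
  have "partial_deriv i (\<lambda>x. complex_of_real (bump (inner (real (Suc m) *\<^sub>R a) x + (- 1)))) x
      = of_real ((real (Suc m) *\<^sub>R a) $ i) * of_real (bump' (inner (real (Suc m) *\<^sub>R a) x + (- 1)))"
    by (rule partial_deriv_ridge[OF bump_has_derivative])
  then show ?thesis by (simp add: cut_def[abs_def] dcut_def algebra_simps)
qed

lemma cut_test:
  assumes "\<phi> \<in> test_functions \<Omega>'" shows "(\<lambda>x. cut m x * \<phi> x) \<in> test_functions \<Omega>"
  using assms
proof (elim test_functionsE)
  fix K assume K: "smooth \<phi>" "compact K" "K \<subseteq> \<Omega>'" "\<And>x. x \<notin> K \<Longrightarrow> \<phi> x = 0"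
  define L where "L = K \<inter> {x. real (Suc m) * inner a x \<ge> 1}"
  show ?thesis
  proof (rule test_functionsI[OF smooth_mult[OF smooth_cut K(1)]])
    show "compact L"
      unfolding L_def by (intro compact_Int_closed K closed_Collect_le continuous_intros)
    show "L \<subseteq> \<Omega>"
    proof
      fix x assume x: "x \<in> L"
      then have "real (Suc m) * inner a x > 0" by (auto simp: L_def)
      then have "inner a x > 0" by (simp add: zero_less_mult_iff)
      then show "x \<in> \<Omega>" using x K(3) by (auto simp: L_def \<Omega>_def)
    qed
    show "cut m x * \<phi> x = 0" if "x \<notin> L" for x
      using that K(4) by (auto simp: L_def cut_def bump_eq_0)
  qed
qed

lemma partial_deriv_cut_mult:
  assumes "\<phi> \<in> test_functions \<Omega>'"
  shows "partial_deriv i (\<lambda>x. cut m x * \<phi> x) = (\<lambda>x. cut m x * partial_deriv i \<phi> x + of_real (a $ i) * (dcut m x * \<phi> x))"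
  using assms
  by (intro ext, subst partial_deriv_mult)
    (auto elim!: test_functionsE simp: partial_deriv_cut intro: smooth_differentiable smooth_cut)

lemma Suc_tendsto_at_top: "c > 0 \<Longrightarrow> filterlim (\<lambda>m. real (Suc m) * c) at_top sequentially"
  by (subst mult.commute, intro filterlim_tendsto_pos_mult_at_top[OF tendsto_const])
    (auto intro: filterlim_compose[OF filterlim_real_sequentially filterlim_Suc] simp del: of_nat_Suc)

lemma cut_tendsto:
  assumes "\<phi> \<in> test_functions \<Omega>'"
  shows "(\<lambda>m. abs_L2 (\<lambda>x. cut m x * \<phi> x)) \<longlonglongrightarrow> restrict_L2 \<Omega> (abs_L2 \<phi>)"
proof -
  note sq = sq_integrable_test[OF assms]
  have "(\<lambda>m. abs_L2 (\<lambda>x. cut m x * \<phi> x)) \<longlonglongrightarrow> abs_L2 (\<lambda>x. indicator \<Omega> x * \<phi> x)"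
  proof (rule abs_L2_dominated_convergence[OF sq])
    show "(\<lambda>x. cut m x * \<phi> x) \<in> borel_measurable lebesgue" for m
      by (rule sq_integrableD(1)[OF sq_integrable_test[OF cut_test[OF assms]]])
    show "(\<lambda>x. indicator \<Omega> x * \<phi> x) \<in> borel_measurable lebesgue"
      by (rule sq_integrableD(1)[OF sq_integrable_indicator[OF sq sets_\<Omega>]])
    show "cmod (cut m x * \<phi> x) \<le> cmod (\<phi> x)" for m x
      by (auto simp: cut_def norm_mult abs_of_nonneg bump_ge_0 intro!: mult_left_le_one_le bump_le_1)
    fix x
    show "(\<lambda>m. cut m x * \<phi> x) \<longlonglongrightarrow> indicator \<Omega> x * \<phi> x"
    proof (cases "inner a x > 0")
      case True
      have "filterlim (\<lambda>m. real (Suc m) * inner a x - 1) at_top sequentially"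
        using filterlim_tendsto_add_at_top[OF tendsto_const[of "-1 :: real"] Suc_tendsto_at_top[OF True]]
        by (simp add: algebra_simps)
      then have "(\<lambda>m. cut m x) \<longlonglongrightarrow> of_real 1"
        unfolding cut_def by (intro tendsto_of_real filterlim_compose[OF bump_tendsto])
      then have "(\<lambda>m. cut m x * \<phi> x) \<longlonglongrightarrow> 1 * \<phi> x" by (intro tendsto_mult) auto
      moreover have "\<phi> x = 0" if "x \<notin> \<Omega>'" using that assms by (auto elim!: test_functionsE)
      ultimately show ?thesis using True by (cases "x \<in> \<Omega>'") (auto simp: \<Omega>_def)
    next
      case False
      then have "real (Suc m) * inner a x - 1 \<le> 0" for m
        using mult_nonneg_nonpos[of "real (Suc m)" "inner a x"] by linarith
      then show ?thesis using False by (simp add: cut_def bump_eq_0 \<Omega>_def del: of_nat_Suc)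
    qed
  qed
  then show ?thesis by (simp add: restrict_L2_abs sq)
qed

text \<open>With \<open>s\<close> = (m+1) times the signed distance, the linear vanishing of \<phi>
  bounds the product by C times the absolute value of \<open>s * bump' (s - 1)\<close>. This is at
  most 3C and tends to 0 pointwise, so dominated convergence applies.\<close>

lemma dcut_tendsto:
  assumes \<phi>: "\<phi> \<in> test_functions \<Omega>'" and C: "\<And>x. cmod (\<phi> x) \<le> C * \<bar>inner a x\<bar>" "C \<ge> 0"
  shows "sq_integrable (\<lambda>x. dcut m x * \<phi> x)" "(\<lambda>m. abs_L2 (\<lambda>x. dcut m x * \<phi> x)) \<longlonglongrightarrow> 0"
proof -
  obtain K where K: "smooth \<phi>" "compact K" "\<And>x. x \<notin> K \<Longrightarrow> \<phi> x = 0"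
    using \<phi> by (auto elim: test_functionsE)
  define s where "s m x = real (Suc m) * inner a x" for m x
  have bound: "cmod (dcut m x * \<phi> x) \<le> C * \<bar>s m x * bump' (s m x - 1)\<bar>" for m x
  proof -
    have "cmod (dcut m x * \<phi> x) \<le> cmod (dcut m x) * (C * \<bar>inner a x\<bar>)"
      unfolding norm_mult by (intro mult_left_mono C) auto
    then show ?thesis by (simp add: dcut_def s_def abs_mult norm_mult mult_ac del: of_nat_Suc)
  qed
  have le: "cmod (dcut m x * \<phi> x) \<le> cmod (of_real (3 * C) * indicator K x)" for m x
  proof (cases "x \<in> K")
    case True
    have "C * \<bar>s m x * bump' (s m x - 1)\<bar> \<le> C * 3" by (intro mult_left_mono bump'_bound C)
    then show ?thesis using bound[of m x] True C by simp
  qed (simp add: K)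
  have dom: "sq_integrable (\<lambda>x. of_real (3 * C) * indicator K x)"
    by (rule sq_integrable_const_indicator[OF lmeasurable_compact[OF K(2)]])
  have meas: "(\<lambda>x. dcut m x * \<phi> x) \<in> borel_measurable lebesgue" for m
  proof -
    have "bump' \<in> borel_measurable borel" unfolding bump'_def by measurable
    moreover have "(\<lambda>x. real (Suc m) * inner a x - 1) \<in> borel_measurable lebesgue"
      by (intro continuous_lebesgue_measurable continuous_intros)
    ultimately have [measurable]: "(\<lambda>x. bump' (real (Suc m) * inner a x - 1)) \<in> borel_measurable lebesgue"
      by (rule measurable_compose[rotated])
    note [measurable] = sq_integrableD(1)[OF sq_integrable_test[OF \<phi>]]
    show ?thesis unfolding dcut_def by measurable
  qed
  show "sq_integrable (\<lambda>x. dcut m x * \<phi> x)"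
    by (rule sq_integrable_dominated[OF dom meas, of _ 1]) (use le in simp)
  have "(\<lambda>m. abs_L2 (\<lambda>x. dcut m x * \<phi> x)) \<longlonglongrightarrow> abs_L2 (\<lambda>x. 0)"
  proof (rule abs_L2_dominated_convergence[OF dom meas _ le])
    fix x
    show "(\<lambda>m. dcut m x * \<phi> x) \<longlonglongrightarrow> 0"
    proof (cases "inner a x > 0")
      case True
      have "(\<lambda>m. s m x * bump' (s m x - 1)) \<longlonglongrightarrow> 0"
        unfolding s_def by (rule filterlim_compose[OF bump'_tendsto Suc_tendsto_at_top[OF True]])
      then have "(\<lambda>m. C * \<bar>s m x * bump' (s m x - 1)\<bar>) \<longlonglongrightarrow> 0"
        by (intro tendsto_mult_right_zero tendsto_rabs_zero)
      then show ?thesis by (rule Lim_null_comparison[rotated]) (use bound in \<open>auto intro: always_eventually\<close>)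
    next
      case False
      then have "\<not> real (Suc m) * inner a x - 1 > 0" for m
        using mult_nonneg_nonpos[of "real (Suc m)" "inner a x"] by linarith
      then show ?thesis by (simp add: dcut_def bump'_def del: of_nat_Suc)
    qed
  qed simp
  then show "(\<lambda>m. abs_L2 (\<lambda>x. dcut m x * \<phi> x)) \<longlonglongrightarrow> 0" by (simp add: zero_L2_def)
qed

section \<open>Extending and restricting weak gradients across the hyperplane\<close>

lemma odd_bound:
  assumes "\<phi> \<in> test_functions \<Omega>'"
  obtains C where "C \<ge> 0" "\<And>x. cmod (\<phi> x - \<phi> (R x)) \<le> C * \<bar>inner a x\<bar>"
proof -
  obtain B where B: "B \<ge> 0" "\<And>x y. cmod (\<phi> x - \<phi> y) \<le> B * norm (x - y)"
    by (rule test_function_lipschitz[OF assms]) (auto intro: that)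
  \<comment> \<open>A point and its mirror image are at distance twice the distance to the
    hyperplane, whence the factor 2.\<close>
  have "cmod (\<phi> x - \<phi> (R x)) \<le> (2 * B) * \<bar>inner a x\<bar>" for x
    using B(2)[of x "R x"] by (simp add: R_def norm_a abs_mult)
  then show thesis using B(1) by (intro that[of "2 * B"]) auto
qed

text \<open>
  The bound says that the field \<open>X\<close> is tangential along the hyperplane; this removes the boundary term
  although \<open>X\<close> does not vanish there.
\<close>

lemma weak_grad_tangential:
  assumes f: "weak_grad \<Omega> f F" and X: "\<And>j. X j \<in> test_functions \<Omega>'"
    and C: "C \<ge> 0" "\<And>x. cmod (\<Sum>j\<in>UNIV. of_real (a $ j) * X j x) \<le> C * \<bar>inner a x\<bar>"
  shows "(\<Sum>j\<in>UNIV. cinner f (abs_L2 (partial_deriv j (X j)))) = - (\<Sum>j\<in>UNIV. cinner (F j) (abs_L2 (X j)))"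
proof -
  define \<psi> where "\<psi> x = (\<Sum>j\<in>UNIV. of_real (a $ j) * X j x)" for x
  have zero_test: "(\<lambda>x. 0) \<in> test_functions \<Omega>'"
    by (rule test_functionsI[OF smooth_zero compact_empty]) auto
  have \<psi>: "\<psi> \<in> test_functions \<Omega>'"
  proof -
    have "(\<lambda>x. \<Sum>j\<in>J. of_real (a $ j) * X j x) \<in> test_functions \<Omega>'" for J :: "'n set"
      by (induction J rule: infinite_finite_induct)
        (auto intro!: test_functions_add test_functions_cmult X zero_test)
    then show ?thesis by (simp add: \<psi>_def[abs_def])
  qed
  note sqX = sq_integrable_test[OF cut_test[OF X]]
    sq_integrable_test[OF cut_test[OF test_functions_partial_deriv[OF X]]]
  note dpsi = dcut_tendsto[OF \<psi> C(2)[folded \<psi>_def] C(1)]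
  \<comment> \<open>A single \<open>X j\<close> need not vanish at the hyperplane, so
    \<open>dcut_tendsto\<close> does not apply to it; for fixed \<open>m\<close> square
    integrability is read off from the product rule.\<close>
  have sqd: "sq_integrable (\<lambda>x. of_real (a $ j) * (dcut m x * X j x))" for j m
  proof -
    have "(\<lambda>x. of_real (a $ j) * (dcut m x * X j x)) = (\<lambda>x. partial_deriv j (\<lambda>x. cut m x * X j x) x - cut m x * partial_deriv j (X j) x)"
      by (simp add: partial_deriv_cut_mult[OF X])
    then show ?thesis
      using sq_integrable_diff[OF sq_integrable_test[OF test_functions_partial_deriv[OF cut_test[OF X]]] sqX(2)]
      by simp
  qed
  \<comment> \<open>The terms with \<open>dcut\<close> are controlled only after summation over
    \<open>j\<close>, when they combine to the normal component \<psi>, and this is the quantity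
    with the linear bound.\<close>
  have key: "(\<Sum>j\<in>UNIV. cinner f (abs_L2 (\<lambda>x. cut m x * partial_deriv j (X j) x))) + cinner f (abs_L2 (\<lambda>x. dcut m x * \<psi> x))
      = - (\<Sum>j\<in>UNIV. cinner (F j) (abs_L2 (\<lambda>x. cut m x * X j x)))" for m
  proof -
    have e1: "abs_L2 (partial_deriv j (\<lambda>x. cut m x * X j x)) = abs_L2 (\<lambda>x. cut m x * partial_deriv j (X j) x)
        + abs_L2 (\<lambda>x. of_real (a $ j) * (dcut m x * X j x))" for j
      unfolding partial_deriv_cut_mult[OF X] by (rule abs_L2_add[symmetric, OF sqX(2) sqd])
    have e2: "cinner f (abs_L2 (partial_deriv j (\<lambda>x. cut m x * X j x))) = - cinner (F j) (abs_L2 (\<lambda>x. cut m x * X j x))" for j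
      using f cut_test[OF X] by (simp add: weak_grad_def)
    have st: "- cinner (F j) (abs_L2 (\<lambda>x. cut m x * X j x)) = cinner f (abs_L2 (\<lambda>x. cut m x * partial_deriv j (X j) x))
        + cinner f (abs_L2 (\<lambda>x. of_real (a $ j) * (dcut m x * X j x)))" for j
      by (rule e2[symmetric, unfolded e1 cinner_add_right])
    have "- (\<Sum>j\<in>UNIV. cinner (F j) (abs_L2 (\<lambda>x. cut m x * X j x)))
        = (\<Sum>j\<in>UNIV. cinner f (abs_L2 (\<lambda>x. cut m x * partial_deriv j (X j) x)))
        + cinner f (\<Sum>j\<in>UNIV. 1 *\<^sub>R abs_L2 (\<lambda>x. of_real (a $ j) * (dcut m x * X j x)))"
      unfolding sum_negf[symmetric] st by (simp add: sum.distrib cinner_sum_right)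
    moreover have "(\<Sum>j\<in>UNIV. 1 *\<^sub>R abs_L2 (\<lambda>x. of_real (a $ j) * (dcut m x * X j x))) = abs_L2 (\<lambda>x. dcut m x * \<psi> x)"
      using abs_L2_sum[of UNIV "\<lambda>j x. of_real (a $ j) * (dcut m x * X j x)" "\<lambda>j. 1", OF sqd]
      by (simp add: \<psi>_def sum_distrib_left mult_ac)
    ultimately show ?thesis by simp
  qed
  have "(\<lambda>m. (\<Sum>j\<in>UNIV. cinner f (abs_L2 (\<lambda>x. cut m x * partial_deriv j (X j) x))) + cinner f (abs_L2 (\<lambda>x. dcut m x * \<psi> x)))
      \<longlonglongrightarrow> (\<Sum>j\<in>UNIV. cinner f (restrict_L2 \<Omega> (abs_L2 (partial_deriv j (X j))))) + cinner f 0"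
    by (intro tendsto_intros tendsto_cinner cut_tendsto dpsi test_functions_partial_deriv X)
  moreover have "(\<lambda>m. - (\<Sum>j\<in>UNIV. cinner (F j) (abs_L2 (\<lambda>x. cut m x * X j x))))
      \<longlonglongrightarrow> - (\<Sum>j\<in>UNIV. cinner (F j) (restrict_L2 \<Omega> (abs_L2 (X j))))"
    by (intro tendsto_intros tendsto_cinner cut_tendsto X)
  ultimately have "(\<Sum>j\<in>UNIV. cinner f (restrict_L2 \<Omega> (abs_L2 (partial_deriv j (X j))))) + cinner f 0
      = - (\<Sum>j\<in>UNIV. cinner (F j) (restrict_L2 \<Omega> (abs_L2 (X j))))"
    unfolding key using LIMSEQ_unique by blast
  moreover have "restrict_L2 \<Omega> f = f" "restrict_L2 \<Omega> (F j) = F j" for j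
    using f by (auto simp: weak_grad_def restrict_L2_ident)
  moreover have "cinner f 0 = 0" using cinner_diff_right[of f f f] by simp
  ultimately show ?thesis by (simp add: cinner_restrict_L2)
qed

text \<open>Testing the even extension with \<phi> on the full domain is folded back to testing
  \<open>f\<close> on the half domain with a vector field that is tangential at the
  hyperplane.\<close>

lemma weak_grad_even:
  assumes f: "weak_grad \<Omega> f F"
  shows "weak_grad \<Omega>' (f + RL f) (\<lambda>i. F i + RG F i)"
  unfolding weak_grad_def
proof (intro conjI allI ballI)
  have in': "f \<in> L2_on \<Omega>'" "F i \<in> L2_on \<Omega>'" for i
    using f L2_on_mono[OF \<Omega>_sub] by (auto simp: weak_grad_def)
  then show "f + RL f \<in> L2_on \<Omega>'" "F i + RG F i \<in> L2_on \<Omega>'" for i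
    by (auto intro!: L2_on_lin(1) L2_on_RL L2_on_RG)
  fix i \<phi> assume \<phi>: "\<phi> \<in> test_functions \<Omega>'"
  define \<psi> where "\<psi> = (\<lambda>x. \<phi> (R x))"
  have \<psi>: "\<psi> \<in> test_functions \<Omega>'" unfolding \<psi>_def by (rule test_R[OF \<phi>])
  \<comment> \<open>The field \<phi> e_i + (\<phi> o R) R e_i. Its divergence collects both halves
    of the pairing with the i-th partial derivative, and its normal component is
    \<open>a $ i\<close> times the odd function \<phi> - \<phi> o R.\<close>
  define X where "X j x = of_real (if i = j then 1 else 0) * \<phi> x + of_real (rc i j) * \<psi> x" for j x
  have X: "X j \<in> test_functions \<Omega>'" for j
    unfolding X_def by (intro test_functions_add test_functions_cmult \<phi> \<psi>)
  note sq = sq_integrable_test[OF \<phi>] sq_integrable_test[OF \<psi>]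
    sq_integrable_test[OF test_functions_partial_deriv[OF \<phi>]]
    sq_integrable_test[OF test_functions_partial_deriv[OF \<psi>]]
  have pd: "partial_deriv j (X j) = (\<lambda>x. of_real (if i = j then 1 else 0) * partial_deriv j \<phi> x + of_real (rc i j) * partial_deriv j \<psi> x)" for j
  proof
    fix x
    have "smooth \<phi>" "smooth \<psi>" using \<phi> \<psi> by (auto elim: test_functionsE)
    then have "\<phi> differentiable (at x)" "\<psi> differentiable (at x)"
      "(\<lambda>x. c * \<phi> x) differentiable (at x)" "(\<lambda>x. c * \<psi> x) differentiable (at x)" for c
      by (auto intro: smooth_differentiable smooth_cmult)
    then show "partial_deriv j (X j) x = of_real (if i = j then 1 else 0) * partial_deriv j \<phi> x + of_real (rc i j) * partial_deriv j \<psi> x"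
      unfolding X_def by (simp add: partial_deriv_add partial_deriv_cmult)
  qed
  have absX: "abs_L2 (X j) = (if i = j then 1 else 0) *\<^sub>R abs_L2 \<phi> + rc i j *\<^sub>R abs_L2 \<psi>"
    and absdX: "abs_L2 (partial_deriv j (X j)) = (if i = j then 1 else 0) *\<^sub>R abs_L2 (partial_deriv j \<phi>) + rc i j *\<^sub>R abs_L2 (partial_deriv j \<psi>)" for j
    unfolding pd X_def
    by (simp_all only: scaleR_eq_cscale cscale_abs_L2 abs_L2_add sq sq_integrable_cmult)
  have "(\<Sum>j\<in>UNIV. of_real (a $ j) * X j x) = of_real (a $ i) * (\<phi> x - \<phi> (R x))" for x
  proof -
    have "(\<Sum>j\<in>UNIV. of_real (a $ j) * X j x) = (\<Sum>j\<in>UNIV. (if i = j then of_real (a $ j) * \<phi> x else 0) + of_real (rc i j * a $ j) * \<psi> x)"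
      by (rule sum.cong) (auto simp: X_def algebra_simps)
    also have "\<dots> = of_real (a $ i) * \<phi> x + of_real (\<Sum>j\<in>UNIV. rc i j * a $ j) * \<psi> x"
      by (simp add: sum.distrib sum_distrib_right)
    finally show ?thesis unfolding rc_a by (simp add: \<psi>_def algebra_simps)
  qed
  moreover obtain C where C: "C \<ge> 0" "\<And>x. cmod (\<phi> x - \<phi> (R x)) \<le> C * \<bar>inner a x\<bar>"
    by (rule odd_bound[OF \<phi>]) (auto intro: that)
  ultimately have bd: "cmod (\<Sum>j\<in>UNIV. of_real (a $ j) * X j x) \<le> (\<bar>a $ i\<bar> * C) * \<bar>inner a x\<bar>" for x
    using mult_left_mono[OF C(2), of "\<bar>a $ i\<bar>" x] by (simp add: norm_mult mult.assoc)
  have "(\<Sum>j\<in>UNIV. cinner f (abs_L2 (partial_deriv j (X j)))) = - (\<Sum>j\<in>UNIV. cinner (F j) (abs_L2 (X j)))"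
    using C(1) by (intro weak_grad_tangential[OF f X _ bd]) auto
  moreover have kron: "(\<Sum>j\<in>UNIV. complex_of_real (if i = j then 1 else 0) * g j) = g i" for g
  proof -
    have "(\<Sum>j\<in>UNIV. complex_of_real (if i = j then 1 else 0) * g j) = (\<Sum>j\<in>UNIV. if i = j then g j else 0)"
      by (rule sum.cong) auto
    then show ?thesis by simp
  qed
  moreover have "(\<Sum>j\<in>UNIV. cinner f (abs_L2 (partial_deriv j (X j)))) = cinner (f + RL f) (abs_L2 (partial_deriv i \<phi>))"
    unfolding absdX cinner_add_right cinner_scaleR_right sum.distrib kron
    by (simp add: cinner_add_left cinner_comp_left RL_abs_partial[OF \<phi>] \<psi>_def
        cinner_sum_right cinner_scaleR_right)
  moreover have "(\<Sum>j\<in>UNIV. cinner (F j) (abs_L2 (X j))) = cinner (F i + RG F i) (abs_L2 \<phi>)"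
    unfolding absX cinner_add_right cinner_scaleR_right sum.distrib kron
    by (simp add: cinner_add_left RG_def cinner_sum_left cinner_scaleR_left cinner_comp_left
        comp_L2_abs sq(1) \<psi>_def)
  ultimately show "cinner (f + RL f) (abs_L2 (partial_deriv i \<phi>)) = - cinner (F i + RG F i) (abs_L2 \<phi>)"
    by simp
qed

lemma weak_grad_restrict:
  assumes "weak_grad \<Omega>' g K"
  shows "weak_grad \<Omega> (restrict_L2 \<Omega> g) (\<lambda>i. restrict_L2 \<Omega> (K i))"
proof -
  have r: "restrict_L2 \<Omega> (abs_L2 \<phi>) = abs_L2 \<phi>" if "\<phi> \<in> test_functions \<Omega>" for \<phi>
    using weak_grad_test[OF open_\<Omega> that] by (intro restrict_L2_ident) (auto simp: weak_grad_def)
  have c: "cinner (restrict_L2 \<Omega> u) (abs_L2 \<phi>) = cinner u (abs_L2 \<phi>)" if "\<phi> \<in> test_functions \<Omega>" for u \<phi>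
    using cinner_restrict_L2[OF sets_\<Omega>, of u "abs_L2 \<phi>"] by (simp add: r that)
  show ?thesis
    using assms test_functions_mono[OF \<Omega>_sub]
    by (auto simp: weak_grad_def restrict_L2_in c c[OF test_functions_partial_deriv])
qed

text \<open>Replaces a trace theorem: for a function vanishing linearly at the hyperplane the
  cut-off versions converge together with their derivatives, since the term with \<open>dcut\<close>
  disappears.\<close>

lemma restrict_odd_H10:
  assumes \<psi>: "\<psi> \<in> test_functions \<Omega>'" and C: "\<And>x. cmod (\<psi> x) \<le> C * \<bar>inner a x\<bar>" "C \<ge> 0"
  shows "restrict_L2 \<Omega> (abs_L2 \<psi>) \<in> H10 \<Omega>"
  unfolding H10_iff[OF open_\<Omega>]
proof (intro exI conjI allI)
  show "weak_grad \<Omega> (restrict_L2 \<Omega> (abs_L2 \<psi>)) (\<lambda>i. restrict_L2 \<Omega> (abs_L2 (partial_deriv i \<psi>)))"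
    by (rule weak_grad_restrict[OF weak_grad_test[OF open' \<psi>]])
  show "(\<lambda>x. cut m x * \<psi> x) \<in> test_functions \<Omega>" for m by (rule cut_test[OF \<psi>])
  show "(\<lambda>m. abs_L2 (\<lambda>x. cut m x * \<psi> x)) \<longlonglongrightarrow> restrict_L2 \<Omega> (abs_L2 \<psi>)"
    by (rule cut_tendsto[OF \<psi>])
  fix i
  note d = dcut_tendsto[OF \<psi> C]
  have "abs_L2 (partial_deriv i (\<lambda>x. cut m x * \<psi> x)) = abs_L2 (\<lambda>x. cut m x * partial_deriv i \<psi> x)
      + cscale (of_real (a $ i)) (abs_L2 (\<lambda>x. dcut m x * \<psi> x))" for m
    unfolding partial_deriv_cut_mult[OF \<psi>]
    by (simp add: abs_L2_add cscale_abs_L2 d(1) sq_integrable_cmult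
        sq_integrable_test[OF cut_test[OF test_functions_partial_deriv[OF \<psi>]]])
  moreover have "(\<lambda>m. abs_L2 (\<lambda>x. cut m x * partial_deriv i \<psi> x) + cscale (of_real (a $ i)) (abs_L2 (\<lambda>x. dcut m x * \<psi> x)))
      \<longlonglongrightarrow> restrict_L2 \<Omega> (abs_L2 (partial_deriv i \<psi>)) + cscale (of_real (a $ i)) 0"
    by (intro tendsto_add cut_tendsto test_functions_partial_deriv \<psi>
        bounded_linear.tendsto[OF bounded_linear_cscale] d(2))
  moreover have "cscale c (0 :: ((real, 'n) vec) L2) = 0" for c
    using bounded_linear_cscale by (rule linear_simps)
  ultimately show "(\<lambda>m. abs_L2 (partial_deriv i (\<lambda>x. cut m x * \<psi> x))) \<longlonglongrightarrow> restrict_L2 \<Omega> (abs_L2 (partial_deriv i \<psi>))"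
    by simp
qed

end

section \<open>Schroedinger operators under reflection\<close>

lemma schroedinger_form_eq:
  assumes \<Omega>: "open \<Omega>" and V: "ess_bounded (\<lambda>x. indicator \<Omega> x * V x) M"
    and f: "weak_grad \<Omega> f F" and g: "weak_grad \<Omega> g K"
  shows "schroedinger_form \<Omega> V f g
    = (\<Sum>i\<in>UNIV. cinner (F i) (K i)) + cinner (mult_L2 (\<lambda>x. indicator \<Omega> x * V x) f) g"
proof -
  have S: "\<Omega> \<in> sets lebesgue" using \<Omega> by auto
  have "(LINT x:\<Omega>|lebesgue. \<Sum>i\<in>UNIV. rep_L2 (F i) x * cnj (rep_L2 (K i) x))
      = (LINT x|lebesgue. (\<Sum>i\<in>UNIV. of_real (indicator \<Omega> x) * rep_L2 (F i) x * cnj (rep_L2 (K i) x)))"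
    unfolding set_lebesgue_integral_def
    by (rule Bochner_Integration.integral_cong) (auto simp: indicator_def sum_distrib_left)
  also have "\<dots> = (\<Sum>i\<in>UNIV. (LINT x|lebesgue. of_real (indicator \<Omega> x) * rep_L2 (F i) x * cnj (rep_L2 (K i) x)))"
    by (intro Bochner_Integration.integral_sum sq_integrable_mult_integrable sq_integrable_rep
        sq_integrable_mult[OF ess_bounded_indicator[OF S]])
  also have "\<dots> = (\<Sum>i\<in>UNIV. cinner (restrict_L2 \<Omega> (F i)) (K i))"
    unfolding restrict_L2_eq_mult cinner_mult_L2[OF ess_bounded_indicator[OF S]] ..
  also have "\<dots> = (\<Sum>i\<in>UNIV. cinner (F i) (K i))"
    using f by (simp add: weak_grad_def restrict_L2_ident[OF S])
  finally have 1: "(LINT x:\<Omega>|lebesgue. \<Sum>i\<in>UNIV. rep_L2 (F i) x * cnj (rep_L2 (K i) x))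
      = (\<Sum>i\<in>UNIV. cinner (F i) (K i))" .
  have 2: "(LINT x:\<Omega>|lebesgue. of_real (V x) * rep_L2 f x * cnj (rep_L2 g x))
      = cinner (mult_L2 (\<lambda>x. indicator \<Omega> x * V x) f) g"
    unfolding set_lebesgue_integral_def cinner_mult_L2[OF V]
    by (rule Bochner_Integration.integral_cong) (auto simp: indicator_def)
  show ?thesis
    unfolding schroedinger_form_def weak_deriv_eq[OF \<Omega> f] weak_deriv_eq[OF \<Omega> g] 1 2 ..
qed

text \<open>The gradient part is nonnegative, so only the potential can be negative. This is the
  dissipativity hypothesis of \<open>C0_commute\<close> for the generator -H.\<close>

lemma schroedinger_op_semibounded:
  assumes \<Omega>: "open \<Omega>" and V: "ess_bounded (\<lambda>x. indicator \<Omega> x * V x) M"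
    and fh: "(f, h) \<in> schroedinger_op bc \<Omega> V"
  shows "- (M * (norm f)\<^sup>2) \<le> inner h f"
proof -
  let ?m = "mult_L2 (\<lambda>x. indicator \<Omega> x * V x)"
  have f: "f \<in> form_domain bc \<Omega>" using fh by (auto simp: schroedinger_op_def)
  then obtain F where F: "weak_grad \<Omega> f F" using form_domain_weak_grad by blast
  have "cinner h f = (\<Sum>i\<in>UNIV. cinner (F i) (F i)) + cinner (?m f) f"
    using fh f schroedinger_form_eq[OF \<Omega> V F F] by (auto simp: schroedinger_op_def)
  then have "inner h f = (\<Sum>i\<in>UNIV. (norm (F i))\<^sup>2) + inner (?m f) f"
    unfolding inner_L2_def by (simp add: cinner_eq_inner Re_sum)
  moreover have "\<bar>inner (?m f) f\<bar> \<le> M * (norm f)\<^sup>2"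
  proof -
    have "\<bar>inner (?m f) f\<bar> \<le> norm (?m f) * norm f" by (rule Cauchy_Schwarz_ineq2)
    also have "\<dots> \<le> (M * norm f) * norm f" by (intro mult_right_mono norm_mult_L2[OF V]) auto
    finally show ?thesis by (simp add: power2_eq_square mult.assoc)
  qed
  moreover have "0 \<le> (\<Sum>i\<in>UNIV. (norm (F i))\<^sup>2)" by (intro sum_nonneg) auto
  ultimately show ?thesis by linarith
qed

lemma ess_bounded_Linf:
  assumes \<Omega>: "\<Omega> \<in> sets lebesgue" and V: "Linf_on \<Omega> V"
  shows "\<exists>M. ess_bounded (\<lambda>x. indicator \<Omega> x * V x) M"
proof -
  let ?e = "esssup (lebesgue_on \<Omega>) (\<lambda>x. ereal \<bar>V x\<bar>)"
  have m: "V \<in> borel_measurable (lebesgue_on \<Omega>)" and fin: "?e < \<infinity>"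
    using V by (auto simp: Linf_on_def)
  obtain M where M: "?e \<le> ereal M" "0 \<le> M"
  proof (cases ?e)
    case (real r)
    then show ?thesis by (intro that[of "max r 0"]) auto
  next
    \<comment> \<open>The supremum of a nonnegative function is -\<infinity> only if \<Omega> is a
      null set.\<close>
    case MInf
    then show ?thesis by (intro that[of 0]) auto
  next
    case PInf
    then show ?thesis using fin by simp
  qed
  have "AE x in lebesgue_on \<Omega>. ereal \<bar>V x\<bar> \<le> ?e"
    by (rule esssup_AE)
  then have "AE x in lebesgue. x \<in> \<Omega> \<longrightarrow> ereal \<bar>V x\<bar> \<le> ?e"
    using \<Omega> by (simp add: AE_restrict_space_iff)
  then have "AE x in lebesgue. \<bar>indicator \<Omega> x * V x\<bar> \<le> M"
    by eventually_elim (use M in \<open>auto simp: indicator_def dest: order_trans\<close>)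
  moreover have "(\<lambda>x. indicator \<Omega> x * V x) \<in> borel_measurable lebesgue"
    using m \<Omega> by (simp add: borel_measurable_restrict_space_iff)
  ultimately show ?thesis using M(2) by (auto simp: ess_bounded_def)
qed

context reflection
begin

fun sg :: "boundary_condition \<Rightarrow> real" where
  "sg Dirichlet = - 1"
| "sg Neumann = 1"

lemma sg_sg [simp]: "sg bc * sg bc = 1" "sg bc * (sg bc * x) = x"
  by (cases bc; simp)+

text \<open>\<open>W\<close> is an isometry of \<open>L\<^sup>2(\<Omega>)\<close> onto the odd or even elements of \<open>L\<^sup>2(\<Omega>')\<close>, and \<open>Ws\<close> is its adjoint.\<close>

definition W :: "boundary_condition \<Rightarrow> ((real, 'n) vec) L2 \<Rightarrow> ((real, 'n) vec) L2" where
  "W bc f = (1 / sqrt 2) *\<^sub>R (f + sg bc *\<^sub>R RL f)"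

definition Ws :: "boundary_condition \<Rightarrow> ((real, 'n) vec) L2 \<Rightarrow> ((real, 'n) vec) L2" where
  "Ws bc g = (1 / sqrt 2) *\<^sub>R restrict_L2 \<Omega> (g + sg bc *\<^sub>R RL g)"

lemma bounded_linear_W: "bounded_linear (W bc)"
  unfolding W_def[abs_def]
  by (intro bounded_linear_scaleR_right[THEN bounded_linear_compose] bounded_linear_add
      bounded_linear_ident bounded_linear_comp_L2)

lemma bounded_linear_Ws: "bounded_linear (Ws bc)"
  unfolding Ws_def[abs_def]
  by (intro bounded_linear_scaleR_right[THEN bounded_linear_compose] bounded_linear_add
      bounded_linear_restrict_L2[OF sets_\<Omega>, THEN bounded_linear_compose]
      bounded_linear_ident bounded_linear_comp_L2)

lemmas RL_simps = linear_simps[OF bounded_linear_comp_L2]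
lemmas restrict_simps = linear_simps[OF bounded_linear_restrict_L2[OF sets_\<Omega>]]
lemmas W_simps = linear_simps[OF bounded_linear_W]
lemmas Ws_simps = linear_simps[OF bounded_linear_Ws]

lemma W_cscale: "W bc (cscale c f) = cscale c (W bc f)"
  by (simp add: W_def comp_L2_cscale scaleR_eq_cscale cscale_cscale cscale_add_right mult.commute)

lemma Ws_cscale: "Ws bc (cscale c f) = cscale c (Ws bc f)"
  by (simp add: Ws_def comp_L2_cscale scaleR_eq_cscale cscale_cscale cscale_add_right mult.commute
      restrict_simps restrict_L2_cscale)

lemma W_in: "f \<in> L2_on \<Omega> \<Longrightarrow> W bc f \<in> L2_on \<Omega>'"
  unfolding W_def using L2_on_mono[OF \<Omega>_sub] by (intro L2_on_lin L2_on_scale L2_on_RL sets_\<Omega>') auto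

lemma Ws_in: "Ws bc g \<in> L2_on \<Omega>"
  unfolding Ws_def by (intro L2_on_scale(2) restrict_L2_in sets_\<Omega>) auto

lemma RL_W: "RL (W bc f) = sg bc *\<^sub>R W bc f"
  by (simp add: W_def RL_simps algebra_simps)

lemma cinner_W:
  assumes "f \<in> L2_on \<Omega>" shows "cinner (W bc f) g = cinner f (Ws bc g)"
proof -
  have "cinner f (restrict_L2 \<Omega> u) = cinner f u" for u
    using assms by (simp add: cinner_restrict_L2 restrict_L2_ident)
  then show ?thesis
    by (simp add: W_def Ws_def cinner_scaleR_left cinner_scaleR_right cinner_add_left cinner_add_right
        cinner_comp_left)
qed

definition \<Omega>m :: "(real, 'n) vec set" where "\<Omega>m = \<Omega>' \<inter> {x. inner a x < 0}"

lemma sets_\<Omega>m: "\<Omega>m \<in> sets lebesgue"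
proof -
  have "open \<Omega>m" unfolding \<Omega>m_def by (intro open_Int open' open_Collect_less continuous_intros)
  then show ?thesis by auto
qed

lemma R_in_\<Omega>: "R x \<in> \<Omega> \<longleftrightarrow> x \<in> \<Omega>m" "R x \<in> \<Omega>m \<longleftrightarrow> x \<in> \<Omega>"
  by (auto simp: \<Omega>_def \<Omega>m_def)

lemma restrict_RL:
  assumes "f \<in> L2_on \<Omega>" shows "restrict_L2 \<Omega> (RL f) = 0"
proof -
  have "RL f \<in> L2_on \<Omega>m" using assms R_in_\<Omega>(1) by (rule comp_L2_on)
  then have "RL f = restrict_L2 \<Omega>m (RL f)" using restrict_L2_ident[OF sets_\<Omega>m] by simp
  then have "restrict_L2 \<Omega> (RL f) = restrict_L2 (\<Omega> \<inter> \<Omega>m) (RL f)"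
    using restrict_restrict_L2[OF sets_\<Omega> sets_\<Omega>m] by metis
  also have "\<Omega> \<inter> \<Omega>m = {}" by (auto simp: \<Omega>_def \<Omega>m_def)
  finally show ?thesis by (simp add: restrict_L2_def zero_L2_def)
qed

lemma Ws_W:
  assumes "f \<in> L2_on \<Omega>" shows "Ws bc (W bc f) = f"
proof -
  have "Ws bc (W bc f) = (1 / sqrt 2) *\<^sub>R restrict_L2 \<Omega> (2 *\<^sub>R W bc f)"
    unfolding Ws_def RL_W by (simp add: scaleR_2)
  also have "\<dots> = f"
    using assms by (simp add: W_def restrict_simps restrict_RL restrict_L2_ident)
  finally show ?thesis .
qed

lemma AE_hyperplane: "AE x in lebesgue. inner a x \<noteq> 0"
proof -
  have "negligible {x. inner a x = 0}" using norm_a by (intro negligible_hyperplane) auto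
  then have "AE x in lebesgue. x \<notin> {x. inner a x = 0}"
    by (intro AE_not_in) (simp add: negligible_iff_null_sets)
  then show ?thesis by simp
qed

lemma restrict_split:
  assumes "u \<in> L2_on \<Omega>'" shows "restrict_L2 \<Omega> u + restrict_L2 \<Omega>m u = u"
proof (rule L2_eqI)
  have "AE x in lebesgue. x \<notin> \<Omega>' \<longrightarrow> rep_L2 u x = 0" using assms by (simp add: L2_on_def)
  then show "AE x in lebesgue. rep_L2 (restrict_L2 \<Omega> u + restrict_L2 \<Omega>m u) x = rep_L2 u x"
    using rep_L2_add[of "restrict_L2 \<Omega> u" "restrict_L2 \<Omega>m u"] rep_restrict_L2[OF sets_\<Omega>, of u]
      rep_restrict_L2[OF sets_\<Omega>m, of u] AE_hyperplane
    by eventually_elim (auto simp: indicator_def \<Omega>_def \<Omega>m_def)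
qed

text \<open>The orthogonal projection onto the odd or even part: the symmetrised function is
  determined by its restriction to \<Omega>, because the hyperplane has measure 0.\<close>

lemma W_Ws:
  assumes "g \<in> L2_on \<Omega>'" shows "W bc (Ws bc g) = (1 / 2) *\<^sub>R (g + sg bc *\<^sub>R RL g)"
proof -
  define u where "u = g + sg bc *\<^sub>R RL g"
  have u: "u \<in> L2_on \<Omega>'" unfolding u_def using assms by (intro L2_on_lin L2_on_scale L2_on_RL sets_\<Omega>')
  have "RL u = sg bc *\<^sub>R u" unfolding u_def by (simp add: RL_simps algebra_simps)
  then have "RL (restrict_L2 \<Omega> u) = sg bc *\<^sub>R restrict_L2 \<Omega>m u"
    using comp_restrict_L2[OF sets_\<Omega> sets_\<Omega>m R_in_\<Omega>(1), of u]
      linear_simps[OF bounded_linear_restrict_L2[OF sets_\<Omega>m]] by simp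
  then have "W bc (Ws bc g) = (1 / sqrt 2 * (1 / sqrt 2)) *\<^sub>R (restrict_L2 \<Omega> u + restrict_L2 \<Omega>m u)"
    unfolding W_def Ws_def u_def[symmetric] by (simp add: RL_simps algebra_simps)
  also have "\<dots> = (1 / 2) *\<^sub>R u" by (simp add: restrict_split[OF u])
  finally show ?thesis by (simp add: u_def)
qed

lemma W_Ws_sym: "g \<in> L2_on \<Omega>' \<Longrightarrow> RL g = sg bc *\<^sub>R g \<Longrightarrow> W bc (Ws bc g) = g"
  by (simp add: W_Ws flip: scaleR_2)

lemma norm_W:
  assumes "f \<in> L2_on \<Omega>" shows "norm (W bc f) = norm f"
proof -
  have "cinner (W bc f) (W bc f) = cinner f f" by (simp add: cinner_W assms Ws_W)
  then show ?thesis by (simp add: norm_eq_sqrt_inner inner_L2_def)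
qed

lemma norm_Ws: "norm (Ws bc g) \<le> norm g"
proof -
  have "cinner (Ws bc g) (Ws bc g) = cinner (W bc (Ws bc g)) g" by (simp add: cinner_W Ws_in)
  then have "norm (Ws bc g) * norm (Ws bc g) = inner (W bc (Ws bc g)) g"
    by (simp add: inner_L2_def power2_norm_eq_inner flip: power2_eq_square)
  also have "\<dots> \<le> norm (Ws bc g) * norm g"
    using norm_cauchy_schwarz[of "W bc (Ws bc g)" g] by (simp add: norm_W Ws_in)
  finally show ?thesis by (cases "Ws bc g = 0") auto
qed

text \<open>\<open>Ws\<close> annihilates the part of the wrong parity. A control on the full domain
  need not have any parity, and this makes its projection harmless.\<close>

lemma Ws_symmetrized: "Ws bc ((1 / 2) *\<^sub>R (q + sg bc *\<^sub>R RL q)) = Ws bc q"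
proof -
  have "(1 / 2) *\<^sub>R (q + sg bc *\<^sub>R RL q) + sg bc *\<^sub>R RL ((1 / 2) *\<^sub>R (q + sg bc *\<^sub>R RL q)) = q + sg bc *\<^sub>R RL q"
    by (simp add: RL_simps algebra_simps flip: scaleR_add_left)
  then show ?thesis unfolding Ws_def by simp
qed

subsection \<open>Form domains\<close>

text \<open>Even extension is \<open>weak_grad_even\<close>. For Dirichlet conditions the odd
  extension of a test function on \<Omega> is a test function on \<open>\<Omega>'\<close>, and
  gradients pass to the limit.\<close>

lemma weak_grad_W:
  assumes "f \<in> form_domain bc \<Omega>" and F: "weak_grad \<Omega> f F"
  shows "weak_grad \<Omega>' (W bc f) (\<lambda>i. (1 / sqrt 2) *\<^sub>R (F i + sg bc *\<^sub>R RG F i))"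
    and "W bc f \<in> form_domain bc \<Omega>'"
proof -
  have "weak_grad \<Omega>' (f + sg bc *\<^sub>R RL f) (\<lambda>i. F i + sg bc *\<^sub>R RG F i) \<and>
      f + sg bc *\<^sub>R RL f \<in> form_domain bc \<Omega>'"
  proof (cases bc)
    case Neumann
    then show ?thesis using weak_grad_even[OF F] by (auto simp: H1_iff)
  next
    case Dirichlet
    then obtain F' \<phi> where \<phi>: "weak_grad \<Omega> f F'" "\<And>k :: nat. \<phi> k \<in> test_functions \<Omega>"
      "(\<lambda>k. abs_L2 (\<phi> k)) \<longlonglongrightarrow> f" "\<And>i. (\<lambda>k. abs_L2 (partial_deriv i (\<phi> k))) \<longlonglongrightarrow> F' i"
      using assms(1) by (auto simp: H10_iff[OF open_\<Omega>])
    have "F' = F" using weak_deriv_eq[OF open_\<Omega> \<phi>(1)] weak_deriv_eq[OF open_\<Omega> F] by auto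
    have \<phi>': "\<phi> k \<in> test_functions \<Omega>'" for k by (rule test_functions_mono[OF \<Omega>_sub \<phi>(2)])
    define \<theta> where "\<theta> k x = \<phi> k x + (- 1) * \<phi> k (R x)" for k x
    have \<theta>: "\<theta> k \<in> test_functions \<Omega>'" for k
      unfolding \<theta>_def by (intro test_functions_add test_functions_cmult \<phi>' test_R)
    note sq = sq_integrable_test[OF \<phi>'] sq_integrable_test[OF test_R[OF \<phi>']]
      sq_integrable_test[OF test_functions_partial_deriv[OF \<phi>']]
      sq_integrable_test[OF test_functions_partial_deriv[OF test_R[OF \<phi>']]]
    have pd: "partial_deriv i (\<theta> k) = (\<lambda>x. partial_deriv i (\<phi> k) x + (- 1) * partial_deriv i (\<lambda>x. \<phi> k (R x)) x)" for i k
    proof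
      fix x
      have "smooth (\<phi> k)" "smooth (\<lambda>x. \<phi> k (R x))"
        using \<phi>'[of k] test_R[OF \<phi>'[of k]] by (auto elim: test_functionsE)
      then have d: "\<phi> k differentiable (at x)" "(\<lambda>x. \<phi> k (R x)) differentiable (at x)"
        "(\<lambda>x. (- 1) * \<phi> k (R x)) differentiable (at x)"
        by - (rule smooth_differentiable smooth_differentiable[OF smooth_cmult], assumption)+
      show "partial_deriv i (\<theta> k) x = partial_deriv i (\<phi> k) x + (- 1) * partial_deriv i (\<lambda>x. \<phi> k (R x)) x"
        unfolding \<theta>_def partial_deriv_add[OF d(1,3)] partial_deriv_cmult[OF d(2)] ..
    qed
    have eq: "abs_L2 (\<theta> k) = abs_L2 (\<phi> k) - RL (abs_L2 (\<phi> k))"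
      "abs_L2 (partial_deriv i (\<theta> k)) = abs_L2 (partial_deriv i (\<phi> k)) - RG (\<lambda>j. abs_L2 (partial_deriv j (\<phi> k))) i" for i k
      unfolding pd \<theta>_def
      by (simp_all add: comp_L2_abs[OF sq(1)] abs_partial_R[OF \<phi>', symmetric] abs_L2_diff sq)
    have lim: "(\<lambda>k. abs_L2 (\<theta> k)) \<longlonglongrightarrow> f - RL f" "(\<lambda>k. abs_L2 (partial_deriv i (\<theta> k))) \<longlonglongrightarrow> F i - RG F i" for i
      unfolding eq using \<phi>(3,4) \<open>F' = F\<close> by (auto intro!: tendsto_diff tendsto_RL tendsto_RG)
    have "weak_grad \<Omega>' (f - RL f) (\<lambda>i. F i - RG F i)"
      by (rule weak_grad_limit[OF open' weak_grad_test[OF open' \<theta>] lim])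
    moreover from this have "f - RL f \<in> H10 \<Omega>'"
      unfolding H10_iff[OF open'] using \<theta> lim by blast
    ultimately show ?thesis using Dirichlet by simp
  qed
  then show "weak_grad \<Omega>' (W bc f) (\<lambda>i. (1 / sqrt 2) *\<^sub>R (F i + sg bc *\<^sub>R RG F i))"
    "W bc f \<in> form_domain bc \<Omega>'"
    unfolding W_def by (auto intro: weak_grad_scaleR[OF open'] form_domain_scaleR[OF open'])
qed

lemma weak_grad_Ws:
  assumes "weak_grad \<Omega>' g K"
  shows "weak_grad \<Omega> (Ws bc g) (\<lambda>i. (1 / sqrt 2) *\<^sub>R restrict_L2 \<Omega> (K i + sg bc *\<^sub>R RG K i))"
  unfolding Ws_def
  by (intro weak_grad_scaleR[OF open_\<Omega>] weak_grad_restrict weak_grad_lin(1)[OF open'] assms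
      weak_grad_scaleR[OF open'] weak_grad_RL)

text \<open>In the Dirichlet case the odd part of a test function on \<open>\<Omega>'\<close>
  vanishes linearly at the hyperplane, so its restriction is in \<open>H10\<close>; closedness of
  \<open>H10\<close> covers general elements.\<close>

lemma form_domain_Ws:
  assumes "g \<in> form_domain bc \<Omega>'" shows "Ws bc g \<in> form_domain bc \<Omega>"
proof (cases bc)
  case Neumann
  then show ?thesis using assms weak_grad_Ws by (fastforce simp: H1_iff)
next
  case Dirichlet
  then obtain K \<phi> where \<phi>: "weak_grad \<Omega>' g K" "\<And>k :: nat. \<phi> k \<in> test_functions \<Omega>'"
    "(\<lambda>k. abs_L2 (\<phi> k)) \<longlonglongrightarrow> g" "\<And>i. (\<lambda>k. abs_L2 (partial_deriv i (\<phi> k))) \<longlonglongrightarrow> K i"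
    using assms by (auto simp: H10_iff[OF open'])
  define u where "u k = Ws Dirichlet (abs_L2 (\<phi> k))" for k
  have H: "u k \<in> H10 \<Omega>" for k
  proof -
    have \<theta>: "(\<lambda>x. \<phi> k x + (- 1) * \<phi> k (R x)) \<in> test_functions \<Omega>'"
      by (intro test_functions_add test_functions_cmult test_R \<phi>(2))
    obtain C where C: "C \<ge> 0" "\<And>x. cmod (\<phi> k x - \<phi> k (R x)) \<le> C * \<bar>inner a x\<bar>"
      by (rule odd_bound[OF \<phi>(2)[of k]]) (auto intro: that)
    have "restrict_L2 \<Omega> (abs_L2 (\<lambda>x. \<phi> k x + (- 1) * \<phi> k (R x))) \<in> H10 \<Omega>"
      by (rule restrict_odd_H10[OF \<theta>]) (use C in auto)
    moreover have "abs_L2 (\<lambda>x. \<phi> k x + (- 1) * \<phi> k (R x)) = abs_L2 (\<phi> k) + sg Dirichlet *\<^sub>R RL (abs_L2 (\<phi> k))"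
      using sq_integrable_test[OF \<phi>(2)] sq_integrable_test[OF test_R[OF \<phi>(2)]]
      by (simp add: comp_L2_abs abs_L2_diff)
    ultimately have "restrict_L2 \<Omega> (abs_L2 (\<phi> k) + sg Dirichlet *\<^sub>R RL (abs_L2 (\<phi> k))) \<in> form_domain Dirichlet \<Omega>"
      by simp
    from form_domain_scaleR[OF open_\<Omega> this] show ?thesis by (simp add: u_def Ws_def)
  qed
  have "Ws Dirichlet g \<in> H10 \<Omega>"
  proof (rule H10_closed[OF open_\<Omega> H])
    show "weak_grad \<Omega> (u k) (\<lambda>i. (1 / sqrt 2) *\<^sub>R restrict_L2 \<Omega>
        (abs_L2 (partial_deriv i (\<phi> k)) + sg Dirichlet *\<^sub>R RG (\<lambda>j. abs_L2 (partial_deriv j (\<phi> k))) i))" for k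
      unfolding u_def by (rule weak_grad_Ws[OF weak_grad_test[OF open' \<phi>(2)]])
    show "u \<longlonglongrightarrow> Ws Dirichlet g"
      unfolding u_def by (rule bounded_linear.tendsto[OF bounded_linear_Ws \<phi>(3)])
    show "(\<lambda>k. (1 / sqrt 2) *\<^sub>R restrict_L2 \<Omega>
        (abs_L2 (partial_deriv i (\<phi> k)) + sg Dirichlet *\<^sub>R RG (\<lambda>j. abs_L2 (partial_deriv j (\<phi> k))) i))
        \<longlonglongrightarrow> (1 / sqrt 2) *\<^sub>R restrict_L2 \<Omega> (K i + sg Dirichlet *\<^sub>R RG K i)" for i
      by (intro tendsto_scaleR tendsto_const bounded_linear.tendsto[OF bounded_linear_restrict_L2[OF sets_\<Omega>]]
          tendsto_add \<phi>(4) tendsto_RG)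
  qed
  then show ?thesis using Dirichlet by simp
qed

subsection \<open>The extended potential\<close>

text \<open>The extension is even for both boundary conditions. It is 0 on the hyperplane and off
  \<open>\<Omega>'\<close>, hence measurable on the whole space and unchanged by the cutoff to
  \<open>\<Omega>'\<close>.\<close>

definition Vext :: "((real, 'n) vec \<Rightarrow> real) \<Rightarrow> (real, 'n) vec \<Rightarrow> real" where
  "Vext V x = indicator \<Omega> x * V x + indicator \<Omega> (R x) * V (R x)"

lemma Vext_R: "Vext V (R x) = Vext V x"
  by (simp add: Vext_def)

lemma Vext_\<Omega>: "x \<in> \<Omega> \<Longrightarrow> Vext V x = V x" and Vext_\<Omega>m: "x \<in> \<Omega>m \<Longrightarrow> Vext V x = V (R x)"
  by (auto simp: Vext_def indicator_def \<Omega>_def \<Omega>m_def)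

lemma indicator_Vext: "indicator \<Omega>' x * Vext V x = Vext V x"
  by (auto simp: Vext_def indicator_def \<Omega>_def)

lemma Vext_measurable:
  assumes "V \<in> borel_measurable (lebesgue_on \<Omega>)" shows "Vext V \<in> borel_measurable lebesgue"
proof -
  have [measurable]: "(\<lambda>x. indicator \<Omega> x * V x) \<in> borel_measurable lebesgue"
    using assms by (simp add: borel_measurable_restrict_space_iff)
  have [measurable]: "(\<lambda>x. indicator \<Omega> (R x) * V (R x)) \<in> borel_measurable lebesgue"
    by (rule measurable_compose[OF meas_R]) measurable
  show ?thesis unfolding Vext_def by measurable
qed

text \<open>The values on the two halves coincide up to a reflection and the hyperplane is a null
  set. A general \<open>h\<close> covers both the modulus and the negative part occurring in
  \<open>cost_bound\<close>.\<close>

lemma esssup_Vext: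
  fixes h :: "real \<Rightarrow> ereal"
  assumes V: "V \<in> borel_measurable (lebesgue_on \<Omega>)" and h: "h \<in> borel_measurable borel"
  shows "esssup (lebesgue_on \<Omega>') (\<lambda>x. h (Vext V x)) = esssup (lebesgue_on \<Omega>) (\<lambda>x. h (V x))"
proof (rule antisym)
  have m: "(\<lambda>x. h (V x)) \<in> borel_measurable (lebesgue_on \<Omega>)"
    using V h by (rule measurable_compose)
  have m': "(\<lambda>x. h (Vext V x)) \<in> borel_measurable (lebesgue_on \<Omega>')"
    using measurable_compose[OF Vext_measurable[OF V] h] by (rule measurable_restrict_space1)
  show "esssup (lebesgue_on \<Omega>') (\<lambda>x. h (Vext V x)) \<le> esssup (lebesgue_on \<Omega>) (\<lambda>x. h (V x))"
  proof (rule esssup_I[OF m'])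
    have "AE x in lebesgue_on \<Omega>. h (V x) \<le> esssup (lebesgue_on \<Omega>) (\<lambda>x. h (V x))"
      by (rule esssup_AE)
    then have *: "AE x in lebesgue. x \<in> \<Omega> \<longrightarrow> h (V x) \<le> esssup (lebesgue_on \<Omega>) (\<lambda>x. h (V x))"
      by (simp add: AE_restrict_space_iff)
    have "AE x in lebesgue. x \<in> \<Omega>' \<longrightarrow> h (Vext V x) \<le> esssup (lebesgue_on \<Omega>) (\<lambda>x. h (V x))"
      using * AE_R[OF *] AE_hyperplane
    proof eventually_elim
      case (elim x)
      show ?case
      proof
        assume "x \<in> \<Omega>'"
        then consider "x \<in> \<Omega>" | "x \<in> \<Omega>m" using elim(3) by (fastforce simp: \<Omega>_def \<Omega>m_def)
        then show "h (Vext V x) \<le> esssup (lebesgue_on \<Omega>) (\<lambda>x. h (V x))"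
          using elim(1,2) by cases (auto simp: Vext_\<Omega> Vext_\<Omega>m R_in_\<Omega>)
      qed
    qed
    then show "AE x in lebesgue_on \<Omega>'. h (Vext V x) \<le> esssup (lebesgue_on \<Omega>) (\<lambda>x. h (V x))"
      by (simp add: AE_restrict_space_iff)
  qed
  show "esssup (lebesgue_on \<Omega>) (\<lambda>x. h (V x)) \<le> esssup (lebesgue_on \<Omega>') (\<lambda>x. h (Vext V x))"
  proof (rule esssup_I[OF m])
    have "AE x in lebesgue_on \<Omega>'. h (Vext V x) \<le> esssup (lebesgue_on \<Omega>') (\<lambda>x. h (Vext V x))"
      by (rule esssup_AE)
    then have "AE x in lebesgue. x \<in> \<Omega>' \<longrightarrow> h (Vext V x) \<le> esssup (lebesgue_on \<Omega>') (\<lambda>x. h (Vext V x))"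
      by (simp add: AE_restrict_space_iff)
    then have "AE x in lebesgue. x \<in> \<Omega> \<longrightarrow> h (V x) \<le> esssup (lebesgue_on \<Omega>') (\<lambda>x. h (Vext V x))"
      by eventually_elim (use \<Omega>_sub in \<open>auto simp: Vext_\<Omega>\<close>)
    then show "AE x in lebesgue_on \<Omega>. h (V x) \<le> esssup (lebesgue_on \<Omega>') (\<lambda>x. h (Vext V x))"
      by (simp add: AE_restrict_space_iff)
  qed
qed

lemma Vext_Linf:
  assumes "Linf_on \<Omega> V"
  shows "Linf_on \<Omega>' (Vext V)" "Linf_norm \<Omega>' (Vext V) = Linf_norm \<Omega> V"
    "Linf_norm \<Omega>' (\<lambda>x. max (- Vext V x) 0) = Linf_norm \<Omega> (\<lambda>x. max (- V x) 0)"
proof -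
  have V: "V \<in> borel_measurable (lebesgue_on \<Omega>)" using assms by (simp add: Linf_on_def)
  note e1 = esssup_Vext[OF V, of "\<lambda>r. ereal \<bar>r\<bar>"]
  note e2 = esssup_Vext[OF V, of "\<lambda>r. ereal \<bar>max (- r) 0\<bar>"]
  show "Linf_on \<Omega>' (Vext V)"
    using assms e1 measurable_restrict_space1[OF Vext_measurable[OF V]] by (simp add: Linf_on_def)
  show "Linf_norm \<Omega>' (Vext V) = Linf_norm \<Omega> V" using e1 by (simp add: Linf_norm_def)
  show "Linf_norm \<Omega>' (\<lambda>x. max (- Vext V x) 0) = Linf_norm \<Omega> (\<lambda>x. max (- V x) 0)"
    using e2 by (simp add: Linf_norm_def)
qed

context
  fixes V :: "(real, 'n) vec \<Rightarrow> real" and M :: real and bc :: boundary_condition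
  assumes V: "ess_bounded (\<lambda>x. indicator \<Omega> x * V x) M"
begin

lemma V': "ess_bounded (\<lambda>x. indicator \<Omega>' x * Vext V x) M"
proof -
  have b: "AE x in lebesgue. \<bar>indicator \<Omega> x * V x\<bar> \<le> M" "0 \<le> M" and
    [measurable]: "(\<lambda>x. indicator \<Omega> x * V x) \<in> borel_measurable lebesgue"
    using V by (auto simp: ess_bounded_def)
  have [measurable]: "(\<lambda>x. indicator \<Omega> (R x) * V (R x)) \<in> borel_measurable lebesgue"
    by (rule measurable_compose[OF meas_R]) measurable
  have "Vext V \<in> borel_measurable lebesgue" unfolding Vext_def by measurable
  moreover have "AE x in lebesgue. \<bar>Vext V x\<bar> \<le> M"
    using b(1) AE_R[OF b(1)]
    by eventually_elim (auto simp: Vext_def indicator_def \<Omega>_def)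
  ultimately show ?thesis using b(2) by (simp add: ess_bounded_def indicator_Vext)
qed

abbreviation "mV \<equiv> mult_L2 (\<lambda>x. indicator \<Omega> x * V x)"
abbreviation "mV' \<equiv> mult_L2 (\<lambda>x. indicator \<Omega>' x * Vext V x)"

lemma RL_mV': "RL (mV' u) = mV' (RL u)"
  by (rule comp_mult_L2[OF V' V']) (unfold indicator_Vext, simp add: Vext_R)

lemma Ws_mV': "Ws bc (mV' g) = mV (Ws bc g)"
proof -
  have "restrict_L2 \<Omega> (mV' u) = mV (restrict_L2 \<Omega> u)" for u
    by (rule L2_eqI)
      (use rep_restrict_L2[OF sets_\<Omega>, of "mV' u"] rep_restrict_L2[OF sets_\<Omega>, of u]
         rep_mult_L2[OF V', of u] rep_mult_L2[OF V, of "restrict_L2 \<Omega> u"]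
       in \<open>eventually_elim; auto simp: indicator_def Vext_\<Omega> subsetD[OF \<Omega>_sub]\<close>)
  then show ?thesis
    unfolding Ws_def RL_mV'
    by (simp flip: linear_simps[OF bounded_linear_mult_L2[OF V]] linear_simps[OF bounded_linear_mult_L2[OF V']])
qed

text \<open>Here \<open>g\<close> ranges over the whole form domain on \<open>\<Omega>'\<close>,
  without any parity, since the definition of the operator tests against all of it. The adjoint
  \<open>Ws\<close> filters out the relevant parity.\<close>

lemma form_W:
  assumes f: "f \<in> form_domain bc \<Omega>" and g: "g \<in> form_domain bc \<Omega>'"
  shows "schroedinger_form \<Omega>' (Vext V) (W bc f) g = schroedinger_form \<Omega> V f (Ws bc g)"
proof -
  obtain F where F: "weak_grad \<Omega> f F" using form_domain_weak_grad[OF f] by blast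
  obtain K where K: "weak_grad \<Omega>' g K" using form_domain_weak_grad[OF g] by blast
  have f2: "f \<in> L2_on \<Omega>" and F2: "F i \<in> L2_on \<Omega>" for i using F by (auto simp: weak_grad_def)
  have r: "cinner (F i) (restrict_L2 \<Omega> u) = cinner (F i) u" for i u
    using F2[of i] by (simp add: cinner_restrict_L2 restrict_L2_ident)
  have "(\<Sum>i\<in>UNIV. cinner ((1 / sqrt 2) *\<^sub>R (F i + sg bc *\<^sub>R RG F i)) (K i))
      = of_real (1 / sqrt 2) * ((\<Sum>i\<in>UNIV. cinner (F i) (K i)) + of_real (sg bc) * (\<Sum>i\<in>UNIV. cinner (RG F i) (K i)))"
    by (simp only: cinner_scaleR_left cinner_add_left sum.distrib sum_distrib_left distrib_left)
  also have "\<dots> = (\<Sum>i\<in>UNIV. cinner (F i) ((1 / sqrt 2) *\<^sub>R restrict_L2 \<Omega> (K i + sg bc *\<^sub>R RG K i)))"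
    unfolding cinner_RG_sum
    by (simp only: cinner_scaleR_right r cinner_add_right sum.distrib sum_distrib_left distrib_left)
  finally have "(\<Sum>i\<in>UNIV. cinner ((1 / sqrt 2) *\<^sub>R (F i + sg bc *\<^sub>R RG F i)) (K i))
      = (\<Sum>i\<in>UNIV. cinner (F i) ((1 / sqrt 2) *\<^sub>R restrict_L2 \<Omega> (K i + sg bc *\<^sub>R RG K i)))" .
  moreover have "cinner (mV' (W bc f)) g = cinner (mV f) (Ws bc g)"
    by (metis cinner_mult_L2_right[OF V'] cinner_mult_L2_right[OF V] cinner_W[OF f2] Ws_mV')
  ultimately show ?thesis
    by (simp add: schroedinger_form_eq[OF open' V' weak_grad_W(1)[OF f F] K]
        schroedinger_form_eq[OF open_\<Omega> V F weak_grad_Ws[OF K]])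
qed

text \<open>From \<Omega> to \<open>\<Omega>'\<close> the test element \<open>g\<close> is replaced
  by \<open>Ws bc g\<close>; backwards, a test element on \<Omega> is lifted by \<open>W\<close>,
  and \<open>Ws_W\<close> removes the lift again.\<close>

lemma schroedinger_op_W:
  assumes f: "f \<in> L2_on \<Omega>" and h: "h \<in> L2_on \<Omega>"
  shows "(W bc f, W bc h) \<in> schroedinger_op bc \<Omega>' (Vext V) \<longleftrightarrow> (f, h) \<in> schroedinger_op bc \<Omega> V"
proof
  assume "(f, h) \<in> schroedinger_op bc \<Omega> V"
  then have fd: "f \<in> form_domain bc \<Omega>"
    and eq: "\<And>g. g \<in> form_domain bc \<Omega> \<Longrightarrow> schroedinger_form \<Omega> V f g = cinner h g"
    by (auto simp: schroedinger_op_def)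
  obtain F where F: "weak_grad \<Omega> f F" using form_domain_weak_grad[OF fd] by blast
  show "(W bc f, W bc h) \<in> schroedinger_op bc \<Omega>' (Vext V)"
    using weak_grad_W(2)[OF fd F] W_in[OF h] form_W[OF fd] eq form_domain_Ws cinner_W[OF h]
    by (auto simp: schroedinger_op_def)
next
  assume "(W bc f, W bc h) \<in> schroedinger_op bc \<Omega>' (Vext V)"
  then have fd': "W bc f \<in> form_domain bc \<Omega>'"
    and eq: "\<And>g. g \<in> form_domain bc \<Omega>' \<Longrightarrow> schroedinger_form \<Omega>' (Vext V) (W bc f) g = cinner (W bc h) g"
    by (auto simp: schroedinger_op_def)
  have fd: "f \<in> form_domain bc \<Omega>" using form_domain_Ws[OF fd'] by (simp add: Ws_W f)
  have "schroedinger_form \<Omega> V f g = cinner h g" if g: "g \<in> form_domain bc \<Omega>" for g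
  proof -
    obtain K where K: "weak_grad \<Omega> g K" using form_domain_weak_grad[OF g] by blast
    have g2: "g \<in> L2_on \<Omega>" using K by (simp add: weak_grad_def)
    note Wg = weak_grad_W(2)[OF g K]
    show ?thesis
      using form_W[OF fd Wg] eq[OF Wg] by (simp add: Ws_W g2 cinner_W h)
  qed
  then show "(f, h) \<in> schroedinger_op bc \<Omega> V" using fd h by (auto simp: schroedinger_op_def)
qed

text \<open>Supplies the hypothesis of \<open>C0_commute\<close> that the symmetry preserves the
  generator.\<close>

lemma schroedinger_op_RL:
  assumes "(f, h) \<in> schroedinger_op bc \<Omega>' (Vext V)"
  shows "(RL f, RL h) \<in> schroedinger_op bc \<Omega>' (Vext V)"
proof -
  from assms have fd: "f \<in> form_domain bc \<Omega>'" and h: "h \<in> L2_on \<Omega>'"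
    and eq: "\<And>g. g \<in> form_domain bc \<Omega>' \<Longrightarrow> schroedinger_form \<Omega>' (Vext V) f g = cinner h g"
    by (auto simp: schroedinger_op_def)
  obtain F where F: "weak_grad \<Omega>' f F" using form_domain_weak_grad[OF fd] by blast
  have "schroedinger_form \<Omega>' (Vext V) (RL f) g = cinner (RL h) g" if g: "g \<in> form_domain bc \<Omega>'" for g
  proof -
    obtain K where K: "weak_grad \<Omega>' g K" using form_domain_weak_grad[OF g] by blast
    have "schroedinger_form \<Omega>' (Vext V) (RL f) g = schroedinger_form \<Omega>' (Vext V) f (RL g)"
      by (simp add: schroedinger_form_eq[OF open' V' weak_grad_RL[OF F] K]
          schroedinger_form_eq[OF open' V' F weak_grad_RL[OF K]] cinner_RG_sum RL_mV'[symmetric] cinner_comp_left)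
    then show ?thesis using eq[OF form_domain_RL[OF g]] by (simp add: cinner_comp_left)
  qed
  then show ?thesis using form_domain_RL[OF fd] L2_on_RL[OF h] by (auto simp: schroedinger_op_def)
qed

end

end

section \<open>Transfer of null-controllability to the half domain\<close>

context reflection
begin

context
  fixes V :: "(real, 'n) vec \<Rightarrow> real" and bc :: boundary_condition and E' :: "real \<Rightarrow> ((real, 'n) vec) L2 \<Rightarrow> ((real, 'n) vec) L2"
  assumes VL: "Linf_on \<Omega> V"
    and E': "is_exp_semigroup (L2_on \<Omega>') (schroedinger_op bc \<Omega>' (Vext V)) E'"
begin

lemma C0': "C0_semigroup (L2_on \<Omega>') E'"
  using E' by (simp add: is_exp_semigroup_def)

lemma gen': "generator (L2_on \<Omega>') E' = {(f, - h) | f h. (f, h) \<in> schroedinger_op bc \<Omega>' (Vext V)}"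
  using E' by (simp add: is_exp_semigroup_def)

lemma E'_RL:
  assumes "t \<ge> 0" "f \<in> L2_on \<Omega>'" shows "RL (E' t f) = E' t (RL f)"
proof -
  obtain M where V: "ess_bounded (\<lambda>x. indicator \<Omega> x * V x) M"
    using ess_bounded_Linf[OF sets_\<Omega> VL] by blast
  show ?thesis
  proof (rule C0_commute[OF sets_\<Omega>' C0' _ bounded_linear_comp_L2 L2_on_RL _ assms])
    fix f h assume "(f, h) \<in> generator (L2_on \<Omega>') E'"
    then have fh: "(f, - h) \<in> schroedinger_op bc \<Omega>' (Vext V)" by (auto simp: gen')
    show "inner h f \<le> M * (norm f)\<^sup>2"
      using schroedinger_op_semibounded[OF open' V'[OF V] fh] by simp
    show "(RL f, RL h) \<in> generator (L2_on \<Omega>') E'"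
      unfolding gen'
      using schroedinger_op_RL[OF V fh] by (force simp: RL_simps)
  qed
qed

lemma W_Ws_E':
  assumes "t \<ge> 0" "f \<in> L2_on \<Omega>" shows "W bc (Ws bc (E' t (W bc f))) = E' t (W bc f)"
proof (rule W_Ws_sym)
  note Wf = W_in[OF assms(2), of bc]
  show "E' t (W bc f) \<in> L2_on \<Omega>'" by (rule C0_in[OF sets_\<Omega>' C0' assms(1) Wf])
  show "RL (E' t (W bc f)) = sg bc *\<^sub>R E' t (W bc f)"
    by (simp add: E'_RL assms Wf RL_W C0_scaleR[OF sets_\<Omega>' C0'])
qed

text \<open>The compression of the semigroup \<open>E'\<close> to the half domain.
  \<open>null_control\<close> provides \<open>E'\<close> on \<open>\<Omega>'\<close>, so the
  semigroup on \<Omega> is obtained from it instead of being assumed.\<close>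

definition Eh :: "real \<Rightarrow> ((real, 'n) vec) L2 \<Rightarrow> ((real, 'n) vec) L2" where
  "Eh t f = Ws bc (E' t (W bc f))"

lemma W_E: "t \<ge> 0 \<Longrightarrow> f \<in> L2_on \<Omega> \<Longrightarrow> W bc (Eh t f) = E' t (W bc f)"
  unfolding Eh_def by (rule W_Ws_E')

lemma C0_E: "C0_semigroup (L2_on \<Omega>) Eh"
proof -
  note C0_in = C0_in[OF sets_\<Omega>' C0'] and C0_add = C0_add[OF sets_\<Omega>' C0']
    and C0_cscale = C0_cscale[OF sets_\<Omega>' C0'] and C0_bound = C0_bound[OF sets_\<Omega>' C0']
    and C0_0 = C0_0[OF sets_\<Omega>' C0'] and C0_semi = C0_semi[OF sets_\<Omega>' C0']
    and C0_lim = C0_lim[OF sets_\<Omega>' C0']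
  show ?thesis
    unfolding C0_semigroup_def
  proof (intro conjI allI impI ballI)
    fix t :: real assume t: "t \<ge> 0"
    show "Eh t f \<in> L2_on \<Omega>" for f by (simp add: Eh_def Ws_in)
    show "Eh t (f + g) = Eh t f + Eh t g" if "f \<in> L2_on \<Omega>" "g \<in> L2_on \<Omega>" for f g
      using t that by (simp add: Eh_def W_simps Ws_simps C0_add W_in)
    show "Eh t (cscale c f) = cscale c (Eh t f)" if "f \<in> L2_on \<Omega>" for c f
      using t that by (simp add: Eh_def W_cscale Ws_cscale C0_cscale W_in)
    obtain K where K: "\<And>f. f \<in> L2_on \<Omega>' \<Longrightarrow> norm (E' t f) \<le> K * norm f"
      using C0_bound[OF t] by blast
    have "norm (Eh t f) \<le> K * norm f" if "f \<in> L2_on \<Omega>" for f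
      unfolding Eh_def using norm_Ws[of bc "E' t (W bc f)"] K[OF W_in[OF that], of bc] norm_W[OF that, of bc] by simp
    then show "\<exists>K. \<forall>f\<in>L2_on \<Omega>. norm (Eh t f) \<le> K * norm f" by blast
  next
    fix f assume f: "f \<in> L2_on \<Omega>"
    show "Eh 0 f = f" using f by (simp add: Eh_def C0_0 W_in Ws_W)
    show "((\<lambda>t. Eh t f) \<longlongrightarrow> f) (at_right 0)"
      using bounded_linear.tendsto[OF bounded_linear_Ws C0_lim[OF W_in[OF f]], of bc bc] f
      by (simp add: Eh_def Ws_W)
  next
    \<comment> \<open>A compression is in general not multiplicative. Here the inserted
      \<open>W bc (Ws bc _)\<close> acts as the identity, because orbits of symmetric elements stay
      symmetric.\<close>
    fix s t :: real and f assume "0 \<le> s" "0 \<le> t" "f \<in> L2_on \<Omega>"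
    then show "Eh (s + t) f = Eh s (Eh t f)"
      by (simp add: Eh_def C0_semi W_in W_Ws_E')
  qed
qed

lemma generator_E:
  assumes f: "f \<in> L2_on \<Omega>" and h: "h \<in> L2_on \<Omega>"
  shows "(f, h) \<in> generator (L2_on \<Omega>) Eh \<longleftrightarrow> (W bc f, W bc h) \<in> generator (L2_on \<Omega>') E'"
proof
  assume "(f, h) \<in> generator (L2_on \<Omega>) Eh"
  then have "((\<lambda>t. (1 / t) *\<^sub>R (Eh t f - f)) \<longlongrightarrow> h) (at_right 0)" by (simp add: generator_def)
  from bounded_linear.tendsto[OF bounded_linear_W this, of bc]
  have "((\<lambda>t. (1 / t) *\<^sub>R (E' t (W bc f) - W bc f)) \<longlongrightarrow> W bc h) (at_right 0)"
    by (rule Lim_transform_eventually)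
      (auto simp: eventually_at_right_field W_simps W_E f intro!: exI[of _ 1])
  then show "(W bc f, W bc h) \<in> generator (L2_on \<Omega>') E'"
    by (simp add: generator_def W_in f h)
next
  assume "(W bc f, W bc h) \<in> generator (L2_on \<Omega>') E'"
  then have "((\<lambda>t. (1 / t) *\<^sub>R (E' t (W bc f) - W bc f)) \<longlongrightarrow> W bc h) (at_right 0)"
    by (simp add: generator_def)
  from bounded_linear.tendsto[OF bounded_linear_Ws this, of bc]
  have "((\<lambda>t. (1 / t) *\<^sub>R (Eh t f - f)) \<longlongrightarrow> h) (at_right 0)"
    by (simp add: Ws_simps Eh_def Ws_W f h)
  then show "(f, h) \<in> generator (L2_on \<Omega>) Eh" by (simp add: generator_def f h)
qed

lemma exp_semigroup_E: "is_exp_semigroup (L2_on \<Omega>) (schroedinger_op bc \<Omega> V) Eh"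
  unfolding is_exp_semigroup_def
proof
  obtain M where V: "ess_bounded (\<lambda>x. indicator \<Omega> x * V x) M"
    using ess_bounded_Linf[OF sets_\<Omega> VL] by blast
  have "(f, k) \<in> generator (L2_on \<Omega>) Eh \<longleftrightarrow> (f, - k) \<in> schroedinger_op bc \<Omega> V" for f k
  proof (cases "f \<in> L2_on \<Omega> \<and> k \<in> L2_on \<Omega>")
    case True
    then have f: "f \<in> L2_on \<Omega>" and k: "k \<in> L2_on \<Omega>" and k': "- k \<in> L2_on \<Omega>"
      using L2_on_scale(3)[OF sets_\<Omega>] by auto
    have "(f, k) \<in> generator (L2_on \<Omega>) Eh \<longleftrightarrow> (W bc f, W bc (- k)) \<in> schroedinger_op bc \<Omega>' (Vext V)"
      unfolding generator_E[OF f k] gen' W_simps by force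
    then show ?thesis by (simp add: schroedinger_op_W[OF V f k'])
  next
    case False
    have "f \<in> L2_on \<Omega> \<and> k \<in> L2_on \<Omega>" if "(f, - k) \<in> schroedinger_op bc \<Omega> V"
      using that form_domain_weak_grad[of f bc \<Omega>] L2_on_scale(3)[OF sets_\<Omega>, of "- k"]
      by (auto simp: schroedinger_op_def weak_grad_def)
    then show ?thesis using False by (auto simp: generator_def)
  qed
  then show "generator (L2_on \<Omega>) Eh = {(f, - h) | f h. (f, h) \<in> schroedinger_op bc \<Omega> V}"
    by (force intro: set_eqI)
qed (rule C0_E)

end

section \<open>Transfer of controls and of the control cost\<close>

lemma bounded_linear_measurable_L2:
  fixes L :: "('a::euclidean_space) L2 \<Rightarrow> ('b::euclidean_space) L2"
  assumes "bounded_linear L" "v \<in> borel_measurable N"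
  shows "(\<lambda>s. L (v s)) \<in> borel_measurable N"
  by (rule measurable_compose[OF assms(2)])
    (intro borel_measurable_continuous_onI linear_continuous_on assms)

lemma integrable_norm_sq_L2:
  fixes L :: "('a::euclidean_space) L2 \<Rightarrow> ('b::euclidean_space) L2"
  assumes L: "bounded_linear L" "\<And>u. norm (L u) \<le> norm u"
    and v: "v \<in> borel_measurable N" "integrable N (\<lambda>s. (norm (v s))\<^sup>2)"
  shows "integrable N (\<lambda>s. (norm (L (v s)))\<^sup>2)"
proof (rule Bochner_Integration.integrable_bound[OF v(2)])
  note [measurable] = bounded_linear_measurable_L2[OF L(1) v(1)]
  show "(\<lambda>s. (norm (L (v s)))\<^sup>2) \<in> borel_measurable N" by measurable
  show "AE s in N. norm ((norm (L (v s)))\<^sup>2) \<le> norm ((norm (v s))\<^sup>2)"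
    using L(2) by (auto intro: power_mono)
qed

lemma null_control_transfer:
  assumes VL: "Linf_on \<Omega> V" and \<omega>: "\<omega> \<in> sets lebesgue" "\<omega>' \<in> sets lebesgue" "\<Omega> \<inter> \<omega>' = \<Omega> \<inter> \<omega>"
    and \<omega>'_sym: "\<And>x. R x \<in> \<omega>' \<longleftrightarrow> x \<in> \<omega>'" and u\<^sub>0: "u\<^sub>0 \<in> L2_on \<Omega>"
    and v': "null_control \<Omega>' (schroedinger_op bc \<Omega>' (Vext V)) \<omega>' T (W bc u\<^sub>0) v'" and T: "T > 0"
  shows "\<exists>v. null_control \<Omega> (schroedinger_op bc \<Omega> V) \<omega> T u\<^sub>0 v \<and> control_norm \<omega> T v \<le> control_norm \<omega>' T v'"
proof -
  let ?N = "lebesgue_on {0<..<T}"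
  from v' obtain E' where v'c: "v' \<in> controls \<Omega>' T"
    and E': "is_exp_semigroup (L2_on \<Omega>') (schroedinger_op bc \<Omega>' (Vext V)) E'"
    and z: "E' T (W bc u\<^sub>0) + (LINT s|?N. E' (T - s) (restrict_L2 \<omega>' (v' s))) = 0"
    by (auto simp: null_control_def)
  define E where "E = Eh bc E'"
  have E_eq: "E t f = Ws bc (E' t (W bc f))" for t f unfolding E_def by (rule Eh_def[OF VL E'])
  have E: "is_exp_semigroup (L2_on \<Omega>) (schroedinger_op bc \<Omega> V) E"
    unfolding E_def by (rule exp_semigroup_E[OF VL E'])
  note C0' = C0'[OF VL E']
  have C0: "C0_semigroup (L2_on \<Omega>) E" using E by (simp add: is_exp_semigroup_def)
  have v'm: "v' \<in> borel_measurable ?N" "\<And>s. s \<in> {0<..<T} \<Longrightarrow> v' s \<in> L2_on \<Omega>'"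
    and v'i: "integrable ?N (\<lambda>s. (norm (v' s))\<^sup>2)"
    using v'c by (auto simp: controls_def)
  show ?thesis
  proof (cases "integrable ?N (\<lambda>s. E' (T - s) (restrict_L2 \<omega>' (v' s)))")
    case False
    \<comment> \<open>The Bochner integral is \<open>0\<close> by convention, so the free evolution already vanishes at time \<open>T\<close>.\<close>
    then have "E' T (W bc u\<^sub>0) = 0" using z by (simp add: not_integrable_integral_eq)
    then have "E T u\<^sub>0 = 0" by (simp add: E_eq Ws_simps)
    moreover have r0: "restrict_L2 \<omega> 0 = 0" using linear_simps[OF bounded_linear_restrict_L2[OF \<omega>(1)]] by simp
    moreover have "E t 0 = 0" if "t \<ge> 0" for t
      using C0_scaleR[OF sets_\<Omega> C0 that zero_L2_on, of 0] by simp
    then have "(LINT s|?N. E (T - s) (restrict_L2 \<omega> 0)) = (LINT s|?N. 0)"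
      unfolding r0 by (intro Bochner_Integration.integral_cong) auto
    moreover have "(\<lambda>s. 0) \<in> controls \<Omega> T" by (simp add: controls_def zero_L2_on)
    ultimately have "null_control \<Omega> (schroedinger_op bc \<Omega> V) \<omega> T u\<^sub>0 (\<lambda>s. 0)"
      using E unfolding null_control_def by auto
    moreover have "control_norm \<omega> T (\<lambda>s. 0) \<le> control_norm \<omega>' T v'"
      by (simp add: control_norm_def r0)
    ultimately show ?thesis by blast
  next
    case True
    define v where "v s = Ws bc (v' s)" for s
    \<comment> \<open>The symmetry of \<open>\<omega>'\<close> lets the restriction commute with
      \<open>RL\<close>, and inside \<Omega> the two control sets agree.\<close>
    have rW: "restrict_L2 \<omega> (v s) = Ws bc (restrict_L2 \<omega>' (v' s))" for s
    proof -
      have "restrict_L2 \<omega> (restrict_L2 \<Omega> u) = restrict_L2 \<Omega> (restrict_L2 \<omega>' u)" for u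
        using \<omega>(3) by (simp add: restrict_restrict_L2 \<omega>(1,2) Int_commute)
      then show ?thesis
        unfolding v_def Ws_def
        by (simp add: comp_restrict_L2[OF \<omega>(2,2) \<omega>'_sym] linear_simps[OF bounded_linear_restrict_L2[OF \<omega>(1)]]
            linear_simps[OF bounded_linear_restrict_L2[OF \<omega>(2)], symmetric])
    qed
    have vc: "v \<in> controls \<Omega> T"
      unfolding controls_def v_def
      using bounded_linear_measurable_L2[OF bounded_linear_Ws v'm(1)]
        integrable_norm_sq_L2[OF bounded_linear_Ws norm_Ws v'm(1) v'i]
      by (auto simp: Ws_in)
    have "(LINT s|?N. E (T - s) (restrict_L2 \<omega> (v s)))
        = (LINT s|?N. Ws bc (E' (T - s) (restrict_L2 \<omega>' (v' s))))"
    proof (rule Bochner_Integration.integral_cong)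
      fix s assume "s \<in> space ?N"
      then have s: "s \<in> {0<..<T}" by simp
      define p where "p = restrict_L2 \<omega>' (v' s)"
      have p: "p \<in> L2_on \<Omega>'"
        using v'm(2)[OF s] restrict_restrict_L2[OF \<omega>(2) sets_\<Omega>', of "v' s"]
          restrict_restrict_L2[OF sets_\<Omega>' \<omega>(2), of "v' s"]
        unfolding p_def L2_on_iff[OF sets_\<Omega>'] by (simp add: Int_commute)
      \<comment> \<open>Lifting the projected control gives its symmetric part. As \<open>E'\<close>
        commutes with \<open>RL\<close>, the symmetrisation moves outside, where \<open>Ws\<close>
        absorbs it.\<close>
      have "E (T - s) (restrict_L2 \<omega> (v s)) = Ws bc (E' (T - s) ((1 / 2) *\<^sub>R (p + sg bc *\<^sub>R RL p)))"
        unfolding E_eq rW by (simp add: W_Ws p flip: p_def)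
      also have "E' (T - s) ((1 / 2) *\<^sub>R (p + sg bc *\<^sub>R RL p))
          = (1 / 2) *\<^sub>R (E' (T - s) p + sg bc *\<^sub>R RL (E' (T - s) p))"
        using s p L2_on_RL[OF p] L2_on_lin(1)[OF sets_\<Omega>'] L2_on_scale(2)[OF sets_\<Omega>']
        by (simp add: C0_scaleR[OF sets_\<Omega>' C0'] C0_add[OF sets_\<Omega>' C0'] E'_RL[OF VL E'])
      finally show "E (T - s) (restrict_L2 \<omega> (v s)) = Ws bc (E' (T - s) (restrict_L2 \<omega>' (v' s)))"
        by (simp add: Ws_symmetrized p_def)
    qed simp
    also have "\<dots> = Ws bc (LINT s|?N. E' (T - s) (restrict_L2 \<omega>' (v' s)))"
      by (rule integral_bounded_linear[OF bounded_linear_Ws True])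
    finally have "E T u\<^sub>0 + (LINT s|?N. E (T - s) (restrict_L2 \<omega> (v s))) = Ws bc 0"
      unfolding z[symmetric] by (simp add: E_eq Ws_simps)
    then have "null_control \<Omega> (schroedinger_op bc \<Omega> V) \<omega> T u\<^sub>0 v"
      using E vc unfolding null_control_def by (auto simp: Ws_simps)
    moreover have "control_norm \<omega> T v \<le> control_norm \<omega>' T v'"
      unfolding control_norm_def rW
    proof (intro real_sqrt_le_mono integral_mono)
      note r = bounded_linear_restrict_L2[OF \<omega>(2)]
      note rm = bounded_linear_measurable_L2[OF r v'm(1)]
      show i: "integrable ?N (\<lambda>s. (norm (restrict_L2 \<omega>' (v' s)))\<^sup>2)"
        by (rule integrable_norm_sq_L2[OF r norm_restrict_L2[OF \<omega>(2)] v'm(1) v'i])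
      show "integrable ?N (\<lambda>s. (norm (Ws bc (restrict_L2 \<omega>' (v' s))))\<^sup>2)"
        by (rule integrable_norm_sq_L2[OF bounded_linear_Ws norm_Ws rm i])
      show "(norm (Ws bc (restrict_L2 \<omega>' (v' s))))\<^sup>2 \<le> (norm (restrict_L2 \<omega>' (v' s)))\<^sup>2" for s
        by (intro power_mono norm_Ws) auto
    qed
    ultimately show ?thesis by blast
  qed
qed

text \<open>\<open>W\<close> maps unit initial states to unit initial states, and each control on
  \<open>\<Omega>'\<close> yields one on \<Omega> of no larger norm; so the infima, and then the
  suprema, compare.\<close>

theorem null_controllable_transfer:
  assumes VL: "Linf_on \<Omega> V" and \<omega>: "\<omega> \<in> sets lebesgue" "\<omega>' \<in> sets lebesgue" "\<Omega> \<inter> \<omega>' = \<Omega> \<inter> \<omega>"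
    and \<omega>'_sym: "\<And>x. R x \<in> \<omega>' \<longleftrightarrow> x \<in> \<omega>'" and T: "T > 0"
    and nc: "null_controllable \<Omega>' (schroedinger_op bc \<Omega>' (Vext V)) \<omega>' T"
    and cost: "control_cost \<Omega>' (schroedinger_op bc \<Omega>' (Vext V)) \<omega>' T \<le> c"
  shows "null_controllable \<Omega> (schroedinger_op bc \<Omega> V) \<omega> T"
    and "control_cost \<Omega> (schroedinger_op bc \<Omega> V) \<omega> T \<le> c"
proof -
  note transfer = null_control_transfer[OF VL \<omega> \<omega>'_sym _ _ T]
  show "null_controllable \<Omega> (schroedinger_op bc \<Omega> V) \<omega> T"
    using nc W_in transfer unfolding null_controllable_def by meson
  have "control_cost \<Omega> (schroedinger_op bc \<Omega> V) \<omega> T \<le> control_cost \<Omega>' (schroedinger_op bc \<Omega>' (Vext V)) \<omega>' T"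
    unfolding control_cost_def
  proof (rule SUP_least)
    fix u\<^sub>0 assume "u\<^sub>0 \<in> {u\<^sub>0 \<in> L2_on \<Omega>. norm u\<^sub>0 = 1}"
    then have u: "u\<^sub>0 \<in> L2_on \<Omega>" "norm u\<^sub>0 = 1" by auto
    have "(INF v\<in>{v. null_control \<Omega> (schroedinger_op bc \<Omega> V) \<omega> T u\<^sub>0 v}. ereal (control_norm \<omega> T v))
        \<le> (INF v\<in>{v. null_control \<Omega>' (schroedinger_op bc \<Omega>' (Vext V)) \<omega>' T (W bc u\<^sub>0) v}. ereal (control_norm \<omega>' T v))"
      using transfer[OF u(1)] by (intro INF_mono) fastforce
    also have "\<dots> \<le> (SUP u\<^sub>0\<in>{u\<^sub>0 \<in> L2_on \<Omega>'. norm u\<^sub>0 = 1}.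
        INF v\<in>{v. null_control \<Omega>' (schroedinger_op bc \<Omega>' (Vext V)) \<omega>' T u\<^sub>0 v}. ereal (control_norm \<omega>' T v))"
      by (rule SUP_upper) (simp add: W_in u norm_W)
    finally show "(INF v\<in>{v. null_control \<Omega> (schroedinger_op bc \<Omega> V) \<omega> T u\<^sub>0 v}. ereal (control_norm \<omega> T v))
        \<le> (SUP u\<^sub>0\<in>{u\<^sub>0 \<in> L2_on \<Omega>'. norm u\<^sub>0 = 1}.
        INF v\<in>{v. null_control \<Omega>' (schroedinger_op bc \<Omega>' (Vext V)) \<omega>' T u\<^sub>0 v}. ereal (control_norm \<omega>' T v))" .
  qed
  then show "control_cost \<Omega> (schroedinger_op bc \<Omega> V) \<omega> T \<le> c" using cost by (rule order_trans)
qed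

end

section \<open>Equidistributed sets under reflection\<close>

text \<open>Thickness is measured by balls instead of grid cells because reflections map balls to
  balls but in general destroy the grid.\<close>

definition relatively_fat :: "real \<Rightarrow> 'a::metric_space set \<Rightarrow> 'a set \<Rightarrow> real \<Rightarrow> bool" where
  "relatively_fat \<delta> A \<omega> r \<longleftrightarrow> (\<forall>c. ball c r \<subseteq> A \<longrightarrow> (\<exists>z. ball z \<delta> \<subseteq> ball c r \<inter> \<omega>))"

context reflection
begin

text \<open>The hyperplane splits off a half ball, which contains a ball of half the radius.\<close>

lemma relatively_fat_reflect:
  assumes fat: "relatively_fat \<delta> \<Omega> \<omega> r" and r: "r > 0"
  shows "relatively_fat \<delta> \<Omega>' (\<omega> \<union> R -` \<omega>) (2 * r)"
proof -
  have pos: "\<exists>z. ball z \<delta> \<subseteq> ball c (2 * r) \<inter> \<omega>" if c: "ball c (2 * r) \<subseteq> \<Omega>'" "inner a c \<ge> 0" for c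
  proof -
    have sub: "ball (c + r *\<^sub>R a) r \<subseteq> ball c (2 * r)"
    proof
      fix y assume "y \<in> ball (c + r *\<^sub>R a) r"
      moreover have "dist c (c + r *\<^sub>R a) = r" using r by (simp add: dist_norm norm_a)
      ultimately show "y \<in> ball c (2 * r)" using dist_triangle[of c y "c + r *\<^sub>R a"] by simp
    qed
    have "inner a y > 0" if "y \<in> ball (c + r *\<^sub>R a) r" for y
    proof -
      have "\<bar>inner a (y - (c + r *\<^sub>R a))\<bar> \<le> norm (y - (c + r *\<^sub>R a))"
        using Cauchy_Schwarz_ineq2[of a "y - (c + r *\<^sub>R a)"] by (simp add: norm_a)
      moreover have "norm (y - (c + r *\<^sub>R a)) < r" using that by (simp add: dist_norm norm_minus_commute)
      ultimately show ?thesis using c(2) by (simp add: inner_diff_right inner_add_right inner_a_a)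
    qed
    then have "ball (c + r *\<^sub>R a) r \<subseteq> \<Omega>" using sub c(1) by (auto simp: \<Omega>_def)
    then obtain z where "ball z \<delta> \<subseteq> ball (c + r *\<^sub>R a) r \<inter> \<omega>" using fat by (auto simp: relatively_fat_def)
    then show ?thesis using sub by blast
  qed
  have "\<exists>z. ball z \<delta> \<subseteq> ball c (2 * r) \<inter> (\<omega> \<union> R -` \<omega>)" if c: "ball c (2 * r) \<subseteq> \<Omega>'" for c
  proof (cases "inner a c \<ge> 0")
    case True
    then show ?thesis using pos[OF c] by blast
  next
    case False
    have R_ball: "R y \<in> ball x s \<longleftrightarrow> y \<in> ball (R x) s" for x y s
      using dist_R[of x "R y"] by simp
    have "ball (R c) (2 * r) \<subseteq> \<Omega>'"
    proof
      fix y assume "y \<in> ball (R c) (2 * r)"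
      then have "R y \<in> \<Omega>'" using R_ball c by blast
      then show "y \<in> \<Omega>'" by simp
    qed
    then obtain z where z: "ball z \<delta> \<subseteq> ball (R c) (2 * r) \<inter> \<omega>" using pos[of "R c"] False by auto
    have "ball (R z) \<delta> \<subseteq> ball c (2 * r) \<inter> R -` \<omega>"
    proof
      fix y assume "y \<in> ball (R z) \<delta>"
      then have "R y \<in> ball (R c) (2 * r) \<inter> \<omega>" using z R_ball by blast
      then show "y \<in> ball c (2 * r) \<inter> R -` \<omega>" using R_ball[of y "R c"] by auto
    qed
    then show ?thesis by blast
  qed
  then show ?thesis unfolding relatively_fat_def by blast
qed

lemma reflected_union:
  assumes "\<omega> \<in> sets lebesgue" "\<omega> \<subseteq> \<Omega>"
  shows "\<omega> \<union> R -` \<omega> \<in> sets lebesgue" "\<omega> \<union> R -` \<omega> \<subseteq> \<Omega>'"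
proof -
  have "R -` \<omega> \<in> sets lebesgue" using measurable_sets[OF meas_R assms(1)] by simp
  then show "\<omega> \<union> R -` \<omega> \<in> sets lebesgue" using assms(1) by simp
  have "x \<in> \<Omega>'" if "R x \<in> \<omega>" for x
  proof -
    have "R x \<in> \<Omega>'" using that assms(2) \<Omega>_sub by blast
    then show ?thesis by simp
  qed
  then show "\<omega> \<union> R -` \<omega> \<subseteq> \<Omega>'" using assms(2) \<Omega>_sub by blast
qed

lemma control_reflect:
  assumes V: "Linf_on \<Omega> V" and \<omega>: "\<omega> \<in> sets lebesgue" "\<omega> \<subseteq> \<Omega>" and T: "T > 0"
    and ctrl: "null_controllable \<Omega>' (schroedinger_op bc \<Omega>' (Vext V)) (\<omega> \<union> R -` \<omega>) T \<and>
      control_cost \<Omega>' (schroedinger_op bc \<Omega>' (Vext V)) (\<omega> \<union> R -` \<omega>) T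
        \<le> ereal (cost_bound D L \<delta> \<Omega>' (Vext V) T)"
  shows "null_controllable \<Omega> (schroedinger_op bc \<Omega> V) \<omega> T \<and>
    control_cost \<Omega> (schroedinger_op bc \<Omega> V) \<omega> T \<le> ereal (cost_bound D L \<delta> \<Omega> V T)"
proof -
  note S = reflected_union(1)[OF \<omega>]
  have I: "\<Omega> \<inter> (\<omega> \<union> R -` \<omega>) = \<Omega> \<inter> \<omega>"
    using \<omega>(2) by (auto simp: \<Omega>_def)
  have "cost_bound D L \<delta> \<Omega>' (Vext V) T = cost_bound D L \<delta> \<Omega> V T"
    unfolding cost_bound_def Vext_Linf(2,3)[OF V] ..
  moreover have "R x \<in> \<omega> \<union> R -` \<omega> \<longleftrightarrow> x \<in> \<omega> \<union> R -` \<omega>" for x by auto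
  ultimately show ?thesis
    using null_controllable_transfer[OF V \<omega>(1) S I _ T conjunct1[OF ctrl] conjunct2[OF ctrl]] by simp
qed

end

lemma equidistributed_cell:
  fixes S :: "(real^'n::finite) set"
  assumes "equidistributed G \<delta> S"
  obtains z :: "int^'n \<Rightarrow> real^'n"
  where "\<And>j. ball (z j) \<delta> \<subseteq> {x. \<forall>i. G * of_int (j $ i) < x $ i \<and> x $ i < G * of_int (j $ i) + G} \<inter> S"
proof -
  obtain z :: "int^'n \<Rightarrow> real^'n"
    where z: "\<forall>j. ball (z j) \<delta> \<subseteq> {x. \<forall>i. G * of_int (j $ i) < x $ i \<and> x $ i < G * of_int (j $ i) + G}"
      "(\<Union>j. ball (z j) \<delta>) \<subseteq> S"
    using assms by (auto simp only: equidistributed_def)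
  show thesis
    by (rule that[of z], rule Int_greatest[OF z(1)[rule_format]]) (use z(2) in blast)
qed

text \<open>Every point of the grid cell containing the centre differs from it by less than
  \<open>G\<close> in both coordinates, so its distance, bounded by the l1 norm, is less than
  \<open>2 * G\<close> and the whole cell lies in the ball.\<close>

lemma equidistributed_fat:
  fixes S :: "(real^2) set"
  assumes S: "equidistributed G \<delta> S" and G: "G > 0" and r: "2 * G \<le> r"
  shows "relatively_fat \<delta> A (A \<inter> S) r"
  unfolding relatively_fat_def
proof (intro allI impI)
  fix c :: "real^2" assume c: "ball c r \<subseteq> A"
  obtain z :: "int^2 \<Rightarrow> real^2" where
    z: "\<And>j. ball (z j) \<delta> \<subseteq> {x. \<forall>i. G * of_int (j $ i) < x $ i \<and> x $ i < G * of_int (j $ i) + G} \<inter> S"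
    by (rule equidistributed_cell[OF S]) (rule that)
  define j :: "int^2" where "j = (\<chi> i. \<lfloor>c $ i / G\<rfloor>)"
  have j: "G * of_int (j $ i) \<le> c $ i" "c $ i < G * of_int (j $ i) + G" for i
  proof -
    have "of_int (j $ i) \<le> c $ i / G" "c $ i / G < of_int (j $ i) + 1"
      using of_int_floor_le[of "c $ i / G"] floor_correct[of "c $ i / G"] by (auto simp: j_def)
    then show "G * of_int (j $ i) \<le> c $ i" "c $ i < G * of_int (j $ i) + G"
      using G by (auto simp: field_simps)
  qed
  have "x \<in> ball c r" if "\<forall>i. G * of_int (j $ i) < x $ i \<and> x $ i < G * of_int (j $ i) + G" for x
  proof -
    have "\<bar>(c - x) $ i\<bar> < G" for i
      using that[rule_format, of i] j[of i] by (simp add: abs_less_iff)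
    from this[of 1] this[of 2] have "(\<Sum>i\<in>UNIV. \<bar>(c - x) $ i\<bar>) < 2 * G"
      unfolding sum_2 by linarith
    then show ?thesis using norm_le_l1_cart[of "c - x"] r by (simp add: dist_norm)
  qed
  then have "ball (z j) \<delta> \<subseteq> ball c r" using z[of j] by fast
  then have "ball (z j) \<delta> \<subseteq> ball c r \<inter> (A \<inter> S)" using z[of j] c by fast
  then show "\<exists>z. ball z \<delta> \<subseteq> ball c r \<inter> (A \<inter> S)" by blast
qed

section \<open>The quadrant\<close>

abbreviation quadrant :: "(real^2) set" where
  "quadrant \<equiv> open_rectangle (\<lambda>_. 0) (\<lambda>_. \<infinity>)"

lemma quadrant_eq: "quadrant = {x. \<forall>i. 0 < x $ i}"
  by (auto simp: open_rectangle_def zero_ereal_def)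

text \<open>Equidistribution refers to the whole plane. Adding the complement of the quadrant to
  \<omega> fills all cells with a negative index and does not change the control set inside the
  quadrant.\<close>

lemma quadrant_control:
  assumes D: "is_cost_constant TYPE(2) D" and T: "T > 0" and \<delta>: "0 < \<delta>" "\<delta> < L / 2"
    and V: "Linf_on quadrant V" and \<omega>: "\<omega> \<in> sets lebesgue" "\<omega> \<subseteq> quadrant"
    and cells: "\<And>j :: int^2. (\<And>i. 0 \<le> j $ i) \<Longrightarrow>
      \<exists>z. ball z \<delta> \<subseteq> {x. \<forall>i. L * of_int (j $ i) < x $ i \<and> x $ i < L * of_int (j $ i) + L} \<inter> \<omega>"
  shows "null_controllable quadrant (schroedinger_op bc quadrant V) \<omega> T \<and>
    control_cost quadrant (schroedinger_op bc quadrant V) \<omega> T \<le> ereal (cost_bound D L \<delta> quadrant V T)"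
proof -
  let ?cell = "\<lambda>j :: int^2. {x :: real^2. \<forall>i. L * of_int (j $ i) < x $ i \<and> x $ i < L * of_int (j $ i) + L}"
  have L: "L > 0" using \<delta> by simp
  define S where "S = \<omega> \<union> - quadrant"
  have open_Q: "open quadrant"
    unfolding quadrant_eq forall_2 by (intro open_Collect_conj open_Collect_less continuous_intros)
  have QS: "quadrant \<inter> S = \<omega>" using \<omega>(2) by (auto simp: S_def)
  have "\<exists>z. ball z \<delta> \<subseteq> ?cell j \<inter> S" for j :: "int^2"
  proof (cases "\<forall>i. 0 \<le> j $ i")
    case True
    then show ?thesis using cells[of j] unfolding S_def by blast
  next
    case False
    then obtain i where i: "j $ i < 0" by (auto simp: not_le)
    define c :: "real^2" where "c = (\<chi> i. L * of_int (j $ i) + L / 2)"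
    have "ball c \<delta> \<subseteq> ?cell j"
    proof
      fix x assume "x \<in> ball c \<delta>"
      then have *: "\<bar>(c - x) $ k\<bar> < L / 2" for k
        using component_le_norm_cart[of "c - x" k] \<delta> by (simp add: dist_norm)
      have "L * of_int (j $ k) < x $ k \<and> x $ k < L * of_int (j $ k) + L" for k
        using *[of k] unfolding c_def abs_less_iff vector_minus_component vec_lambda_beta by linarith
      then show "x \<in> ?cell j" by simp
    qed
    moreover have "?cell j \<subseteq> - quadrant"
    proof
      fix x assume x: "x \<in> ?cell j"
      have "of_int (j $ i) + 1 \<le> (0 :: real)" using i by linarith
      then have "L * (of_int (j $ i) + 1) \<le> 0" using L by (simp add: mult_nonneg_nonpos)
      then have "x $ i < 0" using x by (auto simp: distrib_left dest!: spec[of _ i])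
      then show "x \<in> - quadrant" by (auto simp: quadrant_eq intro!: exI[of _ i])
    qed
    ultimately show ?thesis unfolding S_def by blast
  qed
  then have "\<forall>j. \<exists>z. ball z \<delta> \<subseteq> ?cell j \<inter> S" ..
  from choice[OF this] obtain z where z: "\<forall>j. ball (z j) \<delta> \<subseteq> ?cell j \<inter> S" ..
  have "S \<in> sets lebesgue" unfolding S_def using \<omega>(1) open_Q by auto
  then have "equidistributed L \<delta> S"
    unfolding equidistributed_def using z
    by (intro conjI exI[of _ z] UN_least) (simp_all only: Int_subset_iff simp_thms)
  moreover have "{x :: real^2. \<forall>i. 0 < x $ i \<and> x $ i < L} \<subseteq> quadrant" by (auto simp: quadrant_eq)
  ultimately have "(\<forall>i :: 2. (0 :: ereal) < \<infinity>) \<and> {x :: real^2. \<forall>i. 0 < x $ i \<and> x $ i < L} \<subseteq> quadrant \<and>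
      Linf_on quadrant V \<and> equidistributed L \<delta> S \<and> T > 0"
    using V T by simp
  then show ?thesis
    by (rule D[unfolded is_cost_constant_def, THEN conjunct2, rule_format, OF L conjI[OF \<delta>],
          where \<alpha> = "\<lambda>_. 0" and \<beta> = "\<lambda>_. \<infinity>" and S = S, unfolded QS])
qed

section \<open>Sectors\<close>

text \<open>Multiplying the inequality of \<open>sector\<close> by the cosine removes the tangent,
  so the angle \<pi>/2, at which the doubling ends, is included.\<close>

definition wedge :: "real \<Rightarrow> (real^2) set" where
  "wedge \<theta> = {p. 0 < p $ 2 \<and> cos \<theta> * p $ 2 < sin \<theta> * p $ 1}"

lemma sector_eq_wedge:
  assumes "0 < \<theta>" "\<theta> < pi / 2" shows "sector \<theta> = wedge \<theta>"
proof -
  have c: "cos \<theta> > 0" using assms by (intro cos_gt_zero) auto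
  have s: "sin \<theta> > 0" using assms by (intro sin_gt_zero) auto
  have "q < tan \<theta> * p \<longleftrightarrow> cos \<theta> * q < sin \<theta> * p" for p q :: real
    using c by (simp add: tan_def field_simps)
  moreover have "0 < p" if "0 < q" "cos \<theta> * q < sin \<theta> * p" for p q :: real
  proof -
    have "0 < cos \<theta> * q" using c that(1) by simp
    then have "0 < sin \<theta> * p" using that(2) by linarith
    then show ?thesis using s by (simp add: zero_less_mult_iff)
  qed
  ultimately show ?thesis by (auto simp: sector_def wedge_def)
qed

lemma wedge_quadrant: "wedge (pi / 2) = quadrant"
  by (auto simp: wedge_def quadrant_eq forall_2)

text \<open>Unit normal of the line at angle \<theta>, positive on the side of the positive first
  axis, so that the half cut out of \<open>wedge (2 * \<theta>)\<close> is the lower one.\<close>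

definition sector_normal :: "real \<Rightarrow> real^2" where
  "sector_normal \<theta> = vector [sin \<theta>, - cos \<theta>]"

lemma inner_sector_normal: "inner (sector_normal \<theta>) p = sin \<theta> * p $ 1 - cos \<theta> * p $ 2"
  by (simp add: sector_normal_def inner_vec_def sum_2 vector_2)

text \<open>The reflected second coordinate is the expression whose sign defines the upper side of
  \<open>wedge (2 * \<theta>)\<close>: the reflection exchanges the two sides of the doubled
  wedge.\<close>

lemma reflected_component:
  "(p - (2 * inner (sector_normal \<theta>) p) *\<^sub>R sector_normal \<theta>) $ 2 = sin (2 * \<theta>) * p $ 1 - cos (2 * \<theta>) * p $ 2"
  "(p - (2 * inner (sector_normal \<theta>) p) *\<^sub>R sector_normal \<theta>) $ 1 = cos (2 * \<theta>) * p $ 1 + sin (2 * \<theta>) * p $ 2"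
proof -
  have s: "sin \<theta> * sin \<theta> = 1 - cos \<theta> * cos \<theta>"
    using sin_cos_squared_add3[of \<theta>] by linarith
  show "(p - (2 * inner (sector_normal \<theta>) p) *\<^sub>R sector_normal \<theta>) $ 2 = sin (2 * \<theta>) * p $ 1 - cos (2 * \<theta>) * p $ 2"
    unfolding inner_sector_normal sin_double cos_double power2_eq_square s
    by (simp add: sector_normal_def vector_2 algebra_simps)
  have "(p - (2 * inner (sector_normal \<theta>) p) *\<^sub>R sector_normal \<theta>) $ 1
      = p $ 1 - 2 * (sin \<theta> * sin \<theta>) * p $ 1 + 2 * sin \<theta> * cos \<theta> * p $ 2"
    unfolding inner_sector_normal by (simp add: sector_normal_def vector_2 algebra_simps)
  also have "\<dots> = cos (2 * \<theta>) * p $ 1 + sin (2 * \<theta>) * p $ 2"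
    unfolding sin_double cos_double power2_eq_square s by (simp add: algebra_simps)
  finally show "(p - (2 * inner (sector_normal \<theta>) p) *\<^sub>R sector_normal \<theta>) $ 1 = cos (2 * \<theta>) * p $ 1 + sin (2 * \<theta>) * p $ 2" .
qed

lemma reflection_wedge: "reflection (sector_normal \<theta>) (wedge (2 * \<theta>))"
proof
  have "inner (sector_normal \<theta>) (sector_normal \<theta>) = 1"
    using sin_cos_squared_add3[of \<theta>]
    by (simp add: inner_sector_normal) (simp add: sector_normal_def vector_2 add.commute)
  then show "norm (sector_normal \<theta>) = 1" by (simp add: norm_eq_sqrt_inner)
  show "open (wedge (2 * \<theta>))"
    unfolding wedge_def by (intro open_Collect_conj open_Collect_less continuous_intros)
  fix p assume p: "p \<in> wedge (2 * \<theta>)"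
  define c s where "c = cos (2 * \<theta>)" and "s = sin (2 * \<theta>)"
  \<comment> \<open>The upper inequality for the reflected point reduces to
    \<open>0 < p $ 2\<close>.\<close>
  have "s * (c * p $ 1 + s * p $ 2) - c * (s * p $ 1 - c * p $ 2) = (s * s + c * c) * p $ 2"
    by (simp add: algebra_simps)
  also have "\<dots> = p $ 2" using sin_cos_squared_add3[of "2 * \<theta>"] by (simp add: c_def s_def add.commute)
  finally show "p - (2 * inner (sector_normal \<theta>) p) *\<^sub>R sector_normal \<theta> \<in> wedge (2 * \<theta>)"
    using p unfolding wedge_def mem_Collect_eq reflected_component by (simp add: c_def s_def)
qed

text \<open>The defining expression of the doubled wedge is 2 cos \<theta> times that of
  \<open>wedge \<theta>\<close> plus the second coordinate, so its inequality follows on the lower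
  half.\<close>

lemma wedge_half:
  assumes "0 < \<theta>" "\<theta> < pi / 2" shows "reflection.\<Omega> (sector_normal \<theta>) (wedge (2 * \<theta>)) = wedge \<theta>"
proof -
  interpret reflection "sector_normal \<theta>" "wedge (2 * \<theta>)" by (rule reflection_wedge)
  have c: "cos \<theta> > 0" using assms by (intro cos_gt_zero) auto
  have "cos (2 * \<theta>) * p $ 2 < sin (2 * \<theta>) * p $ 1" if "0 < p $ 2" "cos \<theta> * p $ 2 < sin \<theta> * p $ 1" for p :: "real^2"
  proof -
    have "sin (2 * \<theta>) * p $ 1 - cos (2 * \<theta>) * p $ 2 = 2 * cos \<theta> * (sin \<theta> * p $ 1 - cos \<theta> * p $ 2) + p $ 2"
      unfolding sin_double cos_double_cos power2_eq_square by (simp add: algebra_simps)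
    moreover have "0 < 2 * cos \<theta> * (sin \<theta> * p $ 1 - cos \<theta> * p $ 2)" using c that(2) by simp
    ultimately show ?thesis using that(1) by linarith
  qed
  then show ?thesis unfolding \<Omega>_def by (auto simp: wedge_def inner_sector_normal)
qed

lemma wedge_control_step:
  assumes \<theta>: "0 < \<theta>" "\<theta> < pi / 2" and T: "T > 0"
    and V: "Linf_on (wedge \<theta>) V" and \<omega>: "\<omega> \<in> sets lebesgue" "\<omega> \<subseteq> wedge \<theta>"
    and ctrl: "\<And>V'. Linf_on (wedge (2 * \<theta>)) V' \<Longrightarrow>
      null_controllable (wedge (2 * \<theta>)) (schroedinger_op bc (wedge (2 * \<theta>)) V')
        (\<omega> \<union> reflection.R (sector_normal \<theta>) -` \<omega>) T \<and>
      control_cost (wedge (2 * \<theta>)) (schroedinger_op bc (wedge (2 * \<theta>)) V')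
        (\<omega> \<union> reflection.R (sector_normal \<theta>) -` \<omega>) T \<le> ereal (cost_bound D L \<delta> (wedge (2 * \<theta>)) V' T)"
  shows "null_controllable (wedge \<theta>) (schroedinger_op bc (wedge \<theta>) V) \<omega> T \<and>
    control_cost (wedge \<theta>) (schroedinger_op bc (wedge \<theta>) V) \<omega> T \<le> ereal (cost_bound D L \<delta> (wedge \<theta>) V T)"
proof -
  interpret reflection "sector_normal \<theta>" "wedge (2 * \<theta>)" by (rule reflection_wedge)
  note w = wedge_half[OF \<theta>]
  show ?thesis
    by (rule control_reflect[unfolded w, OF V \<omega> T ctrl[OF Vext_Linf(1)[unfolded w, OF V]]])
qed

text \<open>The cell size \<open>L\<close> stays fixed while each reflection doubles the angle and
  the radius of fatness. At the quadrant the radius is L/2, that of the ball inscribed in a cell.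
  \<open>V\<close> and \<omega> are generalised because both change with every reflection.\<close>

lemma wedge_control:
  assumes D: "is_cost_constant TYPE(2) D" and T: "T > 0" and \<delta>: "0 < \<delta>" "\<delta> < L / 2"
    and V: "Linf_on (wedge (pi / 2 ^ Suc m)) V"
    and \<omega>: "\<omega> \<in> sets lebesgue" "\<omega> \<subseteq> wedge (pi / 2 ^ Suc m)"
    and fat: "relatively_fat \<delta> (wedge (pi / 2 ^ Suc m)) \<omega> (L / 2 ^ Suc m)"
  shows "null_controllable (wedge (pi / 2 ^ Suc m)) (schroedinger_op bc (wedge (pi / 2 ^ Suc m)) V) \<omega> T \<and>
    control_cost (wedge (pi / 2 ^ Suc m)) (schroedinger_op bc (wedge (pi / 2 ^ Suc m)) V) \<omega> T
      \<le> ereal (cost_bound D L \<delta> (wedge (pi / 2 ^ Suc m)) V T)"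
  using V \<omega> fat
proof (induction m arbitrary: V \<omega>)
  case 0
  have w: "wedge (pi / 2 ^ Suc 0) = quadrant" using wedge_quadrant by simp
  have L: "L > 0" using \<delta> by simp
  show ?case
    unfolding w
  proof (rule quadrant_control[OF D T \<delta>])
    fix j :: "int^2" assume j: "\<And>i. 0 \<le> j $ i"
    let ?cell = "{x :: real^2. \<forall>i. L * of_int (j $ i) < x $ i \<and> x $ i < L * of_int (j $ i) + L}"
    define c :: "real^2" where "c = (\<chi> i. L * of_int (j $ i) + L / 2)"
    have sub: "ball c (L / 2) \<subseteq> ?cell"
    proof
      fix x assume "x \<in> ball c (L / 2)"
      then have *: "\<bar>(c - x) $ k\<bar> < L / 2" for k
        using component_le_norm_cart[of "c - x" k] by (simp add: dist_norm)
      have "L * of_int (j $ k) < x $ k \<and> x $ k < L * of_int (j $ k) + L" for k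
        using *[of k] unfolding c_def abs_less_iff vector_minus_component vec_lambda_beta by linarith
      then show "x \<in> ?cell" by simp
    qed
    also have "?cell \<subseteq> quadrant"
    proof -
      have "0 \<le> L * of_int (j $ i)" for i using L j[of i] by simp
      then show ?thesis unfolding quadrant_eq by (auto intro: le_less_trans)
    qed
    finally obtain z where "ball z \<delta> \<subseteq> ball c (L / 2) \<inter> \<omega>"
      using 0(4)[unfolded w relatively_fat_def, rule_format, of c] by auto
    then show "\<exists>z. ball z \<delta> \<subseteq> ?cell \<inter> \<omega>" using sub by blast
  qed (rule 0(1-3)[unfolded w])+
next
  case (Suc m)
  define \<theta> where "\<theta> = pi / 2 ^ Suc (Suc m)"
  have \<theta>2: "2 * \<theta> = pi / 2 ^ Suc m" by (simp add: \<theta>_def)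
  have \<theta>: "0 < \<theta>" "\<theta> < pi / 2"
  proof -
    show "0 < \<theta>" by (simp add: \<theta>_def)
    have "(2 :: real) ^ 1 < 2 ^ Suc (Suc m)" by (rule power_strict_increasing) auto
    then show "\<theta> < pi / 2" unfolding \<theta>_def using divide_strict_left_mono[of 2 "2 ^ Suc (Suc m)" pi] by simp
  qed
  interpret reflection "sector_normal \<theta>" "wedge (2 * \<theta>)" by (rule reflection_wedge)
  note w = wedge_half[OF \<theta>]
  note ru = reflected_union[unfolded w, OF Suc.prems(2,3)[folded \<theta>_def]]
  have "L / 2 ^ Suc (Suc m) > 0" using \<delta> by simp
  from relatively_fat_reflect[OF _ this, of \<delta> \<omega>]
  have fat: "relatively_fat \<delta> (wedge (2 * \<theta>)) (\<omega> \<union> R -` \<omega>) (L / 2 ^ Suc m)"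
    using Suc.prems(4) unfolding w \<theta>_def[symmetric] by simp
  show ?case
    unfolding \<theta>_def[symmetric]
    by (rule wedge_control_step[OF \<theta> T Suc.prems(1-3)[folded \<theta>_def] Suc.IH[folded \<theta>2, OF _ ru fat]])
qed

text \<open>
  For the angle \<open>\<pi>/4\<close> halving a ball would lose too much, but here the reflection swaps the coordinates
  and therefore maps grid cells to grid cells.
\<close>

lemma wedge_control_quarter:
  assumes D: "is_cost_constant TYPE(2) D" and T: "T > 0" and \<delta>: "0 < \<delta>" "\<delta> < G / 2"
    and V: "Linf_on (wedge (pi / 4)) V" and S: "equidistributed G \<delta> S"
  shows "null_controllable (wedge (pi / 4)) (schroedinger_op bc (wedge (pi / 4)) V) (wedge (pi / 4) \<inter> S) T \<and>
    control_cost (wedge (pi / 4)) (schroedinger_op bc (wedge (pi / 4)) V) (wedge (pi / 4) \<inter> S) T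
      \<le> ereal (cost_bound D (4 * G) \<delta> (wedge (pi / 4)) V T)"
proof -
  have G: "G > 0" using \<delta> by simp
  have pi4: "0 < pi / 4" "pi / 4 < pi / 2" by auto
  interpret reflection "sector_normal (pi / 4)" "wedge (2 * (pi / 4))" by (rule reflection_wedge)
  note w = wedge_half[OF pi4]
  define \<omega> where "\<omega> = wedge (pi / 4) \<inter> S"
  have \<omega>: "\<omega> \<in> sets lebesgue" "\<omega> \<subseteq> wedge (pi / 4)"
    using S sets_\<Omega> unfolding w by (auto simp: \<omega>_def equidistributed_def)
  have Q: "wedge (2 * (pi / 4)) = quadrant" using wedge_quadrant by simp
  have wedge4: "x \<in> wedge (pi / 4) \<longleftrightarrow> 0 < x $ 2 \<and> x $ 2 < x $ 1" for x
    by (simp add: wedge_def cos_45 sin_45)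
  have swap: "R x $ 1 = x $ 2" "R x $ 2 = x $ 1" for x
    using reflected_component[of x "pi / 4"] by (simp_all add: R_def)
  obtain z :: "int^2 \<Rightarrow> real^2" where
    z: "\<And>j. ball (z j) \<delta> \<subseteq> {x. \<forall>i. G * of_int (j $ i) < x $ i \<and> x $ i < G * of_int (j $ i) + G} \<inter> S"
    by (rule equidistributed_cell[OF S]) (rule that)
  have inner_cell: "\<exists>y. \<forall>x\<in>ball y \<delta>. x \<in> \<omega> \<and>
      4 * G * of_int p < x $ 1 \<and> x $ 1 < 4 * G * of_int p + 4 * G \<and>
      4 * G * of_int q < x $ 2 \<and> x $ 2 < 4 * G * of_int q + 4 * G"
    if pq: "0 \<le> q" "q \<le> p" for p q :: int
  proof (intro exI ballI)
    \<comment> \<open>Among the 16 small cells in the large cell (p, q), the offset 2 in the first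
      coordinate selects one strictly below the diagonal, even if p = q.\<close>
    let ?k = "vector [4 * p + 2, 4 * q] :: int^2"
    fix x assume "x \<in> ball (z ?k) \<delta>"
    then have x: "x \<in> S" "\<And>i. G * of_int (?k $ i) < x $ i" "\<And>i. x $ i < G * of_int (?k $ i) + G"
      using z[of ?k] by auto
    have x1: "4 * (G * of_int p) + 2 * G < x $ 1" "x $ 1 < 4 * (G * of_int p) + 3 * G"
      and x2: "4 * (G * of_int q) < x $ 2" "x $ 2 < 4 * (G * of_int q) + G"
      using x(2,3)[of 1] x(2,3)[of 2] by (simp_all add: vector_2 algebra_simps)
    have "0 \<le> G * of_int q" "G * of_int q \<le> G * of_int p" using pq G by auto
    then show "x \<in> \<omega> \<and>
      4 * G * of_int p < x $ 1 \<and> x $ 1 < 4 * G * of_int p + 4 * G \<and>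
      4 * G * of_int q < x $ 2 \<and> x $ 2 < 4 * G * of_int q + 4 * G"
      using x(1) x1 x2 G unfolding \<omega>_def Int_iff wedge4 mult.assoc by linarith
  qed
  have cells: "\<exists>z. ball z \<delta> \<subseteq> {x. \<forall>i. 4 * G * of_int (j $ i) < x $ i \<and> x $ i < 4 * G * of_int (j $ i) + 4 * G} \<inter> (\<omega> \<union> R -` \<omega>)"
    if j: "\<And>i. 0 \<le> j $ i" for j :: "int^2"
  proof (cases "j $ 2 \<le> j $ 1")
    case True
    obtain y where "\<forall>x\<in>ball y \<delta>. x \<in> \<omega> \<and>
      4 * G * of_int (j $ 1) < x $ 1 \<and> x $ 1 < 4 * G * of_int (j $ 1) + 4 * G \<and>
      4 * G * of_int (j $ 2) < x $ 2 \<and> x $ 2 < 4 * G * of_int (j $ 2) + 4 * G"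
      using inner_cell[OF j True] ..
    then show ?thesis by (intro exI[of _ y] subsetI) (simp add: forall_2)
  next
    case False
    \<comment> \<open>Above the diagonal the ball is the mirror image of the one found in the
      transposed cell.\<close>
    then have "j $ 1 \<le> j $ 2" by simp
    from inner_cell[OF j this] obtain y where y: "\<forall>x\<in>ball y \<delta>. x \<in> \<omega> \<and>
      4 * G * of_int (j $ 2) < x $ 1 \<and> x $ 1 < 4 * G * of_int (j $ 2) + 4 * G \<and>
      4 * G * of_int (j $ 1) < x $ 2 \<and> x $ 2 < 4 * G * of_int (j $ 1) + 4 * G"
      ..
    have "R x \<in> ball y \<delta>" if "x \<in> ball (R y) \<delta>" for x
      using that dist_R[of y "R x"] by simp
    then have "x \<in> {x. \<forall>i. 4 * G * of_int (j $ i) < x $ i \<and> x $ i < 4 * G * of_int (j $ i) + 4 * G} \<inter> (\<omega> \<union> R -` \<omega>)"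
      if x: "x \<in> ball (R y) \<delta>" for x
      using bspec[OF y, of "R x"] x by (simp add: forall_2 swap)
    then show ?thesis by blast
  qed
  note ru = reflected_union[unfolded w, OF \<omega>, unfolded Q]
  have "\<delta> < 4 * G / 2" using \<delta> G by simp
  note base = quadrant_control[OF D T \<delta>(1) this _ ru cells]
  show ?thesis
    unfolding \<omega>_def[symmetric]
    by (rule wedge_control_step[OF pi4 T V \<omega>, unfolded Q, OF base])
qed

theorem proposition2p14:
  fixes n :: nat and \<Omega> :: "(real^2) set" and bc :: boundary_condition
    and V :: "real^2 \<Rightarrow> real" and G \<delta> D T :: real and S :: "(real^2) set"
  assumes "n \<ge> 2"
    and "\<Omega> = sector (pi / 2 ^ n)"
    and "Linf_on \<Omega> V"
    and "0 < G" and "0 < \<delta>" and "\<delta> < G / 2"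
    and "equidistributed G \<delta> S"
    and "is_cost_constant TYPE(2) D"
    and "T > 0"
  shows "null_controllable \<Omega> (schroedinger_op bc \<Omega> V) (\<Omega> \<inter> S) T \<and>
    control_cost \<Omega> (schroedinger_op bc \<Omega> V) (\<Omega> \<inter> S) T
      \<le> ereal (cost_bound D (4 ^ (n - 1) * G) \<delta> \<Omega> V T)"
proof -
  have "(2 :: real) ^ 1 < 2 ^ n" using assms(1) by (intro power_strict_increasing) auto
  then have "0 < pi / 2 ^ n" "pi / 2 ^ n < pi / 2" using divide_strict_left_mono[of 2 "2 ^ n" pi] by auto
  then have \<Omega>: "\<Omega> = wedge (pi / 2 ^ n)" using assms(2) by (simp add: sector_eq_wedge)
  show ?thesis
  \<comment> \<open>For n = 2 the radius L/2^n equals \<open>G\<close>, short of the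
    \<open>2 * G\<close> that \<open>equidistributed_fat\<close> requires.\<close>
  proof (cases "n = 2")
    case True
    then have "\<Omega> = wedge (pi / 4)" using \<Omega> by simp
    then show ?thesis
      using wedge_control_quarter[OF assms(8,9,5,6) _ assms(7)] assms(3) True by simp
  next
    case False
    define k where "k = n - 3"
    have n: "n = Suc (Suc (Suc k))" using False assms(1) by (simp add: k_def)
    define L where "L = 4 ^ (n - 1) * G"
    have "1 * G \<le> L" unfolding L_def using assms(4) by (intro mult_right_mono) auto
    then have \<delta>: "\<delta> < L / 2" using assms(6) by simp
    \<comment> \<open>The radius is 2^(n-2) G, and with n = k + 3 this is at least
      \<open>2 * G\<close>.\<close>
    have "L / 2 ^ n = 2 * (2 ^ k * G)"
    proof -
      have "(4 :: real) ^ k = 2 ^ k * 2 ^ k" by (simp flip: power_mult_distrib)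
      then show ?thesis by (simp add: L_def n field_simps)
    qed
    moreover have "1 * G \<le> 2 ^ k * G" using assms(4) by (intro mult_right_mono) auto
    ultimately have "2 * G \<le> L / 2 ^ n" by simp
    then have fat: "relatively_fat \<delta> \<Omega> (\<Omega> \<inter> S) (L / 2 ^ n)"
      by (rule equidistributed_fat[OF assms(7,4)])
    have "open \<Omega>"
      unfolding \<Omega> wedge_def by (intro open_Collect_conj open_Collect_less continuous_intros)
    then have "\<Omega> \<inter> S \<in> sets lebesgue" using assms(7) by (auto simp: equidistributed_def)
    then show ?thesis
      unfolding L_def[symmetric]
      by - (rule wedge_control[OF assms(8,9,5) \<delta>, of "Suc (Suc k)", folded n, folded \<Omega>, OF assms(3) _ Int_lower1 fat])
  qed
qed

end
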